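(* Let $\mathcal{E}=(E,\sigma,a)$ with $s\neq 0$ and $a\neq 0$. Then the following statements are equivalent: 1. $\mathcal{E}\simeq M_n(F)$. 2. $\tilde{\mathcal{E}}''\simeq M_{\frac{n}{m(s)m(s,a)}}(F)$. 3. $s^{\frac{1}{m(s)}}=N_{\tilde{E}'/F}(b)$ for some element $b\in(\tilde{E}')^\times$.
   Context: $F$ is a field containing a primitive $n$'th root of unity $q$ ($n\ge2$), $s,a\in F$, and $\mathcal{E}=(E,\sigma,a)$ is the $F$-algebra generated by $h,x$ with relations $xh=qhx$, $h^n=s$, $x^n=a$ (here $E=F[h]/(h^n-s)$, $\sigma(h)=qh$). For $k\ge1$, $F^{[k]}=\{u^k\mid u\in F\}$. $m(s)=\max\{k\ge1\mid k\mid n,\ s\in F^{[k]}\}$, $m(s,a)=\max\{k\ge1\mid k\mid\frac{n}{m(s)},\ a\in F^{[k]}\}$; $s^{1/m(s)}\in F$ and $a^{1/m(s,a)}\in F$ are fixed roots. $\tilde{E}'=F[X]/\big(X^{\frac{n}{m(s)m(s,a)}}-a^{\frac{1}{m(s,a)}}\big)$, which is a field and a cyclic Galois extension of $F$ with Galois group generated by $\tau'$, $\tau'(X)=q^{-m(s)m(s,a)}X$. $\tilde{\mathcal{E}}''=\tilde{E}'[H;\tau']/\big(H^{\frac{n}{m(s)m(s,a)}}-s^{\frac{1}{m(s)}}\big)$, where $He=\tau'(e)H$ for $e\in\tilde{E}'$. $N_{\tilde{E}'/F}$ is the field norm. *)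

theory Defs
  imports
    "HOL-Algebra.QuotRing"
    "HOL-Algebra.UnivPoly"
    "HOL-Algebra.Algebraic_Closure_Type"
    "HOL-Library.Poly_Mapping"
    "Jordan_Normal_Form.Matrix"
begin

text \<open>
  The ground field is a type \<open>'k\<close> of class \<open>field\<close>. A unital associative \<open>'k\<close>-algebra, not
  necessarily commutative, is represented by a record of type \<open>('k, 'r) module\<close>: a ring together
  with a scalar multiplication. The matrix algebra $M_n(F)$ is then \<open>module_mat TYPE('k) n n\<close>.
\<close>

definition alg_iso :: "('k, 'r) module \<Rightarrow> ('k, 's) module \<Rightarrow> ('r \<Rightarrow> 's) set" where
  "alg_iso A B = {\<phi> \<in> ring_iso A B.
     \<forall>c. \<forall>x\<in>carrier A. \<phi> (c \<odot>\<^bsub>A\<^esub> x) = c \<odot>\<^bsub>B\<^esub> \<phi> x}"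

definition alg_isomorphic :: "('k, 'r) module \<Rightarrow> ('k, 's) module \<Rightarrow> bool"
    (infix \<open>\<simeq>\<^sub>a\<^sub>l\<^sub>g\<close> 50) where
  "A \<simeq>\<^sub>a\<^sub>l\<^sub>g B \<longleftrightarrow> alg_iso A B \<noteq> {}"

definition quot_alg :: "('k, 'r) module \<Rightarrow> 'r set \<Rightarrow> ('k, 'r set) module" where
  "quot_alg A I = ring.extend (A Quot I)
     (module.fields (\<lambda>c C. \<Union>x\<in>C. I +>\<^bsub>A\<^esub> (c \<odot>\<^bsub>A\<^esub> x)))"


subsection \<open>Free algebras and the algebra of the relations $xh = qhx$, $h^n = s$, $x^n = a$\<close>

text \<open>
  Words are wrapped in a datatype so that concatenation can serve as the (non-commutative)
  addition of exponents; \<open>'v fword \<Rightarrow>\<^sub>0 'k\<close> is then the monoid algebra of the free monoid on \<open>'v\<close>.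
\<close>

datatype 'v fword = FWord (letters: "'v list")

instantiation fword :: (type) monoid_add
begin

definition zero_fword :: "'a fword" where
  "0 = FWord []"

definition plus_fword :: "'a fword \<Rightarrow> 'a fword \<Rightarrow> 'a fword" where
  "u + v = FWord (letters u @ letters v)"

instance
  by standard (auto simp: zero_fword_def plus_fword_def)

end

definition free_alg :: "('k::field, 'v fword \<Rightarrow>\<^sub>0 'k) module" where
  "free_alg = ring.extend ring_of_type_algebra
     (module.fields (\<lambda>c f. Poly_Mapping.single 0 c * f))"

definition gen :: "'v \<Rightarrow> ('v fword \<Rightarrow>\<^sub>0 'k::field)" where
  "gen v = Poly_Mapping.single (FWord [v]) 1"

datatype hx = Gen_h | Gen_x

definition cyc_alg :: "nat \<Rightarrow> 'k::field \<Rightarrow> 'k \<Rightarrow> 'k \<Rightarrow> ('k, (hx fword \<Rightarrow>\<^sub>0 'k) set) module" where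
  "cyc_alg n q s a = quot_alg free_alg (Idl\<^bsub>free_alg\<^esub>
     {gen Gen_x * gen Gen_h - Poly_Mapping.single 0 q * gen Gen_h * gen Gen_x,
      gen Gen_h ^ n - Poly_Mapping.single 0 s,
      gen Gen_x ^ n - Poly_Mapping.single 0 a})"


subsection \<open>The numbers $m(s)$ and $m(s,a)$\<close>

definition kth_powers :: "nat \<Rightarrow> 'k::field set" where
  "kth_powers k = {u ^ k | u. True}"

definition m1 :: "nat \<Rightarrow> 'k::field \<Rightarrow> nat" where
  "m1 n s = Max {k. k \<ge> 1 \<and> k dvd n \<and> s \<in> kth_powers k}"

definition m2 :: "nat \<Rightarrow> 'k::field \<Rightarrow> 'k \<Rightarrow> nat" where
  "m2 n s a = Max {k. k \<ge> 1 \<and> k dvd n div m1 n s \<and> a \<in> kth_powers k}"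


subsection \<open>The extension $F[X]/(X^m - c)$\<close>

definition poly_alg :: "('k::field, 'k poly) module" where
  "poly_alg = ring.extend ring_of_type_algebra (module.fields Polynomial.smult)"

definition radical_ext :: "nat \<Rightarrow> 'k::field \<Rightarrow> ('k, 'k poly set) module" where
  "radical_ext m c = quot_alg poly_alg (Idl\<^bsub>poly_alg\<^esub> {Polynomial.monom 1 m - [:c:]})"

text \<open>
  The map induced on cosets by the substitution $X \mapsto zX$. If $z \neq 0$ and $z^m = 1$, this
  substitution is an automorphism of $F[X]$ that fixes $X^m - c$, so the image of a coset of the
  ideal $(X^m - c)$ is again a coset.
\<close>

definition radical_rot :: "'k::field \<Rightarrow> 'k poly set \<Rightarrow> 'k poly set" where
  "radical_rot z C = (\<lambda>p. pcompose p [:0, z:]) ` C"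

text \<open>
  The norm of a finite Galois extension $L/F$ as the product of the Galois conjugates, an element
  of $F \cdot 1_L$. Automorphisms are made extensional so that each is counted once.
\<close>

definition Gal :: "('k::field, 'r) module \<Rightarrow> ('r \<Rightarrow> 'r) set" where
  "Gal L = alg_iso L L \<inter> extensional (carrier L)"

definition galois_norm :: "('k::field, 'r) module \<Rightarrow> 'r \<Rightarrow> 'r" where
  "galois_norm L b = (\<Otimes>\<^bsub>L\<^esub>\<phi>\<in>Gal L. \<phi> b)"


subsection \<open>Skew polynomials\<close>

text \<open>
  $R[H;\tau]$ with coefficients on the left: \<open>f\<close> stands for $\sum_i f_i H^i$, and $H e = \tau(e) H$
  gives $(f_i H^i)(g_j H^j) = f_i \tau^i(g_j) H^{i+j}$.
\<close>

definition skew_poly :: "('k, 'r) module \<Rightarrow> ('r \<Rightarrow> 'r) \<Rightarrow> ('k, nat \<Rightarrow> 'r) module" where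
  "skew_poly R \<tau> = \<lparr>
     carrier = up R,
     monoid.mult = (\<lambda>f g k. \<Oplus>\<^bsub>R\<^esub>i\<in>{..k}. f i \<otimes>\<^bsub>R\<^esub> (\<tau> ^^ i) (g (k - i))),
     one = (\<lambda>i. if i = 0 then \<one>\<^bsub>R\<^esub> else \<zero>\<^bsub>R\<^esub>),
     ring.zero = (\<lambda>i. \<zero>\<^bsub>R\<^esub>),
     add = (\<lambda>f g i. f i \<oplus>\<^bsub>R\<^esub> g i),
     module.smult = (\<lambda>c f i. c \<odot>\<^bsub>R\<^esub> f i)\<rparr>"

definition skew_var :: "('k, 'r) module \<Rightarrow> (nat \<Rightarrow> 'r)" where
  "skew_var R = (\<lambda>i. if i = 1 then \<one>\<^bsub>R\<^esub> else \<zero>\<^bsub>R\<^esub>)"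

definition skew_cyc_alg ::
    "('k, 'r) module \<Rightarrow> ('r \<Rightarrow> 'r) \<Rightarrow> nat \<Rightarrow> 'k \<Rightarrow> ('k, (nat \<Rightarrow> 'r) set) module" where
  "skew_cyc_alg R \<tau> m c = (let S = skew_poly R \<tau> in
     quot_alg S (Idl\<^bsub>S\<^esub> {skew_var R [^]\<^bsub>S\<^esub> m \<ominus>\<^bsub>S\<^esub> (c \<odot>\<^bsub>S\<^esub> \<one>\<^bsub>S\<^esub>)}))"

end

theory Submission
  imports Defs "Jordan_Normal_Form.Determinant"
begin

text \<open>
  All three statements are reduced to the solvability of one congruence. An algebra with relations
  \<open>xh = qhx\<close>, \<open>h\<^sup>n = s\<close>, \<open>x\<^sup>n = a\<close> is spanned by the \<open>n\<^sup>2\<close> monomials \<open>h\<^sup>i x\<^sup>j\<close>, and their images under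
  any homomorphism to a matrix algebra are independent because conjugation by \<open>h\<close> and \<open>x\<close> acts on
  them with distinct characters. So the algebra is \<open>M\<^sub>n(F)\<close> iff \<open>F\<^sup>n\<close> carries operators \<open>P\<close>, \<open>Q\<close> with
  these relations; the same holds for the skew polynomial quotient in degree \<open>m\<close>.

  Let \<open>n = d e m\<close>, \<open>s = r\<^sup>d\<close>, \<open>a = c\<^sup>e\<close>. Given such operators, \<open>P\<^bsup>em\<^esup>\<close> and \<open>Q\<^bsup>dm\<^esup>\<close> commute and have a common
  eigenvector \<open>w\<close> with eigenvalues \<open>r\<close> and \<open>c\<close>. If \<open>X\<^sup>m - c\<close> is irreducible, counting dimensions gives
  \<open>P\<^sup>e w = b(Q\<^sup>d) w\<close> for some polynomial \<open>b\<close>, and applying \<open>P\<^sup>e\<close> repeatedly shows that the norm of \<open>b\<close>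
  is \<open>r\<close>. Conversely an element of norm \<open>r\<close> yields one of norm \<open>s\<close> in \<open>F[X]/(X\<^sup>n - a)\<close>, and
  \<open>v \<mapsto> B \<sigma>(v)\<close> together with multiplication by \<open>X\<close> are the required operators.
\<close>

subsection \<open>Primitive roots of unity\<close>

text \<open>The maximality of m(s,a) enters through the irreducibility of \<open>X^m - c\<close>: if
  \<open>c\<close> were a k-th power with \<open>k > 1\<close> dividing \<open>m\<close>, then
  \<open>a\<close> would be an ek-th power with \<open>ek\<close> still dividing n/m(s). The second
  statement needs no arithmetic of its own. It is the case \<open>d = e = 1\<close> of the same
  analysis of a pair of operators, with \<open>q^(de)\<close> in place of \<open>q\<close>. The
  delicate half is the converse, since \<open>X^n - a\<close> may be reducible: its quotient is then
  a product of rings permuted by the substitution for X, not a field with a Galois group. Norms are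
  therefore taken as products of the polynomials b(z^i X), which make sense modulo every
  \<open>X^m - c\<close> and give the Galois norm in the irreducible case. Dimension enters only
  through the solvability of injective square linear systems. Independence comes from separating
  characters by sums over powers of a root of unity; the division by its order is legitimate because
  a primitive root of that order exists.\<close>

definition prim_root :: "nat \<Rightarrow> 'k::field \<Rightarrow> bool" where
  "prim_root n q \<longleftrightarrow> 0 < n \<and> q ^ n = 1 \<and> (\<forall>k. 0 < k \<and> k < n \<longrightarrow> q ^ k \<noteq> 1)"

lemma prim_root_nonzero: "prim_root n q \<Longrightarrow> q \<noteq> 0"
  by (auto simp: prim_root_def power_0_left)

lemma prim_root_power_mod: "prim_root n q \<Longrightarrow> q ^ (k mod n) = q ^ k"
proof -
  assume q: "prim_root n q"
  have "q ^ k = (q ^ n) ^ (k div n) * q ^ (k mod n)"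
    by (simp flip: power_mult power_add)
  then show ?thesis
    using q by (simp add: prim_root_def)
qed

lemma prim_root_power_eq_1_iff: "prim_root n q \<Longrightarrow> q ^ k = 1 \<longleftrightarrow> n dvd k"
proof -
  assume q: "prim_root n q"
  then have "q ^ (k mod n) = 1 \<longleftrightarrow> k mod n = 0"
    using mod_less_divisor[of n k] unfolding prim_root_def
    by (metis bot_nat_0.not_eq_extremum power_0)
  then show ?thesis
    using prim_root_power_mod[OF q, of k] by (simp add: dvd_eq_mod_eq_0)
qed

lemma prim_root_power:
  assumes "prim_root (d * m) q"
  shows "prim_root m (q ^ d)"
proof -
  have "(q ^ d) ^ k = 1 \<longleftrightarrow> m dvd k" for k
    using prim_root_power_eq_1_iff[OF assms, of "d * k"] assms
    by (simp add: prim_root_def power_mult)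
  then show ?thesis
    using assms nat_dvd_not_less unfolding prim_root_def by auto
qed

lemma prim_root_inverse: "prim_root n q \<Longrightarrow> prim_root n (inverse q)"
  by (auto simp: prim_root_def power_inverse)

lemma prim_root_inj_on:
  assumes "prim_root n q"
  shows "inj_on (\<lambda>i. q ^ i) {..<n}"
proof -
  have "i = j" if ij: "i \<le> j" "j < n" "q ^ i = q ^ j" for i j
  proof -
    have "q ^ i * q ^ (j - i) = q ^ i"
      using ij by (metis le_add_diff_inverse power_add)
    then have "q ^ (j - i) = 1"
      using prim_root_nonzero[OF assms] by simp
    then show ?thesis
      using prim_root_power_eq_1_iff[OF assms, of "j - i"] ij dvd_imp_le[of n "j - i"] by force
  qed
  then show ?thesis
    unfolding inj_on_def by (metis lessThan_iff nat_le_linear)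
qed

lemma prim_root_geometric_sum:
  assumes "prim_root n q" "\<not> n dvd t"
  shows "(\<Sum>k<n. q ^ (t * k)) = 0"
proof -
  have "(\<Sum>k<n. (q ^ t) ^ k) = ((q ^ t) ^ n - 1) / (q ^ t - 1)"
    using assms by (intro geometric_sum) (simp add: prim_root_power_eq_1_iff)
  also have "(q ^ t) ^ n = 1"
    using assms by (metis mult.commute power_mult power_one prim_root_def)
  finally show ?thesis
    by (simp add: power_mult)
qed

text \<open>If \<open>n\<close> vanished in the field, 1 would also be a root of 1 + X + ... +
  X^(n-1), which would then have all \<open>n\<close> powers of \<open>q\<close> as roots, too many
  for its degree. This licenses every division by the order of a root of unity.\<close>

lemma prim_root_of_nat_nonzero:
  fixes q :: "'k::field"
  assumes "prim_root n q"
  shows "of_nat n \<noteq> (0::'k)"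
proof
  assume n0: "of_nat n = (0::'k)"
  define p :: "'k poly" where "p = (\<Sum>k<n. Polynomial.monom 1 k)"
  have n: "0 < n"
    using assms by (simp add: prim_root_def)
  have "coeff p 0 = 1"
    using n by (simp add: p_def coeff_sum)
  then have p0: "p \<noteq> 0"
    by auto
  have "degree p \<le> n - 1"
    unfolding p_def by (intro degree_sum_le) (auto intro: order.trans[OF degree_monom_le])
  have root: "poly p (q ^ i) = 0" if "i < n" for i
  proof (cases "i = 0")
    case True
    then show ?thesis
      using n0 by (simp add: p_def poly_sum poly_monom)
  next
    case False
    then have "\<not> n dvd i"
      using that nat_dvd_not_less by blast
    then show ?thesis
      using prim_root_geometric_sum[OF assms] by (simp add: p_def poly_sum poly_monom power_mult)
  qed
  have "n = card ((\<lambda>i. q ^ i) ` {..<n})"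
    using prim_root_inj_on[OF assms] by (simp add: card_image)
  also have "\<dots> \<le> card {x. poly p x = 0}"
    using root by (intro card_mono poly_roots_finite p0) auto
  also have "\<dots> \<le> degree p"
    using card_poly_roots_bound[OF p0] .
  finally show False
    using \<open>degree p \<le> n - 1\<close> n by simp
qed

section \<open>Separation of weights by roots of unity\<close>

lemma smult_sum_right: "Polynomial.smult c (\<Sum>i\<in>I. f i) = (\<Sum>i\<in>I. Polynomial.smult c (f i))"
  by (induct I rule: infinite_finite_induct) (simp_all add: smult_add_right)

text \<open>Fourier inversion on Z/N: the k-th hypothesis is weighted by \<open>z ^ (u * k)\<close>
  and all are added. By orthogonality only the indices with weight \<open>r\<close> modulo
  \<open>N\<close> survive, each with the factor \<open>N\<close>, which is nonzero in the
  field.\<close>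

lemma weight_component_zero:
  fixes y :: "'i \<Rightarrow> 'k::field poly"
  assumes z: "prim_root N z" and "finite I"
    and zero: "\<And>k. k < N \<Longrightarrow> (\<Sum>i\<in>I. Polynomial.smult (z ^ (w i * k)) (y i)) = 0"
  shows "(\<Sum>i | i \<in> I \<and> w i mod N = r mod N. y i) = 0"
proof -
  \<comment> \<open>A natural number representing -r modulo \<open>N\<close>.\<close>
  define u where "u = N - r mod N"
  have N: "0 < N"
    using z by (simp add: prim_root_def)
  have dvd: "N dvd w i + u \<longleftrightarrow> w i mod N = r mod N" for i
  proof -
    have "int N dvd int (w i) + int u \<longleftrightarrow> int N dvd int (w i) - int (r mod N)"
      using N dvd_add_left_iff[of "int N" "int N" "int (w i) - int (r mod N)"]
      by (simp add: u_def of_nat_diff algebra_simps)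
    also have "\<dots> \<longleftrightarrow> int (w i) mod int N = int (r mod N) mod int N"
      by (simp add: mod_eq_dvd_iff)
    also have "\<dots> \<longleftrightarrow> w i mod N = r mod N"
      by (metis mod_mod_trivial of_nat_eq_iff zmod_int)
    finally show ?thesis
      by (simp flip: of_nat_add)
  qed
  have "0 = (\<Sum>k<N. Polynomial.smult (z ^ (u * k)) (\<Sum>i\<in>I. Polynomial.smult (z ^ (w i * k)) (y i)))"
    using zero by simp
  also have "\<dots> = (\<Sum>k<N. \<Sum>i\<in>I. Polynomial.smult (z ^ ((w i + u) * k)) (y i))"
    by (simp add: smult_sum_right power_add algebra_simps)
  also have "\<dots> = (\<Sum>i\<in>I. Polynomial.smult (\<Sum>k<N. z ^ ((w i + u) * k)) (y i))"
    by (subst sum.swap) (simp add: smult_sum)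
  also have "\<dots> = (\<Sum>i\<in>I. if w i mod N = r mod N then Polynomial.smult (of_nat N) (y i) else 0)"
  proof (intro sum.cong refl)
    fix i
    show "Polynomial.smult (\<Sum>k<N. z ^ ((w i + u) * k)) (y i)
      = (if w i mod N = r mod N then Polynomial.smult (of_nat N) (y i) else 0)"
    proof (cases "w i mod N = r mod N")
      case True
      then have "z ^ ((w i + u) * k) = 1" for k
        using prim_root_power_eq_1_iff[OF z] dvd by simp
      then show ?thesis
        using True by simp
    next
      case False
      then show ?thesis
        using prim_root_geometric_sum[OF z, of "w i + u"] dvd by simp
    qed
  qed
  also have "\<dots> = Polynomial.smult (of_nat N) (\<Sum>i | i \<in> I \<and> w i mod N = r mod N. y i)"
    using \<open>finite I\<close> by (simp add: sum.If_cases smult_sum_right Int_def)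
  finally show ?thesis
    using prim_root_of_nat_nonzero[OF z] by simp
qed

text \<open>Two monic polynomials of degree \<open>n\<close> in a new variable, with polynomials as
  coefficients, share the \<open>n\<close> roots \<open>q^i x\<close>; these are distinct because
  \<open>x\<close> is nonzero. The factorization serves both the roots in the algebraic closure and
  the determination of the Galois group.\<close>

lemma power_diff_factorization:
  fixes x y :: "'k::field poly"
  assumes q: "prim_root n q" and "x \<noteq> 0"
  shows "y ^ n - x ^ n = (\<Prod>i<n. y - Polynomial.smult (q ^ i) x)"
proof -
  have n: "0 < n"
    using q by (simp add: prim_root_def)
  define A where "A = (Polynomial.monom 1 n + [:- (x ^ n):] :: 'k poly poly)"
  define B where "B = (\<Prod>i<n. [:- Polynomial.smult (q ^ i) x, 1:])"
  have "degree A = n"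
    using n degree_add_eq_left[of "[:- (x ^ n):]" "Polynomial.monom 1 n"]
    by (simp add: A_def degree_monom_eq)
  have lA: "lead_coeff A = 1"
    using \<open>degree A = n\<close> n by (simp add: A_def coeff_pCons split: nat.splits)
  have dB: "degree B = n"
    unfolding B_def by (subst degree_prod_eq_sum_degree) auto
  have lB: "lead_coeff B = 1"
    unfolding B_def lead_coeff_prod by simp
  have "A - B = 0"
  proof (rule ccontr)
    assume D: "A - B \<noteq> 0"
    have "degree (A - B) \<noteq> n"
    proof
      assume "degree (A - B) = n"
      then have "lead_coeff (A - B) = 0"
        using lA lB dB \<open>degree A = n\<close> by simp
      then show False
        using D leading_coeff_0_iff by blast
    qed
    moreover have "degree (A - B) \<le> n"
      using dB \<open>degree A = n\<close> by (simp add: degree_diff_le)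
    ultimately have deg: "degree (A - B) < n"
      by simp
    have inj: "inj_on (\<lambda>i. Polynomial.smult (q ^ i) x) {..<n}"
    proof (rule inj_onI)
      fix i j assume ij: "i \<in> {..<n}" "j \<in> {..<n}" "Polynomial.smult (q ^ i) x = Polynomial.smult (q ^ j) x"
      then have "Polynomial.smult (q ^ i - q ^ j) x = 0"
        by (simp add: smult_diff_left)
      then have "q ^ i = q ^ j"
        using \<open>x \<noteq> 0\<close> by simp
      then show "i = j"
        using prim_root_inj_on[OF q] ij by (auto dest: inj_onD)
    qed
    have root: "poly (A - B) (Polynomial.smult (q ^ i) x) = 0" if "i < n" for i
    proof -
      have "(q ^ i) ^ n = 1"
        using q by (metis mult.commute power_mult power_one prim_root_def)
      then have "poly A (Polynomial.smult (q ^ i) x) = 0"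
        by (simp add: A_def poly_monom smult_power)
      moreover have "poly B (Polynomial.smult (q ^ i) x) = 0"
        using that by (auto simp: B_def poly_prod intro!: prod_zero)
      ultimately show ?thesis
        by simp
    qed
    have "n = card ((\<lambda>i. Polynomial.smult (q ^ i) x) ` {..<n})"
      using inj by (simp add: card_image)
    also have "\<dots> \<le> card {x. poly (A - B) x = 0}"
      using root by (intro card_mono poly_roots_finite D) auto
    also have "\<dots> \<le> degree (A - B)"
      using card_poly_roots_bound[OF D] .
    finally show False
      using deg by simp
  qed
  then have "poly A y = poly B y"
    by simp
  then show ?thesis
    by (simp add: A_def B_def poly_prod poly_monom)
qed

subsection \<open>Linear operators and matrices\<close>

text \<open>Vectors of length \<open>n\<close> are encoded as polynomials of degree below \<open>n\<close>.\<close>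

definition lin_op :: "('k::field poly \<Rightarrow> 'k poly) \<Rightarrow> bool" where
  "lin_op T \<longleftrightarrow> (\<forall>u v. T (u + v) = T u + T v) \<and>
     (\<forall>c v. T (Polynomial.smult c v) = Polynomial.smult c (T v))"

lemma lin_op_add: "lin_op T \<Longrightarrow> T (u + v) = T u + T v"
  by (simp add: lin_op_def)

lemma lin_op_smult: "lin_op T \<Longrightarrow> T (Polynomial.smult c v) = Polynomial.smult c (T v)"
  by (simp add: lin_op_def)

lemma lin_op_zero: "lin_op T \<Longrightarrow> T 0 = 0"
  using lin_op_smult[of T 0 0] by simp

lemma lin_op_sum: "lin_op T \<Longrightarrow> T (\<Sum>i\<in>I. f i) = (\<Sum>i\<in>I. T (f i))"
  by (induct I rule: infinite_finite_induct) (simp_all add: lin_op_zero lin_op_add)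

lemma lin_op_funpow: "lin_op T \<Longrightarrow> lin_op (T ^^ k)"
  by (induct k) (auto simp: lin_op_def)

lemma lin_op_comp: "lin_op S \<Longrightarrow> lin_op T \<Longrightarrow> lin_op (\<lambda>v. S (T v))"
  by (auto simp: lin_op_def)

lemma lin_op_scale: "lin_op T \<Longrightarrow> lin_op (\<lambda>v. Polynomial.smult c (T v))"
  by (auto simp: lin_op_def smult_add_right mult.commute)

lemma lin_op_sum_fun: "(\<And>i. i \<in> I \<Longrightarrow> lin_op (f i)) \<Longrightarrow> lin_op (\<lambda>v. \<Sum>i\<in>I. f i v)"
  by (induct I rule: infinite_finite_induct) (auto simp: lin_op_def smult_add_right)

text \<open>Vanishing coefficients, rather than a bound on the degree, give a subspace for every
  \<open>n\<close>; for \<open>n = 0\<close> the condition \<open>degree v < n\<close> would exclude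
  0.\<close>

definition low :: "nat \<Rightarrow> 'k::field poly set" where
  "low n = {v. \<forall>i\<ge>n. coeff v i = 0}"

lemma low_zero [simp]: "0 \<in> low n"
  by (simp add: low_def)

lemma low_add: "u \<in> low n \<Longrightarrow> v \<in> low n \<Longrightarrow> u + v \<in> low n"
  by (simp add: low_def)

lemma low_smult: "v \<in> low n \<Longrightarrow> Polynomial.smult c v \<in> low n"
  by (simp add: low_def)

lemma low_sum: "(\<And>i. i \<in> I \<Longrightarrow> f i \<in> low n) \<Longrightarrow> (\<Sum>i\<in>I. f i) \<in> low n"
  by (induct I rule: infinite_finite_induct) (auto intro: low_add)

lemma monom_low [simp]: "i < n \<Longrightarrow> Polynomial.monom c i \<in> low n"
  by (simp add: low_def)

lemma low_iff_degree:
  assumes "0 < n"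
  shows "v \<in> low n \<longleftrightarrow> degree v < n"
proof
  assume v: "v \<in> low n"
  show "degree v < n"
  proof (rule ccontr)
    assume d: "\<not> degree v < n"
    then have "lead_coeff v = 0"
      using v by (simp add: low_def)
    then show False
      using d assms by simp
  qed
qed (auto simp: low_def coeff_eq_0)

lemma low_expand: "v \<in> low n \<Longrightarrow> v = (\<Sum>j<n. Polynomial.smult (coeff v j) (Polynomial.monom 1 j))"
  by (rule poly_eqI) (auto simp: coeff_sum low_def sum.delta not_less if_distrib cong: if_cong)

lemma lin_op_expand:
  assumes "lin_op T" "v \<in> low n"
  shows "T v = (\<Sum>j<n. Polynomial.smult (coeff v j) (T (Polynomial.monom 1 j)))"
  by (subst low_expand[OF assms(2)]) (simp only: lin_op_sum[OF assms(1)] lin_op_smult[OF assms(1)])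

definition opmat :: "nat \<Rightarrow> ('k::field poly \<Rightarrow> 'k poly) \<Rightarrow> 'k mat" where
  "opmat n T = mat n n (\<lambda>(i, j). coeff (T (Polynomial.monom 1 j)) i)"

lemma opmat_carrier [simp]: "opmat n T \<in> carrier_mat n n"
  by (simp add: opmat_def)

lemma opmat_cong: "(\<And>v. v \<in> low n \<Longrightarrow> S v = T v) \<Longrightarrow> opmat n S = opmat n T"
  by (auto simp: opmat_def intro!: eq_matI)

lemma opmat_comp:
  assumes "lin_op S" "\<And>v. v \<in> low n \<Longrightarrow> T v \<in> low n"
  shows "opmat n (\<lambda>v. S (T v)) = opmat n S * opmat n T"
proof (rule eq_matI)
  fix i j assume ij: "i < dim_row (opmat n S * opmat n T)" "j < dim_col (opmat n S * opmat n T)"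
  then have "i < n" "j < n"
    by (auto simp: opmat_def)
  then have "S (T (Polynomial.monom 1 j))
      = (\<Sum>k<n. Polynomial.smult (coeff (T (Polynomial.monom 1 j)) k) (S (Polynomial.monom 1 k)))"
    using assms by (intro lin_op_expand) auto
  then show "opmat n (\<lambda>v. S (T v)) $$ (i, j) = (opmat n S * opmat n T) $$ (i, j)"
    using \<open>i < n\<close> \<open>j < n\<close>
    by (simp add: opmat_def scalar_prod_def coeff_sum atLeast0LessThan mult.commute)
qed (simp_all add: opmat_def)

lemma opmat_add: "opmat n (\<lambda>v. S v + T v) = opmat n S + opmat n T"
  by (rule eq_matI) (simp_all add: opmat_def)

lemma opmat_smult: "opmat n (\<lambda>v. Polynomial.smult c (T v)) = c \<cdot>\<^sub>m opmat n T"
  by (rule eq_matI) (simp_all add: opmat_def)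

lemma opmat_id: "opmat n (\<lambda>v. v) = 1\<^sub>m n"
  by (rule eq_matI) (simp_all add: opmat_def one_mat_def)

lemma opmat_zero: "opmat n (\<lambda>v. 0) = 0\<^sub>m n n"
  by (rule eq_matI) (simp_all add: opmat_def)

text \<open>Invariance of \<open>low n\<close> matters here: the matrix records only the
  coefficients below \<open>n\<close>.\<close>

lemma opmat_inject:
  assumes "opmat n S = opmat n T" "lin_op S" "lin_op T"
    and "\<And>v. v \<in> low n \<Longrightarrow> S v \<in> low n" "\<And>v. v \<in> low n \<Longrightarrow> T v \<in> low n" and "v \<in> low n"
  shows "S v = T v"
proof -
  have "S (Polynomial.monom 1 j) = T (Polynomial.monom 1 j)" if "j < n" for j
  proof (rule poly_eqI)
    fix i
    show "coeff (S (Polynomial.monom 1 j)) i = coeff (T (Polynomial.monom 1 j)) i"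
    proof (cases "i < n")
      case True
      then show ?thesis
        using that arg_cong[OF assms(1), of "\<lambda>A. A $$ (i, j)"] by (simp add: opmat_def)
    next
      case False
      then show ?thesis
        using assms(4,5)[OF monom_low[OF that, of 1]] by (simp add: low_def)
    qed
  qed
  then show ?thesis
    using lin_op_expand[OF assms(2,6)] lin_op_expand[OF assms(3,6)] by simp
qed

text \<open>Coefficients from \<open>n\<close> on are dropped, so the operator is defined and linear
  on all polynomials, while the identity matrix acts as the identity on \<open>low n\<close>
  only.\<close>

definition matop :: "nat \<Rightarrow> 'k::field mat \<Rightarrow> 'k poly \<Rightarrow> 'k poly" where
  "matop n A v = (\<Sum>i<n. Polynomial.monom (\<Sum>j<n. A $$ (i, j) * coeff v j) i)"

lemma coeff_matop: "coeff (matop n A v) i = (if i < n then \<Sum>j<n. A $$ (i, j) * coeff v j else 0)"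
  by (simp add: matop_def coeff_sum sum.delta if_distrib cong: if_cong)

lemma matop_low [simp]: "matop n A v \<in> low n"
  by (simp add: low_def coeff_matop)

lemma lin_op_matop: "lin_op (matop n A)"
  unfolding lin_op_def
  by (auto intro!: poly_eqI sum.cong simp: coeff_matop sum.distrib sum_distrib_left algebra_simps)

lemma matop_mult:
  assumes "A \<in> carrier_mat n n" "B \<in> carrier_mat n n"
  shows "matop n (A * B) v = matop n A (matop n B v)"
proof (rule poly_eqI)
  fix i
  have "(\<Sum>j<n. (A * B) $$ (i, j) * coeff v j) = (\<Sum>k<n. A $$ (i, k) * (\<Sum>j<n. B $$ (k, j) * coeff v j))"
    if "i < n"
  proof -
    have "(\<Sum>j<n. (A * B) $$ (i, j) * coeff v j)
        = (\<Sum>j<n. \<Sum>k<n. A $$ (i, k) * B $$ (k, j) * coeff v j)"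
      using assms that by (intro sum.cong)
        (auto simp: scalar_prod_def atLeast0LessThan sum_distrib_right)
    also have "\<dots> = (\<Sum>k<n. A $$ (i, k) * (\<Sum>j<n. B $$ (k, j) * coeff v j))"
      by (subst sum.swap) (simp add: sum_distrib_left mult.assoc)
    finally show ?thesis .
  qed
  then show "coeff (matop n (A * B) v) i = coeff (matop n A (matop n B v)) i"
    by (simp add: coeff_matop)
qed

lemma matop_smult: "A \<in> carrier_mat n n \<Longrightarrow> matop n (c \<cdot>\<^sub>m A) v = Polynomial.smult c (matop n A v)"
  by (rule poly_eqI) (simp add: coeff_matop sum_distrib_left mult.assoc)

lemma matop_one: "v \<in> low n \<Longrightarrow> matop n (1\<^sub>m n) v = v"
  by (rule poly_eqI) (auto simp: coeff_matop low_def sum.delta if_distrib if_distribR cong: if_cong)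

lemma matop_power:
  assumes "A \<in> carrier_mat n n" "v \<in> low n"
  shows "matop n (A ^\<^sub>m k) v = (matop n A ^^ k) v"
  using assms(2)
proof (induct k arbitrary: v)
  case 0
  then show ?case
    using assms by (simp add: matop_one)
next
  case (Suc k)
  have "matop n (A ^\<^sub>m Suc k) v = matop n (A ^\<^sub>m k) (matop n A v)"
    using assms by (simp add: matop_mult)
  then show ?case
    using Suc(1)[of "matop n A v"] by (simp add: funpow_swap1)
qed

text \<open>The dimension argument of the proof: a square system with trivial kernel has nonzero
  determinant. Arbitrary finite index sets spare its users any numbering of pairs of exponents or of
  matrix entries.\<close>

lemma square_system_solvable:
  fixes f :: "'i \<Rightarrow> 'j \<Rightarrow> 'k::field"
  assumes "finite I" "finite J" "card I = card J"
    and inj: "\<And>c. (\<And>j. j \<in> J \<Longrightarrow> (\<Sum>i\<in>I. c i * f i j) = 0) \<Longrightarrow> \<forall>i\<in>I. c i = 0"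
  shows "\<exists>c. \<forall>j\<in>J. (\<Sum>i\<in>I. c i * f i j) = y j"
proof -
  define N where "N = card I"
  obtain g where g: "bij_betw g {0..<N} I"
    using ex_bij_betw_nat_finite[OF \<open>finite I\<close>] by (auto simp: N_def)
  obtain h where h: "bij_betw h {0..<N} J"
    using ex_bij_betw_nat_finite[OF \<open>finite J\<close>] assms(3) by (auto simp: N_def)
  define A where "A = mat N N (\<lambda>(r, k). f (g k) (h r))"
  have A: "A \<in> carrier_mat N N"
    by (simp add: A_def)
  define g' where "g' = the_inv_into {0..<N} g"
  have g': "g' (g k) = k" if "k < N" for k
    using that g by (simp add: g'_def bij_betw_def the_inv_into_f_f)
  have Av: "(A *\<^sub>v v) $ r = (\<Sum>i\<in>I. v $ g' i * f i (h r))" if "v \<in> carrier_vec N" "r < N" for v r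
  proof -
    have "(A *\<^sub>v v) $ r = (\<Sum>k\<in>{0..<N}. f (g k) (h r) * v $ k)"
      using that by (simp add: A_def scalar_prod_def)
    also have "\<dots> = (\<Sum>k\<in>{0..<N}. v $ g' (g k) * f (g k) (h r))"
      by (intro sum.cong) (simp_all add: g' mult.commute)
    also have "\<dots> = (\<Sum>i\<in>I. v $ g' i * f i (h r))"
      by (rule sum.reindex_bij_betw[OF g])
    finally show ?thesis .
  qed
  have "det A \<noteq> 0"
  proof
    assume "det A = 0"
    then obtain v where v: "v \<in> carrier_vec N" "v \<noteq> 0\<^sub>v N" "A *\<^sub>v v = 0\<^sub>v N"
      using det_0_iff_vec_prod_zero_field[OF A] by blast
    have "(\<Sum>i\<in>I. v $ g' i * f i j) = 0" if "j \<in> J" for j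
    proof -
      have "j \<in> h ` {0..<N}"
        using h that by (simp add: bij_betw_imp_surj_on)
      then obtain r where r: "r < N" "j = h r"
        by auto
      then show ?thesis
        using Av[OF v(1) r(1)] v(3) by simp
    qed
    then have "\<forall>i\<in>I. v $ g' i = 0"
      by (rule inj)
    then have "v $ k = 0" if "k < N" for k
      using g'[OF that] that bij_betwE[OF g] by force
    then have "v = 0\<^sub>v N"
      using v(1) by (intro eq_vecI) auto
    then show False
      using v(2) by simp
  qed
  then obtain B where B: "B \<in> carrier_mat N N" "A * B = 1\<^sub>m N"
    using det_non_zero_imp_unit[OF A, of "()"] by (auto simp: Units_def ring_mat_simps)
  define x where "x = vec N (\<lambda>r. y (h r))"
  define v where "v = B *\<^sub>v x"
  have v: "v \<in> carrier_vec N"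
    using mult_mat_vec_carrier[OF B(1)] by (simp add: v_def x_def)
  have "A *\<^sub>v v = x"
    using assoc_mult_mat_vec[OF A B(1), of x] B(2) by (simp add: v_def x_def)
  have "(\<Sum>i\<in>I. v $ g' i * f i j) = y j" if "j \<in> J" for j
  proof -
    have "j \<in> h ` {0..<N}"
      using h that by (simp add: bij_betw_imp_surj_on)
    then obtain r where r: "r < N" "j = h r"
      by auto
    then show ?thesis
      using Av[OF v r(1)] \<open>A *\<^sub>v v = x\<close> by (simp add: x_def)
  qed
  then show ?thesis
    by (intro exI[of _ "\<lambda>i. v $ g' i"]) simp
qed

subsection \<open>Operators commuting up to a root of unity\<close>

text \<open>\<open>P\<close> plays the role of h and \<open>Q\<close> that of x. Linearity is
  global, but the relations are imposed on \<open>low n\<close> only, because the operators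
  constructed later truncate or reduce modulo a polynomial and satisfy them just there.\<close>

locale twisted_pair =
  fixes n :: nat and q s a :: "'k::field" and P Q :: "'k poly \<Rightarrow> 'k poly"
  assumes root: "prim_root n q" and s: "s \<noteq> 0" and a: "a \<noteq> 0"
    and lin_P: "lin_op P" and lin_Q: "lin_op Q"
    and low_P: "v \<in> low n \<Longrightarrow> P v \<in> low n" and low_Q: "v \<in> low n \<Longrightarrow> Q v \<in> low n"
    and P_power: "v \<in> low n \<Longrightarrow> (P ^^ n) v = Polynomial.smult s v"
    and Q_power: "v \<in> low n \<Longrightarrow> (Q ^^ n) v = Polynomial.smult a v"
    and twist: "v \<in> low n \<Longrightarrow> Q (P v) = Polynomial.smult q (P (Q v))"
begin

lemma n_pos: "0 < n"
  using root by (simp add: prim_root_def)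

lemma low_P_pow: "v \<in> low n \<Longrightarrow> (P ^^ i) v \<in> low n"
  by (induct i) (auto intro: low_P)

lemma low_Q_pow: "v \<in> low n \<Longrightarrow> (Q ^^ i) v \<in> low n"
  by (induct i) (auto intro: low_Q)

lemmas lin_P_pow = lin_op_funpow[OF lin_P]
lemmas lin_Q_pow = lin_op_funpow[OF lin_Q]

lemma low_PQ: "v \<in> low n \<Longrightarrow> (P ^^ i) ((Q ^^ j) v) \<in> low n"
  by (simp add: low_P_pow low_Q_pow)

lemma twist_power:
  assumes "v \<in> low n"
  shows "(Q ^^ j) ((P ^^ i) v) = Polynomial.smult (q ^ (i * j)) ((P ^^ i) ((Q ^^ j) v))"
proof -
  have 1: "Q ((P ^^ i) v) = Polynomial.smult (q ^ i) ((P ^^ i) (Q v))" if "v \<in> low n" for v i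
    by (induct i) (simp_all add: twist low_P_pow that lin_op_smult[OF lin_P] mult.commute)
  show ?thesis
    using assms
    by (induct j) (simp_all add: 1 low_Q_pow lin_op_smult[OF lin_Q] power_add mult.commute)
qed

lemma P_pow_inj:
  assumes "v \<in> low n" "(P ^^ i) v = 0"
  shows "v = 0"
proof -
  have "P v = 0 \<Longrightarrow> v = 0" if "v \<in> low n" for v
    using P_power[OF that] n_pos s lin_op_zero[OF lin_P_pow, of "n - 1"]
    by (cases n) (auto simp: funpow_Suc_right simp del: funpow.simps)
  then show ?thesis
    using assms by (induct i) (auto simp: low_P_pow)
qed

lemma Q_pow_inj:
  assumes "v \<in> low n" "(Q ^^ i) v = 0"
  shows "v = 0"
proof -
  have "Q v = 0 \<Longrightarrow> v = 0" if "v \<in> low n" for v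
    using Q_power[OF that] n_pos a lin_op_zero[OF lin_Q_pow, of "n - 1"]
    by (cases n) (auto simp: funpow_Suc_right simp del: funpow.simps)
  then show ?thesis
    using assms by (induct i) (auto simp: low_Q_pow)
qed

lemma Q_pow_surj:
  assumes "u \<in> low n"
  shows "\<exists>v\<in>low n. (Q ^^ k) v = u"
  using assms
proof (induct k arbitrary: u)
  case (Suc k)
  obtain v where v: "v \<in> low n" "(Q ^^ k) v = u"
    using Suc by blast
  \<comment> \<open>As \<open>Q^n\<close> is multiplication by \<open>a\<close>, this is the
    preimage of \<open>v\<close> under \<open>Q\<close>.\<close>
  define w where "w = Polynomial.smult (inverse a) ((Q ^^ (n - 1)) v)"
  have "Q w = Polynomial.smult (inverse a) ((Q ^^ n) v)"
    using n_pos by (cases n) (simp_all add: w_def lin_op_smult[OF lin_Q])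
  then have "Q w = v"
    using a by (simp add: Q_power v)
  then have "(Q ^^ Suc k) w = u"
    using v by (simp add: funpow_swap1)
  then show ?case
    using v by (auto simp: w_def intro!: bexI[of _ w] low_smult low_Q_pow)
qed auto

text \<open>Writing \<open>v\<close> as \<open>Q^k w\<close> and applying \<open>Q^k\<close> to the
  relation at \<open>w\<close> conjugates each monomial by \<open>Q^k\<close>, which multiplies
  \<open>P^i Q^j\<close> by \<open>q^(ik)\<close>. The resulting family of relations can be filtered
  by the exponent of \<open>P\<close>.\<close>

lemma weight_P_component:
  assumes "finite I" and v: "\<And>v. v \<in> low n \<Longrightarrow> (\<Sum>x\<in>I. Polynomial.smult (c x) ((P ^^ fst x) ((Q ^^ snd x) v))) = 0"
    and "v \<in> low n"
  shows "(\<Sum>x | x \<in> I \<and> fst x mod n = r mod n. Polynomial.smult (c x) ((P ^^ fst x) ((Q ^^ snd x) v))) = 0"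
proof (rule weight_component_zero[OF root \<open>finite I\<close>])
  fix k
  obtain w where w: "w \<in> low n" "(Q ^^ k) w = v"
    using Q_pow_surj assms by blast
  have "(Q ^^ k) ((Q ^^ j) w) = (Q ^^ j) v" for j
    using w by (metis add.commute comp_apply funpow_add)
  then have "(Q ^^ k) (\<Sum>x\<in>I. Polynomial.smult (c x) ((P ^^ fst x) ((Q ^^ snd x) w)))
      = (\<Sum>x\<in>I. Polynomial.smult (q ^ (fst x * k)) (Polynomial.smult (c x) ((P ^^ fst x) ((Q ^^ snd x) v))))"
    using w(1)
    by (simp add: lin_op_sum[OF lin_Q_pow] lin_op_smult[OF lin_Q_pow] twist_power low_Q_pow mult.commute)
  then show "(\<Sum>x\<in>I. Polynomial.smult (q ^ (fst x * k)) (Polynomial.smult (c x) ((P ^^ fst x) ((Q ^^ snd x) v)))) = 0"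
    using v[OF w(1)] lin_op_zero[OF lin_Q_pow] by simp
qed

text \<open>Dual to the filter for \<open>P\<close>: the relation is used at \<open>P^k v\<close>.
  Moving \<open>P^k\<close> to the front produces the factor \<open>q^(jk)\<close>, and
  \<open>P^k\<close> is then cancelled by injectivity.\<close>

lemma weight_Q_component:
  assumes "finite I" and v: "\<And>v. v \<in> low n \<Longrightarrow> (\<Sum>x\<in>I. Polynomial.smult (c x) ((P ^^ fst x) ((Q ^^ snd x) v))) = 0"
    and "v \<in> low n"
  shows "(\<Sum>x | x \<in> I \<and> snd x mod n = r mod n. Polynomial.smult (c x) ((P ^^ fst x) ((Q ^^ snd x) v))) = 0"
proof (rule weight_component_zero[OF root \<open>finite I\<close>])
  fix k
  let ?y = "(\<Sum>x\<in>I. Polynomial.smult (q ^ (snd x * k)) (Polynomial.smult (c x) ((P ^^ fst x) ((Q ^^ snd x) v))))"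
  have comm: "(P ^^ k) ((P ^^ i) u) = (P ^^ i) ((P ^^ k) u)" for i u
    by (metis add.commute comp_apply funpow_add)
  have "(P ^^ k) ?y = (\<Sum>x\<in>I. Polynomial.smult (c x) ((P ^^ fst x) ((Q ^^ snd x) ((P ^^ k) v))))"
    using assms(3)
    by (simp add: lin_op_sum[OF lin_P_pow] lin_op_smult[OF lin_P_pow] twist_power comm mult.commute)
  also have "\<dots> = 0"
    using v low_P_pow assms(3) by blast
  finally show "?y = 0"
    using P_pow_inj assms(3) by (meson low_PQ low_smult low_sum)
qed

text \<open>Filtering by the exponent of \<open>P\<close> and then by that of \<open>Q\<close>
  isolates a single monomial, which is injective on \<open>low n\<close>.\<close>

lemma op_independent:
  assumes "\<And>v. v \<in> low n \<Longrightarrow> (\<Sum>x\<in>{..<n} \<times> {..<n}. Polynomial.smult (c x) ((P ^^ fst x) ((Q ^^ snd x) v))) = 0"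
    and "x \<in> {..<n} \<times> {..<n}"
  shows "c x = 0"
proof -
  let ?I = "{y \<in> {..<n} \<times> {..<n}. fst y mod n = fst x mod n}"
  have 1: "(\<Sum>y\<in>?I. Polynomial.smult (c y) ((P ^^ fst y) ((Q ^^ snd y) v))) = 0" if "v \<in> low n" for v
    by (rule weight_P_component) (use assms that in auto)
  have "(\<Sum>y | y \<in> ?I \<and> snd y mod n = snd x mod n. Polynomial.smult (c y) ((P ^^ fst y) ((Q ^^ snd y) v))) = 0"
    if "v \<in> low n" for v
    by (rule weight_Q_component) (use 1 that in auto)
  moreover have "{y. y \<in> ?I \<and> snd y mod n = snd x mod n} = {x}"
    using assms(2) by auto
  ultimately have "Polynomial.smult (c x) ((P ^^ fst x) ((Q ^^ snd x) v)) = 0" if "v \<in> low n" for v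
    using that by simp
  \<comment> \<open>The polynomial 1 is a nonzero vector of \<open>low n\<close> because
    \<open>n\<close> is positive.\<close>
  from this[of 1] show ?thesis
    using P_pow_inj[of "(Q ^^ snd x) 1"] Q_pow_inj[of 1] low_Q_pow[of 1] n_pos
    by (auto simp: low_iff_degree)
qed

text \<open>There are as many monomials as matrix entries, so their independence makes the linear
  system for the coefficients solvable.\<close>

lemma op_span:
  "\<exists>c. A = opmat n (\<lambda>v. \<Sum>x\<in>{..<n} \<times> {..<n}. Polynomial.smult (c x) ((P ^^ fst x) ((Q ^^ snd x) v)))"
  if A: "A \<in> carrier_mat n n"
proof -
  let ?I = "{..<n} \<times> {..<n}"
  let ?op = "\<lambda>c v. \<Sum>x\<in>?I. Polynomial.smult (c x) ((P ^^ fst x) ((Q ^^ snd x) v))"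
  have lin: "lin_op (?op c)" for c
    by (intro lin_op_sum_fun lin_op_scale lin_op_comp[OF lin_P_pow lin_Q_pow])
  have entry: "opmat n (?op c) $$ y = (\<Sum>x\<in>?I. c x * coeff ((P ^^ fst x) ((Q ^^ snd x) (Polynomial.monom 1 (snd y)))) (fst y))"
    if "y \<in> ?I" for c y
    using that by (auto simp: opmat_def coeff_sum)
  have "\<exists>c. \<forall>y\<in>?I. (\<Sum>x\<in>?I. c x * coeff ((P ^^ fst x) ((Q ^^ snd x) (Polynomial.monom 1 (snd y)))) (fst y)) = A $$ y"
  proof (rule square_system_solvable)
    fix c :: "nat \<times> nat \<Rightarrow> 'k"
    assume c: "\<And>y. y \<in> ?I \<Longrightarrow> (\<Sum>x\<in>?I. c x * coeff ((P ^^ fst x) ((Q ^^ snd x) (Polynomial.monom 1 (snd y)))) (fst y)) = 0"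
    have "opmat n (?op c) = opmat n (\<lambda>v. 0)"
    proof (rule eq_matI)
      fix i j assume "i < dim_row (opmat n (\<lambda>v. 0 :: 'k poly))" "j < dim_col (opmat n (\<lambda>v. 0 :: 'k poly))"
      then have "(i, j) \<in> ?I"
        by (simp add: opmat_def)
      then show "opmat n (?op c) $$ (i, j) = opmat n (\<lambda>v. 0) $$ (i, j)"
        using entry[of "(i, j)" c] c[of "(i, j)"] by (simp add: opmat_def)
    qed (simp_all add: opmat_def)
    then have "?op c v = 0" if "v \<in> low n" for v
      by (rule opmat_inject) (use lin that in \<open>auto simp: lin_op_def intro!: low_sum low_smult low_PQ\<close>)
    then show "\<forall>x\<in>?I. c x = 0"
      using op_independent[of c] by blast
  qed auto
  then obtain c where "\<forall>y\<in>?I. (\<Sum>x\<in>?I. c x * coeff ((P ^^ fst x) ((Q ^^ snd x) (Polynomial.monom 1 (snd y)))) (fst y)) = A $$ y"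
    by blast
  then have "A = opmat n (?op c)"
    using A entry by (intro eq_matI) (auto simp: opmat_def)
  then show ?thesis
    by blast
qed

end

lemma twisted_pair_matop:
  assumes "prim_root n q" "s \<noteq> 0" "a \<noteq> 0"
    and A: "A \<in> carrier_mat n n" and B: "B \<in> carrier_mat n n"
    and "B * A = q \<cdot>\<^sub>m (A * B)" "A ^\<^sub>m n = s \<cdot>\<^sub>m 1\<^sub>m n" "B ^\<^sub>m n = a \<cdot>\<^sub>m 1\<^sub>m n"
  shows "twisted_pair n q s a (matop n A) (matop n B)"
proof
  show "(matop n A ^^ n) v = Polynomial.smult s v" if "v \<in> low n" for v
    using that assms by (simp add: matop_smult matop_one flip: matop_power)
  show "(matop n B ^^ n) v = Polynomial.smult a v" if "v \<in> low n" for v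
    using that assms by (simp add: matop_smult matop_one flip: matop_power)
  show "matop n B (matop n A v) = Polynomial.smult q (matop n A (matop n B v))" for v
    using assms by (simp add: matop_smult flip: matop_mult)
qed (use assms in \<open>auto simp: lin_op_matop\<close>)

subsection \<open>Norms from a radical extension\<close>

definition evop :: "'k::field poly \<Rightarrow> ('k poly \<Rightarrow> 'k poly) \<Rightarrow> 'k poly \<Rightarrow> 'k poly" where
  "evop f T v = (\<Sum>i\<le>degree f. Polynomial.smult (coeff f i) ((T ^^ i) v))"

lemma evop_bound: "degree f \<le> N \<Longrightarrow> evop f T v = (\<Sum>i\<le>N. Polynomial.smult (coeff f i) ((T ^^ i) v))"
  unfolding evop_def by (rule sum.mono_neutral_left) (auto simp: coeff_eq_0)

lemma evop_0 [simp]: "evop 0 T v = 0"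
  by (simp add: evop_def)

lemma evop_const [simp]: "evop [:c:] T v = Polynomial.smult c v"
  by (simp add: evop_def)

lemma evop_1 [simp]: "evop 1 T v = v"
  by (simp add: evop_def)

lemma evop_add: "evop (f + g) T v = evop f T v + evop g T v"
  using degree_add_le_max[of f g]
  by (simp add: evop_bound[where N = "max (degree f) (degree g)"] sum.distrib smult_add_left)

lemma evop_smult: "evop (Polynomial.smult c f) T v = Polynomial.smult c (evop f T v)"
  by (simp add: evop_bound[where N = "degree f"] smult_sum_right)

lemma evop_diff: "evop (f - g) T v = evop f T v - evop g T v"
proof -
  have "f - g = f + Polynomial.smult (-1) g"
    by simp
  then show ?thesis
    by (simp only: evop_add evop_smult) simp
qed

lemma evop_pCons:
  assumes "lin_op T"
  shows "evop (pCons c f) T v = Polynomial.smult c v + T (evop f T v)"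
proof -
  have "evop (pCons c f) T v
      = (\<Sum>i\<le>Suc (degree f). Polynomial.smult (coeff (pCons c f) i) ((T ^^ i) v))"
    by (intro evop_bound degree_pCons_le)
  then show ?thesis
    unfolding evop_def
    by (simp add: sum.atMost_Suc_shift lin_op_sum[OF assms] lin_op_smult[OF assms] del: sum.atMost_Suc)
qed

lemma lin_op_evop: "lin_op T \<Longrightarrow> lin_op (evop f T)"
  unfolding evop_def by (intro lin_op_sum_fun lin_op_scale lin_op_funpow)

lemma evop_mult:
  assumes "lin_op T"
  shows "evop (f * g) T v = evop f T (evop g T v)"
proof (induct f)
  case (pCons c f)
  then show ?case
    using evop_pCons[OF assms, of 0 "f * g" v]
    by (simp add: mult_pCons_left evop_add evop_smult evop_pCons[OF assms])
qed simp

lemma evop_monom: "evop (Polynomial.monom c k) T v = Polynomial.smult c ((T ^^ k) v)"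
proof -
  have "evop (Polynomial.monom c k) T v
      = (\<Sum>i\<le>k. Polynomial.smult (coeff (Polynomial.monom c k) i) ((T ^^ i) v))"
    by (intro evop_bound degree_monom_le)
  also have "\<dots> = (\<Sum>i\<le>k. if i = k then Polynomial.smult c ((T ^^ k) v) else 0)"
    by (intro sum.cong) auto
  finally show ?thesis
    by simp
qed

lemma evop_low:
  assumes "v \<in> low n" "\<And>v. v \<in> low n \<Longrightarrow> T v \<in> low n"
  shows "evop f T v \<in> low n"
proof -
  have "(T ^^ i) v \<in> low n" for i
    using assms by (induct i) auto
  then show ?thesis
    by (auto simp: evop_def intro!: low_sum low_smult)
qed

section \<open>Scaling of the variable and twisted norms\<close>

lemma coeff_pcompose_scale: "coeff (pcompose f [:0, z:]) i = z ^ i * coeff f i"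
  for z :: "'k::field"
proof (induct f arbitrary: i)
  case (pCons c f)
  then show ?case
    by (cases i) (simp_all add: pcompose_pCons coeff_pCons)
qed simp

lemma pcompose_scale_scale: "pcompose (pcompose f [:0, y:]) [:0, z:] = pcompose f [:0, y * z:]"
  for z :: "'k::field"
  by (rule poly_eqI) (simp add: coeff_pcompose_scale power_mult_distrib)

text \<open>For a primitive m-th root of unity \<open>z\<close> and irreducible
  \<open>X^m - c\<close>, the factors represent the Galois conjugates of \<open>b\<close>. Keeping
  the product in F[X] gives it a meaning for reducible \<open>X^n - a\<close> as well.\<close>

definition twisted_norm :: "nat \<Rightarrow> 'k::field \<Rightarrow> 'k poly \<Rightarrow> 'k poly" where
  "twisted_norm m z b = (\<Prod>i<m. pcompose b [:0, z ^ i:])"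

text \<open>The recursion obeyed by the iterates of a semilinear map: each further application
  scales the product collected so far and multiplies it by \<open>b\<close>.\<close>

lemma twisted_norm_Suc:
  "twisted_norm (Suc m) z b = pcompose (twisted_norm m z b) [:0, z:] * b"
  unfolding twisted_norm_def pcompose_prod prod.lessThan_Suc_shift pcompose_scale_scale
  by (simp add: power_commutes mult.commute)

definition binom :: "nat \<Rightarrow> 'k::field \<Rightarrow> 'k poly" where
  "binom m c = Polynomial.monom 1 m - [:c:]"

lemma degree_binom: "0 < m \<Longrightarrow> degree (binom m c) = m"
proof -
  assume "0 < m"
  have "binom m c = Polynomial.monom 1 m + [:- c:]"
    by (rule poly_eqI) (simp add: binom_def coeff_pCons split: nat.split)
  then show ?thesis
    using \<open>0 < m\<close> by (simp add: degree_add_eq_left degree_monom_eq)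
qed

lemma evop_binom: "evop (binom m c) T v = (T ^^ m) v - Polynomial.smult c v"
  by (simp add: binom_def evop_diff evop_monom)

text \<open>\<open>Z\<close> behaves as an ideal, generated by an element \<open>p\<close> of least
  degree. It contains \<open>g\<close> but no nonzero constant, so \<open>p\<close> is a nonconstant
  divisor of \<open>g\<close>; by irreducibility it is \<open>g\<close> up to a scalar. Annihilators
  of vectors and Euclid's lemma are both instances.\<close>

lemma poly_ideal_dvd:
  fixes g :: "'k::field poly"
  assumes irr: "\<And>f. f dvd g \<Longrightarrow> degree f = 0 \<or> degree f = degree g" and "g \<noteq> 0"
    and diff: "\<And>p r u. Z p \<Longrightarrow> Z r \<Longrightarrow> Z (r - p * u)"
    and proper: "\<And>e. e \<noteq> 0 \<Longrightarrow> \<not> Z [:e:]"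
    and "Z g" "Z f"
  shows "g dvd f"
proof -
  define p where "p = arg_min degree (\<lambda>p. p \<noteq> 0 \<and> Z p)"
  have p: "p \<noteq> 0" "Z p"
    using arg_min_natI[of "\<lambda>p. p \<noteq> 0 \<and> Z p" g degree] assms by (auto simp: p_def)
  have min: "degree p \<le> degree r" if "r \<noteq> 0" "Z r" for r
    using arg_min_nat_le[of "\<lambda>p. p \<noteq> 0 \<and> Z p" r degree] that by (simp add: p_def)
  have dvd: "p dvd r" if r: "Z r" for r
  proof -
    have "Z (r mod p)"
      using diff[OF p(2) r, of "r div p"] by (simp add: minus_mult_div_eq_mod)
    then have "r mod p = 0"
      using min[of "r mod p"] degree_mod_less[OF p(1), of r] by force
    then show ?thesis
      by (simp add: mod_eq_0_iff_dvd)
  qed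
  have "degree p \<noteq> 0"
  proof
    assume "degree p = 0"
    then obtain e where "p = [:e:]"
      by (auto elim: degree_eq_zeroE)
    then show False
      using p proper[of e] by simp
  qed
  then have "degree p = degree g"
    using irr[OF dvd[OF \<open>Z g\<close>]] by simp
  moreover obtain u where u: "g = p * u"
    using dvd[OF \<open>Z g\<close>] by (rule dvdE)
  ultimately have "degree u = 0"
    using \<open>g \<noteq> 0\<close> by (auto simp: degree_mult_eq)
  then obtain e where "u = [:e:]"
    by (auto elim: degree_eq_zeroE)
  then have "g = Polynomial.smult e p" "e \<noteq> 0"
    using u \<open>g \<noteq> 0\<close> by auto
  then show ?thesis
    using dvd[OF \<open>Z f\<close>] by (simp add: smult_dvd_iff)
qed

lemma annihilator_dvd:
  assumes "lin_op T" and irr: "\<And>f. f dvd g \<Longrightarrow> degree f = 0 \<or> degree f = degree g"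
    and "g \<noteq> 0" "w \<noteq> 0" "evop g T w = 0" "evop f T w = 0"
  shows "g dvd f"
proof (rule poly_ideal_dvd[where Z = "\<lambda>p. evop p T w = 0"])
  show "evop (r - p * u) T w = 0" if "evop p T w = 0" "evop r T w = 0" for p r u
    using that evop_mult[OF \<open>lin_op T\<close>, of u p w]
    by (simp add: evop_diff mult.commute lin_op_zero[OF lin_op_evop[OF \<open>lin_op T\<close>]])
qed (use assms in auto)

text \<open>Euclid's lemma, from the ideal of all \<open>p\<close> with \<open>g dvd f * p\<close>;
  it contains no nonzero constant since \<open>g\<close> does not divide \<open>f\<close>.\<close>

lemma irreducible_dvd_mult:
  fixes g :: "'k::field poly"
  assumes irr: "\<And>f. f dvd g \<Longrightarrow> degree f = 0 \<or> degree f = degree g" and "g \<noteq> 0"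
    and "g dvd f * h" "\<not> g dvd f"
  shows "g dvd h"
proof (rule poly_ideal_dvd[where Z = "\<lambda>p. g dvd f * p"])
  show "g dvd f * (r - p * u)" if "g dvd f * p" "g dvd f * r" for p r u
    using that by (simp add: right_diff_distrib flip: mult.assoc)
  show "\<not> g dvd f * [:e:]" if "e \<noteq> 0" for e
    using that assms(4) by (simp add: dvd_smult_iff)
qed (use assms in auto)

lemma irreducible_dvd_prod:
  fixes g :: "'k::field poly"
  assumes irr: "\<And>f. f dvd g \<Longrightarrow> degree f = 0 \<or> degree f = degree g" and "0 < degree g"
    and "g dvd (\<Prod>i\<in>I. f i)"
  shows "\<exists>i\<in>I. g dvd f i"
proof -
  have "\<not> g dvd 1"
    using \<open>0 < degree g\<close> dvd_imp_degree_le[of g 1] by auto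
  have "g \<noteq> 0"
    using \<open>0 < degree g\<close> by auto
  then have mult: "g dvd f \<or> g dvd h" if "g dvd f * h" for f h
    using irreducible_dvd_mult[OF irr _ that] by blast
  show ?thesis
    using assms(3)
  proof (induct I rule: infinite_finite_induct)
    case (insert i I)
    then show ?case
      using mult[of "f i" "prod f I"] by auto
  qed (use \<open>\<not> g dvd 1\<close> in auto)
qed

text \<open>The N-th power of \<open>T / x\<close> fixes \<open>u\<close>, so the sum over the orbit
  of \<open>u\<close> is fixed by \<open>T / x\<close>. That such a sum can be made nonzero is a
  separate matter, settled by the independence of monomials.\<close>

lemma eigenvector_average:
  assumes T: "lin_op T" and "x \<noteq> 0" and u: "(T ^^ N) u = Polynomial.smult (x ^ N) u"
  defines "w \<equiv> \<Sum>k<N. Polynomial.smult (inverse x ^ k) ((T ^^ k) u)"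
  shows "T w = Polynomial.smult x w"
proof -
  let ?g = "\<lambda>k. Polynomial.smult (inverse x ^ k) ((T ^^ k) u)"
  have "T w = (\<Sum>k<N. Polynomial.smult x (?g (Suc k)))"
    using \<open>x \<noteq> 0\<close> by (simp add: w_def lin_op_sum[OF T] lin_op_smult[OF T] flip: mult.assoc)
  also have "\<dots> = Polynomial.smult x (\<Sum>k<N. ?g (Suc k))"
    by (simp only: smult_sum_right)
  also have "(\<Sum>k<N. ?g (Suc k)) = w"
  proof -
    have "?g 0 + (\<Sum>k<N. ?g (Suc k)) = w + ?g N"
      unfolding w_def by (simp only: sum.lessThan_Suc_shift[of ?g N, symmetric] sum.lessThan_Suc)
    moreover have "?g N = ?g 0"
      using \<open>x \<noteq> 0\<close> u by (simp add: power_inverse)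
    ultimately show ?thesis
      by simp
  qed
  finally show ?thesis .
qed

text \<open>Applying \<open>T^k\<close> for all \<open>k\<close> turns the eigenvalues
  \<open>x * z^j\<close> into weights, which the root-of-unity filter separates.\<close>

lemma eigen_component_zero:
  assumes T: "lin_op T" and z: "prim_root N z" and "finite I" "x \<noteq> 0"
    and eig: "\<And>i. i \<in> I \<Longrightarrow> T (y i) = Polynomial.smult (x * z ^ w i) (y i)"
    and zero: "(\<Sum>i\<in>I. y i) = 0"
  shows "(\<Sum>i | i \<in> I \<and> w i mod N = r mod N. y i) = 0"
proof (rule weight_component_zero[OF z \<open>finite I\<close>])
  fix k
  have "(T ^^ k) (y i) = Polynomial.smult (x ^ k) (Polynomial.smult (z ^ (w i * k)) (y i))" if "i \<in> I" for i
    by (induct k) (simp_all add: lin_op_smult[OF T] eig[OF that] power_add mult_ac)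
  then have "(T ^^ k) (\<Sum>i\<in>I. y i) = Polynomial.smult (x ^ k) (\<Sum>i\<in>I. Polynomial.smult (z ^ (w i * k)) (y i))"
    by (simp add: lin_op_sum[OF lin_op_funpow[OF T]] smult_sum_right)
  then show "(\<Sum>i\<in>I. Polynomial.smult (z ^ (w i * k)) (y i)) = 0"
    using zero lin_op_zero[OF lin_op_funpow[OF T]] \<open>x \<noteq> 0\<close> by simp
qed

text \<open>The factorization of the size is a parameter: m(s) and m(s,a) as \<open>d\<close> and
  \<open>e\<close> treat the algebra on h and x, while \<open>d = e = 1\<close> treats the skew
  polynomial algebra.\<close>

locale twisted_pair_roots = twisted_pair n q s a P Q
  for n and q s a :: "'k::field" and P Q +
  fixes d e m :: nat and r c :: 'k
  assumes n_eq: "n = d * e * m" and r: "r ^ d = s" and c: "c ^ e = a"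
begin

lemma d_pos: "0 < d" and e_pos: "0 < e" and m_pos: "0 < m"
  using n_pos n_eq by auto

lemma r_nonzero: "r \<noteq> 0" and c_nonzero: "c \<noteq> 0"
  using r s c a d_pos e_pos by (auto simp: power_0_left)

text \<open>Moving \<open>P^(em)\<close> past \<open>Q^j\<close> costs \<open>q^(-emj)\<close>; on
  eigenvectors \<open>w\<close> of \<open>P^(em)\<close> this separates the \<open>Q^j w\<close> by
  \<open>j\<close> modulo \<open>d\<close>.\<close>

lemma root_P: "prim_root d (inverse (q ^ (e * m)))"
  using root by (intro prim_root_inverse prim_root_power) (simp add: n_eq mult_ac)

lemma root_Q: "prim_root e (q ^ (d * m))"
  using root by (intro prim_root_power) (simp add: n_eq mult_ac)

text \<open>Averaging over \<open>P^(em)\<close> and over \<open>Q^(dm)\<close> gives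
  \<open>A\<close> and \<open>B\<close>, and \<open>A\<close> respects the eigenspaces of
  \<open>Q^(dm)\<close>. Their composite cannot vanish, since it is a combination of distinct
  monomials in which the identity has coefficient 1.\<close>

lemma joint_eigenvector:
  "\<exists>w\<in>low n. w \<noteq> 0 \<and> (P ^^ (e * m)) w = Polynomial.smult r w \<and> (Q ^^ (d * m)) w = Polynomial.smult c w"
proof -
  let ?p = "e * m" and ?t = "d * m"
  define A where "A v = (\<Sum>k<d. Polynomial.smult (inverse r ^ k) (((P ^^ ?p) ^^ k) v))" for v
  define B where "B v = (\<Sum>k<e. Polynomial.smult (inverse c ^ k) (((Q ^^ ?t) ^^ k) v))" for v
  have A_low: "A v \<in> low n" and B_low: "B v \<in> low n" if "v \<in> low n" for v
    using that unfolding A_def B_def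
    by (auto intro!: low_sum low_smult simp: funpow_mult low_P_pow low_Q_pow)
  have lin_A: "lin_op A"
    unfolding A_def by (intro lin_op_sum_fun lin_op_scale lin_op_funpow lin_P)
  have PA: "(P ^^ ?p) (A v) = Polynomial.smult r (A v)" if "v \<in> low n" for v
    unfolding A_def
  proof (rule eigenvector_average[OF lin_P_pow r_nonzero])
    show "((P ^^ ?p) ^^ d) v = Polynomial.smult (r ^ d) v"
      using P_power[OF that] by (simp add: funpow_mult r n_eq mult_ac)
  qed
  have QB: "(Q ^^ ?t) (B v) = Polynomial.smult c (B v)" if "v \<in> low n" for v
    unfolding B_def
  proof (rule eigenvector_average[OF lin_Q_pow c_nonzero])
    show "((Q ^^ ?t) ^^ e) v = Polynomial.smult (c ^ e) v"
      using Q_power[OF that] by (simp add: funpow_mult c n_eq mult_ac)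
  qed
  have QA: "(Q ^^ ?t) (A v) = A ((Q ^^ ?t) v)" if "v \<in> low n" for v
  proof -
    \<comment> \<open>The exponent is a multiple of \<open>d * e * m\<close>, so
      \<open>Q^(dm)\<close> commutes with every power of \<open>P^(em)\<close>.\<close>
    have "q ^ (?p * k * ?t) = 1" for k
      using prim_root_power_eq_1_iff[OF root] by (auto simp: n_eq)
    then show ?thesis
      unfolding A_def using that
      by (simp add: lin_op_sum[OF lin_Q_pow] lin_op_smult[OF lin_Q_pow] funpow_mult twist_power mult.commute)
  qed
  have "\<exists>v\<in>low n. A (B v) \<noteq> 0"
  proof (rule ccontr)
    assume "\<not> (\<exists>v\<in>low n. A (B v) \<noteq> 0)"
    then have zero: "A (B v) = 0" if "v \<in> low n" for v
      using that by blast
    \<comment> \<open>The coefficients of the composite of \<open>A\<close> and \<open>B\<close> in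
      the full family of monomials, extended by 0 to the exponents that do not occur.\<close>
    define C where "C x = (if ?p dvd fst x \<and> ?t dvd snd x
        then inverse r ^ (fst x div ?p) * inverse c ^ (snd x div ?t) else 0)" for x
    let ?I = "{..<n} \<times> {..<n}"
    let ?h = "\<lambda>(k, l). (?p * k, ?t * l)"
    let ?K = "{..<d} \<times> {..<e}"
    have "inj_on ?h ?K"
      using e_pos d_pos m_pos by (auto simp: inj_on_def)
    have sub: "?h ` ?K \<subseteq> ?I"
      using e_pos d_pos m_pos by (auto simp: n_eq)
    have C0: "C x = 0" if "x \<in> ?I - ?h ` ?K" for x
    proof (rule ccontr)
      assume "C x \<noteq> 0"
      then have "?p dvd fst x" "?t dvd snd x"
        by (metis C_def)+
      then obtain k l where "fst x = ?p * k" "snd x = ?t * l"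
        by (elim dvdE) blast
      then have kl: "x = (?p * k, ?t * l)"
        by (simp add: prod_eq_iff)
      then have "k < d" "l < e"
        using that e_pos d_pos m_pos by (auto simp: n_eq)
      then show False
        using kl that by auto
    qed
    have "(\<Sum>x\<in>?I. Polynomial.smult (C x) ((P ^^ fst x) ((Q ^^ snd x) v))) = 0" if "v \<in> low n" for v
    proof -
      have "A (B v) = (\<Sum>k<d. \<Sum>l<e. Polynomial.smult (inverse r ^ k * inverse c ^ l)
          ((P ^^ (?p * k)) ((Q ^^ (?t * l)) v)))"
        by (simp add: A_def B_def funpow_mult lin_op_sum[OF lin_P_pow] lin_op_smult[OF lin_P_pow] smult_sum_right)
      also have "\<dots> = (\<Sum>x\<in>?K. (\<lambda>x. Polynomial.smult (C x) ((P ^^ fst x) ((Q ^^ snd x) v))) (?h x))"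
        using e_pos d_pos m_pos by (auto simp: sum.cartesian_product C_def intro!: sum.cong)
      also have "\<dots> = (\<Sum>x\<in>?h ` ?K. Polynomial.smult (C x) ((P ^^ fst x) ((Q ^^ snd x) v)))"
        by (simp only: sum.reindex[OF \<open>inj_on ?h ?K\<close>] comp_def)
      also have "\<dots> = (\<Sum>x\<in>?I. Polynomial.smult (C x) ((P ^^ fst x) ((Q ^^ snd x) v)))"
        using sub C0 by (intro sum.mono_neutral_left) auto
      finally show ?thesis
        using zero[OF that] by simp
    qed
    then have "C (0, 0) = 0"
      using op_independent[of C "(0, 0)"] n_pos by simp
    then show False
      by (simp add: C_def)
  qed
  then obtain v where "v \<in> low n" "A (B v) \<noteq> 0"
    by blast
  then show ?thesis
    using A_low B_low PA QA QB by (intro bexI[of _ "A (B v)"]) (auto simp: lin_op_smult[OF lin_A])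
qed

text \<open>The \<open>e * (d * m) = n\<close> vectors \<open>P^i Q^j w\<close> with
  \<open>i < e\<close> and \<open>j < d * m\<close> form a basis. Their eigenvalues under
  \<open>Q^(dm)\<close> and \<open>P^(em)\<close> determine \<open>i\<close> and
  \<open>j mod d\<close>; within such a class a relation yields a polynomial of degree below
  \<open>m\<close> in \<open>Q^d\<close> that kills \<open>w\<close>, hence 0 by irreducibility.
  Since \<open>P^e w\<close> has the same eigenvalues as \<open>w\<close>, its expansion involves
  only the vectors \<open>Q^(dl) w\<close>.\<close>

lemma norm_exists:
  assumes irr: "\<And>f. f dvd binom m c \<Longrightarrow> degree f = 0 \<or> degree f = m"
  shows "\<exists>b. binom m c dvd twisted_norm m (inverse (q ^ (d * e))) b - [:r:]"
proof -
  let ?p = "e * m" and ?t = "d * m" and ?T = "Q ^^ d"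
  obtain w where w: "w \<in> low n" "w \<noteq> 0" and Pw: "(P ^^ ?p) w = Polynomial.smult r w"
    and Qw: "(Q ^^ ?t) w = Polynomial.smult c w"
    using joint_eigenvector by blast
  define y where "y x = (P ^^ fst x) ((Q ^^ snd x) w)" for x
  have y_low: "y x \<in> low n" for x
    using w by (simp add: y_def low_PQ)
  have P_y: "(P ^^ ?p) (y x) = Polynomial.smult (r * inverse (q ^ ?p) ^ snd x) (y x)" for x
  proof -
    have "(Q ^^ snd x) (Polynomial.smult r w) = Polynomial.smult (q ^ (?p * snd x)) ((P ^^ ?p) ((Q ^^ snd x) w))"
      using twist_power[OF w(1), of "snd x" ?p] Pw by simp
    then have "Polynomial.smult (inverse (q ^ (?p * snd x))) ((Q ^^ snd x) (Polynomial.smult r w))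
        = Polynomial.smult (inverse (q ^ (?p * snd x)))
            (Polynomial.smult (q ^ (?p * snd x)) ((P ^^ ?p) ((Q ^^ snd x) w)))"
      by (rule arg_cong)
    then have "Polynomial.smult (inverse (q ^ (?p * snd x)) * r) ((Q ^^ snd x) w) = (P ^^ ?p) ((Q ^^ snd x) w)"
      using prim_root_nonzero[OF root] by (simp add: lin_op_smult[OF lin_Q_pow])
    moreover have "inverse (q ^ (?p * snd x)) * r = r * inverse (q ^ ?p) ^ snd x"
      by (simp add: power_inverse mult.commute flip: power_mult)
    ultimately have "(P ^^ ?p) ((Q ^^ snd x) w) = Polynomial.smult (r * inverse (q ^ ?p) ^ snd x) ((Q ^^ snd x) w)"
      by (simp only:)
    moreover have "(P ^^ ?p) (y x) = (P ^^ fst x) ((P ^^ ?p) ((Q ^^ snd x) w))"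
      unfolding y_def by (metis add.commute comp_apply funpow_add)
    ultimately show ?thesis
      by (simp add: y_def lin_op_smult[OF lin_P_pow])
  qed
  have Q_y: "(Q ^^ ?t) (y x) = Polynomial.smult (c * (q ^ ?t) ^ fst x) (y x)" for x
  proof -
    have "(Q ^^ ?t) ((Q ^^ snd x) w) = (Q ^^ snd x) ((Q ^^ ?t) w)"
      by (metis add.commute comp_apply funpow_add)
    then show ?thesis
      using w by (simp add: y_def twist_power low_Q_pow Qw lin_op_smult[OF lin_Q_pow]
        lin_op_smult[OF lin_P_pow] power_mult mult.commute flip: power_mult)
  qed
  have component: "(\<Sum>x | x \<in> I \<and> fst x mod e = i mod e \<and> snd x mod d = j mod d. Polynomial.smult (C x) (y x)) = 0"
    if "finite I" "(\<Sum>x\<in>I. Polynomial.smult (C x) (y x)) = 0" for I C i j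
  proof -
    have "(\<Sum>x | x \<in> I \<and> fst x mod e = i mod e. Polynomial.smult (C x) (y x)) = 0"
      using that by (intro eigen_component_zero[OF lin_Q_pow[of ?t] root_Q _ c_nonzero])
        (simp_all add: lin_op_smult[OF lin_Q_pow] Q_y mult_ac)
    then have "(\<Sum>x | x \<in> {x \<in> I. fst x mod e = i mod e} \<and> snd x mod d = j mod d. Polynomial.smult (C x) (y x)) = 0"
      using that by (intro eigen_component_zero[OF lin_P_pow[of ?p] root_P _ r_nonzero])
        (simp_all add: lin_op_smult[OF lin_P_pow] P_y mult_ac)
    then show ?thesis
      by (simp add: conj_assoc)
  qed
  \<comment> \<open>A class consists of \<open>P^i Q^j\<close> applied to the powers of
    \<open>Q^d\<close> at \<open>w\<close>, and this outer operator is injective.\<close>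
  have line: "(\<Sum>l<m. Polynomial.smult (C (i, j + d * l)) (y (i, j + d * l)))
      = (P ^^ i) ((Q ^^ j) (evop (\<Sum>l<m. Polynomial.monom (C (i, j + d * l)) l) ?T w))" for C i j
  proof -
    have "evop (\<Sum>l<m. Polynomial.monom (C (i, j + d * l)) l) ?T w
        = (\<Sum>l<m. Polynomial.smult (C (i, j + d * l)) ((Q ^^ (d * l)) w))"
      by (induct m) (simp_all add: evop_add evop_monom funpow_mult)
    then show ?thesis
      by (simp add: y_def lin_op_sum[OF lin_Q_pow] lin_op_sum[OF lin_P_pow]
        lin_op_smult[OF lin_Q_pow] lin_op_smult[OF lin_P_pow] funpow_add)
  qed
  have reindex: "(\<Sum>x\<in>(\<lambda>l. (i, j + d * l)) ` {..<m}. Polynomial.smult (C x) (y x))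
      = (\<Sum>l<m. Polynomial.smult (C (i, j + d * l)) (y (i, j + d * l)))" for C i j
    using d_pos by (subst sum.reindex) (auto simp: inj_on_def)
  have g: "evop (binom m c) ?T w = 0"
    using Qw by (simp add: evop_binom funpow_mult)
  have dvd: "binom m c dvd f" if "evop f ?T w = 0" for f
    using that irr m_pos degree_binom[of m c]
    by (intro annihilator_dvd[OF lin_Q_pow _ _ w(2) g]) auto
  let ?J = "{..<e} \<times> {..<?t}"
  have independent: "\<forall>x\<in>?J. C x = 0" if C: "(\<Sum>x\<in>?J. Polynomial.smult (C x) (y x)) = 0" for C
  proof
    fix x assume x: "x \<in> ?J"
    obtain i j where ij: "x = (i, j)"
      by fastforce
    define f where "f = (\<Sum>l<m. Polynomial.monom (C (i, j mod d + d * l)) l)"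
    have coeff_f: "coeff f l = C (i, j mod d + d * l)" if "l < m" for l
      using that by (simp add: f_def coeff_sum)
    have "{x \<in> ?J. fst x mod e = i mod e \<and> snd x mod d = j mod d} = (\<lambda>l. (i, j mod d + d * l)) ` {..<m}" (is "?L = ?R")
    proof
      show "?L \<subseteq> ?R"
      proof
        fix z assume "z \<in> ?L"
        then have z: "fst z = i" "snd z < d * m" "snd z mod d = j mod d"
          using x ij by auto
        then have "z = (i, j mod d + d * (snd z div d))" "snd z div d < m"
          using d_pos by (auto simp: less_mult_imp_div_less mult.commute prod_eq_iff)
            (metis mod_mult_div_eq mult.commute)
        then show "z \<in> ?R"
          by blast
      qed
      show "?R \<subseteq> ?L"
      proof (rule image_subsetI)
        fix l assume "l \<in> {..<m}"
        then have "d * Suc l \<le> d * m"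
          by (intro mult_le_mono2) simp
        then have "j mod d + d * l < d * m"
          using mod_less_divisor[OF d_pos, of j] unfolding mult_Suc_right by linarith
        then show "(i, j mod d + d * l) \<in> ?L"
          using x ij by simp
      qed
    qed
    then have "(P ^^ i) ((Q ^^ (j mod d)) (evop f ?T w)) = 0"
      using component[OF _ C, where i = i and j = j]
        reindex[where i = i and j = "j mod d" and C = C] line[where i = i and j = "j mod d" and C = C]
      by (simp add: f_def)
    then have "evop f ?T w = 0"
      using w by (meson P_pow_inj Q_pow_inj evop_low low_Q_pow)
    then have "binom m c dvd f"
      by (rule dvd)
    moreover have "degree f < m"
      unfolding f_def using m_pos by (intro degree_sum_less) (auto intro: le_less_trans[OF degree_monom_le])
    ultimately have "f = 0"
      using degree_binom[OF m_pos, of c] dvd_imp_degree_le[of "binom m c" f] by linarith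
    moreover have "j div d < m"
      using x ij d_pos by (auto simp: less_mult_imp_div_less mult.commute)
    ultimately have "C (i, j mod d + d * (j div d)) = 0"
      using coeff_f[of "j div d"] by simp
    then show "C x = 0"
      using ij by simp
  qed
  \<comment> \<open>As many independent vectors as coordinates, so \<open>P^e w\<close> is a
    combination of them.\<close>
  have "\<exists>C. \<forall>k\<in>{..<n}. (\<Sum>x\<in>?J. C x * coeff (y x) k) = coeff ((P ^^ e) w) k"
  proof (rule square_system_solvable)
    show "card ?J = card {..<n}"
      by (simp add: n_eq)
    fix C assume C: "\<And>k. k \<in> {..<n} \<Longrightarrow> (\<Sum>x\<in>?J. C x * coeff (y x) k) = 0"
    have "(\<Sum>x\<in>?J. Polynomial.smult (C x) (y x)) = 0"
    proof (rule poly_eqI)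
      fix k
      show "coeff (\<Sum>x\<in>?J. Polynomial.smult (C x) (y x)) k = coeff 0 k"
        using C[of k] y_low by (cases "k < n") (auto simp: coeff_sum low_def)
    qed
    then show "\<forall>x\<in>?J. C x = 0"
      by (rule independent)
  qed auto
  then obtain C where C: "\<forall>k\<in>{..<n}. (\<Sum>x\<in>?J. C x * coeff (y x) k) = coeff ((P ^^ e) w) k"
    by blast
  have "(P ^^ e) w = (\<Sum>x\<in>?J. Polynomial.smult (C x) (y x))"
  proof (rule poly_eqI)
    fix k
    show "coeff ((P ^^ e) w) k = coeff (\<Sum>x\<in>?J. Polynomial.smult (C x) (y x)) k"
      using C y_low low_P_pow[OF w(1), of e] by (cases "k < n") (auto simp: coeff_sum low_def)
  qed
  \<comment> \<open>Moves \<open>P^e w\<close> to the other side of its expansion. The index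
    \<open>(e, 0)\<close> lies outside \<open>?J\<close> but in the class of \<open>(0, 0)\<close>,
    so the filter for that class keeps it together with the powers of \<open>Q^d\<close>
    only.\<close>
  define D where "D = C((e, 0) := - 1)"
  have yD: "y (e, 0) = (P ^^ e) w"
    by (simp add: y_def)
  have "(\<Sum>x\<in>insert (e, 0) ?J. Polynomial.smult (D x) (y x)) = - y (e, 0) + (\<Sum>x\<in>?J. Polynomial.smult (D x) (y x))"
    by (subst sum.insert) (auto simp: D_def)
  also have "(\<Sum>x\<in>?J. Polynomial.smult (D x) (y x)) = (\<Sum>x\<in>?J. Polynomial.smult (C x) (y x))"
    by (intro sum.cong) (auto simp: D_def)
  finally have "(\<Sum>x\<in>insert (e, 0) ?J. Polynomial.smult (D x) (y x)) = 0"
    using \<open>(P ^^ e) w = _\<close> yD by simp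
  then have "(\<Sum>x | x \<in> insert (e, 0) ?J \<and> fst x mod e = 0 mod e \<and> snd x mod d = 0 mod d.
      Polynomial.smult (D x) (y x)) = 0"
    by (rule component[rotated]) simp
  also have "{x. x \<in> insert (e, 0) ?J \<and> fst x mod e = 0 mod e \<and> snd x mod d = 0 mod d}
      = insert (e, 0) ((\<lambda>l. (0, 0 + d * l)) ` {..<m})" (is "?L = ?R")
    using d_pos e_pos m_pos by (auto simp: image_iff mod_eq_0_iff_dvd elim!: dvdE)
  also have "(\<Sum>x\<in>?R. Polynomial.smult (D x) (y x))
      = - y (e, 0) + (\<Sum>x\<in>(\<lambda>l. (0, 0 + d * l)) ` {..<m}. Polynomial.smult (D x) (y x))"
    using e_pos by (subst sum.insert) (auto simp: D_def)
  finally have "(P ^^ e) w = (\<Sum>x\<in>(\<lambda>l. (0, 0 + d * l)) ` {..<m}. Polynomial.smult (D x) (y x))"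
    by (simp add: yD)
  then obtain b where b: "(P ^^ e) w = evop b ?T w"
    unfolding reindex line by auto
  let ?z = "inverse (q ^ (d * e))"
  have "(?T ^^ i) ((P ^^ e) v) = Polynomial.smult ((q ^ (d * e)) ^ i) ((P ^^ e) ((?T ^^ i) v))"
    if "v \<in> low n" for v i
    using twist_power[OF that, of "d * i" e]
    by (simp add: funpow_mult mult_ac flip: power_mult)
  \<comment> \<open>Conjugation by \<open>P^e\<close> thus acts on polynomials in \<open>Q^d\<close>
    as the substitution of \<open>?z X\<close> for X.\<close>
  then have P_T: "(P ^^ e) ((?T ^^ i) v) = Polynomial.smult (?z ^ i) ((?T ^^ i) ((P ^^ e) v))" if "v \<in> low n" for v i
    using that prim_root_nonzero[OF root] by (simp add: power_inverse)
  have P_evop: "(P ^^ e) (evop f ?T v) = evop (pcompose f [:0, ?z:]) ?T ((P ^^ e) v)" if "v \<in> low n" for f v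
    using prim_root_nonzero[OF root] P_T[OF that]
    by (simp add: evop_def lin_op_sum[OF lin_P_pow] lin_op_smult[OF lin_P_pow] coeff_pcompose_scale
        degree_pcompose mult.commute)
  have "((P ^^ e) ^^ k) w = evop (twisted_norm k ?z b) ?T w" for k
  proof (induct k)
    case (Suc k)
    then show ?case
      using w by (simp add: P_evop b twisted_norm_Suc evop_mult[OF lin_Q_pow])
  qed (simp add: twisted_norm_def)
  \<comment> \<open>At \<open>k = m\<close> the iterate is \<open>P^(em) w\<close>, which equals
    \<open>r w\<close> by the choice of \<open>w\<close>.\<close>
  then have "evop (twisted_norm m ?z b - [:r:]) ?T w = 0"
    using Pw by (simp add: evop_diff funpow_mult flip: \<open>\<And>k. _ = evop (twisted_norm k ?z b) ?T w\<close>)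
  then show ?thesis
    using dvd by blast
qed

end

section \<open>Lifting a norm from X^m - c to X^n - a\<close>

abbreviation scale :: "'k::field \<Rightarrow> 'k poly \<Rightarrow> 'k poly" where
  "scale z p \<equiv> pcompose p [:0, z:]"

lemma scale_one: "scale 1 p = p"
  by (rule poly_eqI) (simp add: coeff_pcompose_scale)

lemma scale_monom: "scale z (Polynomial.monom y k) = Polynomial.monom (z ^ k * y) k"
  by (rule poly_eqI) (simp add: coeff_pcompose_scale)

lemma scale_binom: "z ^ m = 1 \<Longrightarrow> scale z (binom m c) = binom m c"
  by (simp add: binom_def pcompose_diff scale_monom)

lemma pcompose_monom: "pcompose (Polynomial.monom y k) p = Polynomial.smult y (p ^ k)"
  for y :: "'k::field"
  by (induct k) (simp_all add: monom_0 monom_Suc pcompose_pCons)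

lemma dvd_pcompose: "f dvd g \<Longrightarrow> pcompose f p dvd pcompose g p"
  by (auto simp: dvd_def pcompose_mult)

lemma dvd_diff_mult:
  fixes g :: "'a::comm_ring_1"
  assumes "g dvd x - y" "g dvd x' - y'"
  shows "g dvd x * x' - y * y'"
proof -
  have "x * x' - y * y' = (x - y) * x' + y * (x' - y')"
    by (simp add: algebra_simps)
  then show ?thesis
    using assms by (metis dvd_add dvd_mult dvd_mult2)
qed

lemma dvd_diff_prod:
  fixes g :: "'a::comm_ring_1"
  assumes "\<And>i. i \<in> I \<Longrightarrow> g dvd x i - y i"
  shows "g dvd prod x I - prod y I"
  using assms by (induct I rule: infinite_finite_induct) (auto intro!: dvd_diff_mult)

lemma dvd_diff_power:
  fixes g :: "'a::comm_ring_1"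
  assumes "g dvd x - y"
  shows "g dvd x ^ k - y ^ k"
  using dvd_diff_prod[of "{..<k}" g "\<lambda>_. x" "\<lambda>_. y"] assms by simp

lemma prod_periodic:
  fixes F :: "nat \<Rightarrow> 'a::comm_monoid_mult"
  assumes "\<And>l. F (l + m) = F l"
  shows "(\<Prod>l<d * m. F l) = (\<Prod>l<m. F l) ^ d"
proof (induct d)
  case (Suc d)
  have F: "F (l + d * m) = F l" for l
  proof (induct d)
    case (Suc d)
    then show ?case
      using assms[of "l + d * m"] by (simp add: ac_simps)
  qed simp
  have "(\<Prod>l<N + K. F l) = (\<Prod>l<K. F l) * (\<Prod>l<N. F (l + K))" for N K
    by (induct N) (simp_all add: mult.assoc)
  from this[of m "d * m"] have "(\<Prod>l<m + d * m. F l) = (\<Prod>l<d * m. F l) * (\<Prod>l<m. F (l + d * m))" .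
  then show ?case
    using Suc by (simp add: F mult.commute)
qed simp

lemma prod_multiples:
  fixes F :: "nat \<Rightarrow> 'a::comm_monoid_mult"
  assumes "0 < e"
  shows "(\<Prod>i<e * M. if e dvd i then F i else 1) = (\<Prod>l<M. F (e * l))"
proof -
  have "(\<Prod>i<e * M. if e dvd i then F i else 1) = prod F {i \<in> {..<e * M}. e dvd i}"
    by (rule prod.inter_filter[symmetric]) simp
  also have "{i \<in> {..<e * M}. e dvd i} = (\<lambda>l. e * l) ` {..<M}"
    using assms by auto
  also have "prod F \<dots> = (\<Prod>l<M. F (e * l))"
    using assms by (subst prod.reindex) (auto simp: inj_on_def)
  finally show ?thesis .
qed

text \<open>The product with \<open>n + 1\<close> factors can be split at its last factor or at its
  first. Since \<open>z^n = 1\<close>, both of these factors are \<open>b\<close>, and cancelling it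
  compares the norm with its scaling.\<close>

lemma scale_twisted_norm:
  assumes "0 < n" "z ^ n = 1"
  shows "scale z (twisted_norm n z b) = twisted_norm n z b"
proof (cases "b = 0")
  case True
  then show ?thesis
    using assms by (simp add: twisted_norm_def power_0_left)
next
  case False
  have "twisted_norm n z b * b = scale z (twisted_norm n z b) * b"
    using assms twisted_norm_Suc[of n z b] by (simp add: twisted_norm_def scale_one)
  then show ?thesis
    using False by (metis mult_right_cancel)
qed

text \<open>
  Over \<open>X\<^sup>n - a\<close> the polynomial \<open>X\<^bsup>dm\<^esup> - c\<close> has \<open>e\<close> conjugates under \<open>X \<mapsto> zX\<close>, with product \<open>X\<^sup>n - a\<close>.
  Below \<open>\<epsilon>\<close> is the idempotent of the first one, and \<open>B\<close> is \<open>b(X\<^sup>d)\<close> modulo it and \<open>1\<close> modulo the others.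
\<close>

lemma twisted_norm_lift:
  fixes q s a r c :: "'k::field"
  assumes root: "prim_root n q" and n: "n = d * e * m" and "c \<noteq> 0" and r: "r ^ d = s" and c: "c ^ e = a"
    and b: "binom m c dvd twisted_norm m (inverse (q ^ (d * e))) b - [:r:]"
  shows "\<exists>B. binom n a dvd twisted_norm n (inverse q) B - [:s:]"
proof -
  define z where "z = inverse q"
  have z: "prim_root n z"
    using root by (simp add: z_def prim_root_inverse)
  have zn: "z ^ n = 1"
    using z by (simp add: prim_root_def)
  have pos: "0 < n" "0 < d" "0 < e" "0 < m"
    using root n by (auto simp: prim_root_def)
  define t where "t = d * m"
  have zt: "prim_root e (z ^ t)"
    using z by (intro prim_root_power) (simp add: n t_def mult_ac)
  have e0: "of_nat e \<noteq> (0::'k)"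
    using prim_root_of_nat_nonzero[OF zt] .
  define G where "G = binom t c"
  \<comment> \<open>\<open>h\<close> is 1 modulo \<open>X^t - c\<close>, and
    \<open>h^e = X^n / a\<close> is 1 modulo \<open>X^n - a\<close>. Averaging the powers of
    \<open>h\<close> therefore projects onto the factor where \<open>h = 1\<close>.\<close>
  define h where "h = Polynomial.smult (inverse c) (Polynomial.monom 1 t)"
  define \<epsilon> where "\<epsilon> = Polynomial.smult (inverse (of_nat e)) (\<Sum>k<e. h ^ k)"
  define D where "D = pcompose b (Polynomial.monom 1 d)"
  define B where "B = 1 + (D - 1) * \<epsilon>"
  have G: "G = Polynomial.smult c (h - 1)"
    using \<open>c \<noteq> 0\<close> by (simp add: G_def h_def binom_def smult_diff_right one_pCons)
  have "a \<noteq> 0"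
    using \<open>c \<noteq> 0\<close> c by auto
  have h_e: "h ^ e - 1 = Polynomial.smult (inverse a) (binom n a)"
    using \<open>a \<noteq> 0\<close>
    by (simp add: h_def smult_power monom_power binom_def smult_diff_right one_pCons c power_inverse n t_def mult_ac)
  have "G * \<epsilon> = Polynomial.smult (c * inverse (of_nat e)) ((h - 1) * (\<Sum>k<e. h ^ k))"
    by (simp add: G \<epsilon>_def mult.commute)
  also have "(h - 1) * (\<Sum>k<e. h ^ k) = Polynomial.smult (inverse a) (binom n a)"
    by (simp add: power_diff_1_eq[symmetric] h_e)
  finally have f_dvd: "binom n a dvd G * \<epsilon>"
    by (simp add: dvd_smult)
  have h_scale: "scale (z ^ i) (h ^ k) = Polynomial.smult ((z ^ t) ^ (i * k)) (h ^ k)" for i k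
    by (simp add: h_def smult_power monom_power pcompose_smult scale_monom smult_monom mult_ac flip: power_mult)
  have \<epsilon>_scale: "scale (z ^ i) \<epsilon> = Polynomial.smult (inverse (of_nat e)) (\<Sum>k<e. Polynomial.smult ((z ^ t) ^ (i * k)) (h ^ k))" for i
    by (simp add: \<epsilon>_def pcompose_smult pcompose_sum h_scale)
  have sum_\<epsilon>: "(\<Sum>i<e. scale (z ^ i) \<epsilon>) = 1"
  proof -
    have "(\<Sum>i<e. scale (z ^ i) \<epsilon>)
        = Polynomial.smult (inverse (of_nat e)) (\<Sum>i<e. \<Sum>k<e. Polynomial.smult ((z ^ t) ^ (i * k)) (h ^ k))"
      by (simp add: \<epsilon>_scale smult_sum_right)
    also have "(\<Sum>i<e. \<Sum>k<e. Polynomial.smult ((z ^ t) ^ (i * k)) (h ^ k))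
        = (\<Sum>k<e. Polynomial.smult (\<Sum>i<e. (z ^ t) ^ (k * i)) (h ^ k))"
      by (subst sum.swap) (simp add: smult_sum mult.commute)
    also have "\<dots> = (\<Sum>k<e. if k = 0 then [:of_nat e:] else 0)"
    proof (intro sum.cong refl)
      fix k assume "k \<in> {..<e}"
      then have "k \<noteq> 0 \<Longrightarrow> \<not> e dvd k"
        by (auto dest: dvd_imp_le)
      then show "Polynomial.smult (\<Sum>i<e. (z ^ t) ^ (k * i)) (h ^ k) = (if k = 0 then [:of_nat e:] else 0)"
        using prim_root_geometric_sum[OF zt, of k] by simp
    qed
    finally show ?thesis
      using pos e0 by (simp add: one_pCons)
  qed
  have G_h: "G dvd h ^ k - 1" for k
  proof -
    have "G dvd h - 1"
      using \<open>c \<noteq> 0\<close> by (simp add: G smult_dvd_iff)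
    then show ?thesis
      using dvd_diff_power[of G h 1 k] by simp
  qed
  \<comment> \<open>The i-th conjugation multiplies \<open>h\<close> by \<open>(z^t)^i\<close>;
    modulo \<open>G\<close>, where \<open>h = 1\<close>, a sum of e-th roots of unity
    remains.\<close>
  have G_\<epsilon>: "G dvd scale (z ^ i) \<epsilon> - (if e dvd i then 1 else 0)" for i
  proof -
    have "(\<Sum>k<e. (z ^ t) ^ (i * k)) = (if e dvd i then of_nat e else 0)"
    proof (cases "e dvd i")
      case True
      then have "(z ^ t) ^ (i * k) = 1" for k
        using prim_root_power_eq_1_iff[OF zt] by simp
      then show ?thesis
        using True by simp
    qed (use prim_root_geometric_sum[OF zt] in simp)
    then have "(if e dvd i then 1 else 0)
        = Polynomial.smult (inverse (of_nat e)) (\<Sum>k<e. Polynomial.smult ((z ^ t) ^ (i * k)) (1 :: 'k poly))"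
      using e0 by (simp only: smult_sum[symmetric]) simp
    then have "scale (z ^ i) \<epsilon> - (if e dvd i then 1 else 0)
        = Polynomial.smult (inverse (of_nat e)) (\<Sum>k<e. Polynomial.smult ((z ^ t) ^ (i * k)) (h ^ k - 1))"
      by (simp only: \<epsilon>_scale smult_diff_right sum_subtractf)
    then show ?thesis
      using G_h by (simp add: dvd_smult dvd_sum)
  qed
  \<comment> \<open>Modulo \<open>G\<close> only every e-th factor of the norm of \<open>B\<close>
    differs from 1.\<close>
  have G_B: "G dvd scale (z ^ i) B - (if e dvd i then scale (z ^ i) D else 1)" for i
  proof -
    have "scale (z ^ i) B = 1 + (scale (z ^ i) D - 1) * scale (z ^ i) \<epsilon>"
      by (simp add: B_def pcompose_add pcompose_mult pcompose_diff pcompose_1)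
    then have "scale (z ^ i) B - (if e dvd i then scale (z ^ i) D else 1)
        = (scale (z ^ i) D - 1) * (scale (z ^ i) \<epsilon> - (if e dvd i then 1 else 0))"
      by (simp add: algebra_simps)
    then show ?thesis
      using G_\<epsilon> by simp
  qed
  have D_scale: "scale y D = pcompose (scale (y ^ d) b) (Polynomial.monom 1 d)" for y
    by (simp add: D_def pcompose_assoc[symmetric] scale_monom pcompose_pCons smult_monom)
  have norm_D: "(\<Prod>l<m. scale (z ^ (e * l)) D) = pcompose (twisted_norm m (inverse (q ^ (d * e))) b) (Polynomial.monom 1 d)"
    by (simp add: twisted_norm_def pcompose_prod D_scale z_def power_inverse mult_ac flip: power_mult)
  have "G = pcompose (binom m c) (Polynomial.monom 1 d)"
    by (simp add: G_def binom_def pcompose_diff t_def) (simp add: pcompose_monom monom_power)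
  then have "G dvd (\<Prod>l<m. scale (z ^ (e * l)) D) - [:r:]"
    using dvd_pcompose[OF b, of "Polynomial.monom 1 d"] by (simp add: norm_D pcompose_diff)
  then have "G dvd (\<Prod>l<m. scale (z ^ (e * l)) D) ^ d - [:r:] ^ d"
    by (rule dvd_diff_power)
  \<comment> \<open>\<open>D\<close> is a polynomial in \<open>X^d\<close>, so its conjugate under
    \<open>z^(el)\<close> has period \<open>m\<close> in \<open>l\<close>. The d-th power of the
    short product thus runs through all \<open>el < n\<close>, while \<open>r\<close> becomes
    \<open>s\<close>.\<close>
  also have "(\<Prod>l<m. scale (z ^ (e * l)) D) ^ d = (\<Prod>l<d * m. scale (z ^ (e * l)) D)"
  proof (rule prod_periodic[symmetric])
    fix l
    have "((z ^ (e * (l + m))) ^ d) = (z ^ (e * l)) ^ d * z ^ n"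
      by (simp add: n algebra_simps flip: power_mult power_add)
    then show "scale (z ^ (e * (l + m))) D = scale (z ^ (e * l)) D"
      by (simp add: D_scale zn)
  qed
  also have "\<dots> = (\<Prod>i<n. if e dvd i then scale (z ^ i) D else 1)"
    using prod_multiples[OF pos(3), where M = "d * m" and F = "\<lambda>i. scale (z ^ i) D"] by (simp add: n mult_ac)
  also have "[:r:] ^ d = [:s:]"
    by (simp add: poly_const_pow r)
  finally have 1: "G dvd (\<Prod>i<n. if e dvd i then scale (z ^ i) D else 1) - [:s:]" .
  have 2: "G dvd twisted_norm n z B - (\<Prod>i<n. if e dvd i then scale (z ^ i) D else 1)"
    unfolding twisted_norm_def by (intro dvd_diff_prod G_B)
  have "(x - y) + (y - w) = x - w" for x y w :: "'k poly"
    by (simp add: algebra_simps)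
  then have G_norm: "G dvd twisted_norm n z B - [:s:]"
    using dvd_add[OF 2 1] by (simp only:)
  \<comment> \<open>\<open>W\<close> is a multiple of \<open>G\<close> and invariant under scaling
    by \<open>z\<close>, so modulo \<open>X^n - a\<close> it is killed by every conjugate of
    \<epsilon>. These conjugates add up to 1.\<close>
  define W where "W = twisted_norm n z B - [:s:]"
  have "scale z W = W"
    by (simp add: W_def pcompose_diff scale_twisted_norm[OF pos(1) zn])
  then have W_scale: "scale (z ^ i) W = W" for i
  proof (induct i)
    case (Suc i)
    then show ?case
      using pcompose_scale_scale[of W "z ^ i" z] by (simp add: mult.commute)
  qed (simp add: scale_one)
  obtain u where "W = G * u"
    using G_norm unfolding W_def by (rule dvdE)
  then have "binom n a dvd W * \<epsilon>"
    using dvd_mult2[OF f_dvd, of u] by (simp add: mult_ac)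
  have "binom n a dvd W * scale (z ^ i) \<epsilon>" for i
  proof -
    have "(z ^ i) ^ n = 1"
      using zn by (metis mult.commute power_mult power_one)
    then show ?thesis
      using dvd_pcompose[OF \<open>binom n a dvd W * \<epsilon>\<close>, of "[:0, z ^ i:]"]
      by (simp add: scale_binom pcompose_mult W_scale)
  qed
  then have "binom n a dvd (\<Sum>i<e. W * scale (z ^ i) \<epsilon>)"
    by (intro dvd_sum)
  then have "binom n a dvd W"
    by (simp add: sum_\<epsilon> flip: sum_distrib_left)
  then show ?thesis
    by (auto simp: W_def z_def)
qed

section \<open>Operators built from an element of norm s\<close>

lemma lin_op_mod: "lin_op T \<Longrightarrow> lin_op (\<lambda>v. T v mod f)"
  by (simp add: lin_op_def poly_mod_add_left mod_smult_left)

lemma mod_binom_low: "0 < n \<Longrightarrow> v mod binom n a \<in> low n"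
  using degree_mod_less[of "binom n a" v] degree_binom[of n a] by (cases "binom n a = 0") (auto simp: low_iff_degree)

lemma mod_binom_id: "0 < n \<Longrightarrow> v \<in> low n \<Longrightarrow> v mod binom n a = v"
  using degree_binom[of n a] by (simp add: low_iff_degree mod_poly_less)

lemma poly_mod_eqI: "g dvd x - y \<Longrightarrow> x mod g = y mod g"
  for g :: "'k::field poly"
  using poly_mod_diff_left[of x y g] by (simp add: dvd_eq_mod_eq_0)

lemma twisted_pair_of_norm:
  fixes q s a :: "'k::field"
  assumes root: "prim_root n q" and "s \<noteq> 0" "a \<noteq> 0"
    and B: "binom n a dvd twisted_norm n (inverse q) B - [:s:]"
  shows "\<exists>P Q. twisted_pair n q s a P Q"
proof -
  let ?f = "binom n a" and ?z = "inverse q"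
  define P where "P v = (B * scale ?z v) mod ?f" for v
  define Q where "Q v = (pCons 0 v) mod ?f" for v
  have n: "0 < n" and qn: "q ^ n = 1"
    using root by (auto simp: prim_root_def)
  have q: "q \<noteq> 0"
    using prim_root_nonzero[OF root] .
  have zn: "?z ^ n = 1"
    using qn by (simp add: power_inverse)
  \<comment> \<open>Since \<open>?z^n = 1\<close>, scaling preserves the multiples of
    \<open>X^n - a\<close>; reduction can be postponed to the end of an iteration.\<close>
  have scale_mod: "(B * scale ?z (u mod ?f)) mod ?f = (B * scale ?z u) mod ?f" for u
  proof (rule poly_mod_eqI)
    have "?f dvd u mod ?f - u"
      by (simp add: minus_mod_eq_mult_div dvd_diff_commute)
    then have "?f dvd scale ?z (u mod ?f) - scale ?z u"
      using dvd_pcompose[of ?f _ "[:0, ?z:]"] by (fastforce simp: scale_binom[OF zn] simp flip: pcompose_diff)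
    then show "?f dvd B * scale ?z (u mod ?f) - B * scale ?z u"
      by (simp flip: right_diff_distrib)
  qed
  have P_pow: "(P ^^ k) v = (twisted_norm k ?z B * scale (?z ^ k) v) mod ?f" if "v \<in> low n" for v k
  proof (induct k)
    case 0
    then show ?case
      using that n by (simp add: twisted_norm_def scale_one mod_binom_id)
  next
    case (Suc k)
    have "(P ^^ Suc k) v = (B * scale ?z (twisted_norm k ?z B * scale (?z ^ k) v)) mod ?f"
      by (simp add: Suc P_def scale_mod)
    also have "B * scale ?z (twisted_norm k ?z B * scale (?z ^ k) v)
        = twisted_norm (Suc k) ?z B * scale (?z ^ Suc k) v"
      by (simp add: twisted_norm_Suc pcompose_mult pcompose_scale_scale mult_ac)
    finally show ?case .
  qed
  have Q_pow: "(Q ^^ k) v = (Polynomial.monom 1 k * v) mod ?f" if "v \<in> low n" for v k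
  proof (induct k)
    case 0
    then show ?case
      using that n by (simp add: mod_binom_id)
  next
    case (Suc k)
    have "(Q ^^ Suc k) v = (pCons 0 ((Polynomial.monom 1 k * v) mod ?f)) mod ?f"
      by (simp add: Suc Q_def)
    also have "\<dots> = (pCons 0 (Polynomial.monom 1 k * v)) mod ?f"
      using mod_mult_right_eq[of "[:0, 1:]" "Polynomial.monom 1 k * v" ?f] by simp
    finally show ?case
      by (simp add: monom_Suc)
  qed
  have "twisted_pair n q s a P Q"
  proof
    show "lin_op P"
      unfolding P_def by (intro lin_op_mod) (auto simp: lin_op_def pcompose_add pcompose_smult algebra_simps)
    show "lin_op Q"
      unfolding Q_def by (intro lin_op_mod) (auto simp: lin_op_def)
    show "P v \<in> low n" "Q v \<in> low n" for v
      using n by (simp_all add: P_def Q_def mod_binom_low)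
    show "(P ^^ n) v = Polynomial.smult s v" if v: "v \<in> low n" for v
    proof -
      have "?f dvd (twisted_norm n ?z B - [:s:]) * v"
        using B by simp
      then have "(twisted_norm n ?z B * v) mod ?f = (Polynomial.smult s v) mod ?f"
        by (intro poly_mod_eqI) (simp add: left_diff_distrib)
      then show ?thesis
        using v n by (simp add: P_pow zn scale_one mod_binom_id low_smult del: power_inverse)
    qed
    show "(Q ^^ n) v = Polynomial.smult a v" if v: "v \<in> low n" for v
    proof -
      have "?f dvd (Polynomial.monom 1 n - [:a:]) * v"
        by (simp add: binom_def)
      then have "(Polynomial.monom 1 n * v) mod ?f = (Polynomial.smult a v) mod ?f"
        by (intro poly_mod_eqI) (simp add: left_diff_distrib)
      then show ?thesis
        using v n by (simp add: Q_pow mod_binom_id low_smult)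
    qed
    show "Q (P v) = Polynomial.smult q (P (Q v))" if "v \<in> low n" for v
    proof -
      have "Q (P v) = (pCons 0 (B * scale ?z v)) mod ?f"
        using mod_mult_right_eq[of "[:0, 1:]" "B * scale ?z v" ?f] by (simp add: P_def Q_def)
      moreover have "P (Q v) = (B * scale ?z (pCons 0 v)) mod ?f"
        by (simp add: P_def Q_def scale_mod)
      moreover have "pCons 0 (B * scale ?z v) = Polynomial.smult q (B * scale ?z (pCons 0 v))"
        using q by (simp add: pcompose_pCons)
      ultimately show ?thesis
        by (simp add: mod_smult_left)
    qed
  qed (use assms in auto)
  then show ?thesis
    by blast
qed

subsection \<open>Irreducibility\<close>

lemma map_poly_to_ac_mult: "map_poly to_ac (f * g) = map_poly to_ac f * map_poly to_ac g"
  by (rule poly_eqI) (simp add: coeff_map_poly coeff_mult to_ac_sum)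

text \<open>
  If \<open>\<alpha>\<close> is an \<open>m\<close>-th root of \<open>c\<close> in the algebraic closure, the constant coefficient of a factor
  of degree \<open>k\<close> of \<open>X\<^sup>m - c\<close> is a scalar times \<open>\<alpha>\<^sup>k\<close>. The least positive \<open>g\<close> with
  \<open>\<alpha>\<^sup>g\<close> in the ground field therefore divides \<open>k\<close> and \<open>m\<close>, and \<open>c\<close> is an \<open>m/g\<close>-th power.
\<close>

lemma binom_factor_degree:
  fixes c \<omega> :: "'k::field"
  assumes root: "prim_root m \<omega>" and "c \<noteq> 0"
    and no_power: "\<And>k. k dvd m \<Longrightarrow> c \<in> kth_powers k \<Longrightarrow> k = 1"
    and f: "f dvd binom m c"
  shows "degree f = 0 \<or> degree f = m"
proof -
  have m: "0 < m"
    using root by (simp add: prim_root_def)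
  have "binom m c \<noteq> 0"
    using degree_binom[OF m, of c] m by auto
  then have "f \<noteq> 0"
    using f by auto
  have deg: "degree f \<le> m"
    using dvd_imp_degree_le[OF f \<open>binom m c \<noteq> 0\<close>] degree_binom[OF m, of c] by simp
  obtain \<alpha> where \<alpha>: "\<alpha> ^ m = to_ac c"
    using nth_root_exists[OF m] by blast
  have "\<alpha> \<noteq> 0"
    using \<alpha> m \<open>c \<noteq> 0\<close> by (auto simp: power_0_left)
  have root': "prim_root m (to_ac \<omega>)"
    using root by (auto simp: prim_root_def simp flip: to_ac_power to_ac_1)
  \<comment> \<open>Every root is a power of \<omega> times \<alpha>, so a product of
    \<open>k\<close> roots is a ground field element times \<open>\<alpha>^k\<close>.\<close>
  have roots: "\<exists>u. u \<noteq> 0 \<and> x = to_ac u * \<alpha>" if "x ^ m = to_ac c" for x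
  proof -
    have "[:x:] ^ m - [:\<alpha>:] ^ m = 0"
      using that \<alpha> by (simp add: poly_const_pow)
    then have "(\<Prod>i<m. [:x:] - Polynomial.smult (to_ac \<omega> ^ i) [:\<alpha>:]) = 0"
      using power_diff_factorization[OF root', of "[:\<alpha>:]" "[:x:]"] \<open>\<alpha> \<noteq> 0\<close> by simp
    then obtain i where "[:x:] - Polynomial.smult (to_ac \<omega> ^ i) [:\<alpha>:] = 0"
      by (auto simp: prod_zero_iff)
    then have "x = to_ac (\<omega> ^ i) * \<alpha>"
      by simp
    then show ?thesis
      using prim_root_nonzero[OF root] by (intro exI[of _ "\<omega> ^ i"]) simp
  qed
  define F where "F = map_poly to_ac f"
  have "F \<noteq> 0"
    using \<open>f \<noteq> 0\<close> by (auto simp: F_def map_poly_eq_0_iff)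
  have dF: "degree F = degree f"
    unfolding F_def by (rule degree_map_poly) simp
  obtain A where A: "size A = degree F" "F = Polynomial.smult (lead_coeff F) (\<Prod>x\<in>#A. [:-x, 1:])"
    using alg_closed_imp_factorization[OF \<open>F \<noteq> 0\<close>] by blast
  have "F dvd map_poly to_ac (binom m c)"
    using f by (auto simp: F_def map_poly_to_ac_mult)
  also have "map_poly to_ac (binom m c) = Polynomial.monom 1 m - [:to_ac c:]"
    by (rule poly_eqI) (simp add: coeff_map_poly binom_def coeff_pCons split: nat.split)
  finally have F_dvd: "F dvd Polynomial.monom 1 m - [:to_ac c:]" .
  have F_root: "x ^ m = to_ac c" if "poly F x = 0" for x
  proof -
    obtain h where "Polynomial.monom 1 m - [:to_ac c:] = F * h"
      using F_dvd by (rule dvdE)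
    then have "poly (Polynomial.monom 1 m - [:to_ac c:]) x = poly F x * poly h x"
      by simp
    then show ?thesis
      using that by (simp add: poly_monom)
  qed
  have "\<exists>u. u \<noteq> 0 \<and> x = to_ac u * \<alpha>" if "x \<in># A" for x
  proof -
    have "[:-x, 1:] dvd (\<Prod>x\<in>#A. [:-x, 1:])"
      using that by (intro dvd_prod_mset) auto
    then have "poly (\<Prod>x\<in>#A. [:-x, 1:]) x = 0"
      by (simp add: poly_eq_0_iff_dvd)
    then have "poly F x = 0"
      by (subst A(2)) simp
    then show ?thesis
      using roots F_root by blast
  qed
  then have "\<exists>u. u \<noteq> 0 \<and> poly (\<Prod>x\<in>#A. [:-x, 1:]) 0 = to_ac u * \<alpha> ^ size A"
  proof (induct A)
    case empty
    then show ?case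
      by (intro exI[of _ 1]) simp
  next
    case (add x A)
    then obtain u v where uv: "u \<noteq> 0" "x = to_ac u * \<alpha>" "v \<noteq> 0"
      "poly (\<Prod>x\<in>#A. [:-x, 1:]) 0 = to_ac v * \<alpha> ^ size A"
      by (metis add_mset_remove_trivial insert_noteq_member union_single_eq_member insert_iff set_mset_add_mset_insert)
    then show ?case
      by (intro exI[of _ "- u * v"]) (simp add: mult_ac)
  qed
  then obtain u where u: "u \<noteq> 0" "poly (\<Prod>x\<in>#A. [:-x, 1:]) 0 = to_ac u * \<alpha> ^ degree f"
    using A(1) dF by auto
  have "to_ac (coeff f 0) = poly F 0"
    by (simp add: F_def coeff_map_poly poly_0_coeff_0)
  also have "\<dots> = to_ac (lead_coeff f) * (to_ac u * \<alpha> ^ degree f)"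
    using u by (subst A(2)) (simp add: F_def coeff_map_poly dF[unfolded F_def])
  finally have "\<alpha> ^ degree f = to_ac (coeff f 0 / (lead_coeff f * u))"
    using u(1) \<open>f \<noteq> 0\<close> by (simp add: field_simps)
  then have f_mem: "\<alpha> ^ degree f \<in> range to_ac"
    by blast
  define g where "g = (LEAST j. 0 < j \<and> \<alpha> ^ j \<in> range to_ac)"
  have g: "0 < g \<and> \<alpha> ^ g \<in> range to_ac"
    unfolding g_def by (rule LeastI[of _ m]) (use m \<alpha> in auto)
  then obtain v where v: "\<alpha> ^ g = to_ac v"
    by blast
  have g_dvd: "g dvd j" if j: "\<alpha> ^ j \<in> range to_ac" for j
  proof (rule ccontr)
    assume "\<not> g dvd j"
    then have pos: "0 < j mod g"
      by (simp add: dvd_eq_mod_eq_0)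
    obtain w where w: "\<alpha> ^ j = to_ac w"
      using j by blast
    have "\<alpha> ^ j = (\<alpha> ^ g) ^ (j div g) * \<alpha> ^ (j mod g)"
      by (simp flip: power_mult power_add)
    then have "\<alpha> ^ (j mod g) = to_ac (w / v ^ (j div g))"
      using v w \<open>\<alpha> \<noteq> 0\<close> by (auto simp: field_simps)
    then have "\<alpha> ^ (j mod g) \<in> range to_ac"
      by (rule range_eqI)
    then have "(LEAST j. 0 < j \<and> \<alpha> ^ j \<in> range to_ac) \<le> j mod g"
      using pos by (intro Least_le) simp
    then have "g \<le> j mod g"
      by (simp only: g_def[symmetric])
    then show False
      using mod_less_divisor[OF conjunct1[OF g], of j] by simp
  qed
  have "g dvd m"
    using g_dvd[of m] \<alpha> by auto
  then obtain k where k: "m = g * k"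
    by blast
  have "to_ac c = to_ac (v ^ k)"
    using \<alpha> v by (simp add: k power_mult)
  then have "c = v ^ k"
    by (simp only: to_ac_eq_iff)
  then have "c \<in> kth_powers k"
    by (auto simp: kth_powers_def)
  \<comment> \<open>Hence \<open>g = m\<close>, and \<open>g\<close> divides the degree of
    \<open>f\<close>.\<close>
  then have "k = 1"
    using k by (intro no_power) auto
  then have "m dvd degree f"
    using g_dvd[OF f_mem] k by simp
  then show ?thesis
    using deg m by (auto elim!: dvdE)
qed

section \<open>The exponents m(s) and m(s,a)\<close>

lemma m1_props:
  fixes s :: "'k::field"
  assumes "0 < n"
  shows "0 < m1 n s" "m1 n s dvd n"
    "\<And>k. 0 < k \<Longrightarrow> k dvd n \<Longrightarrow> s \<in> kth_powers k \<Longrightarrow> k \<le> m1 n s"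
proof -
  let ?K = "{k. k \<ge> 1 \<and> k dvd n \<and> s \<in> kth_powers k}"
  have fin: "finite ?K"
    using assms by (auto intro!: finite_subset[of ?K "{..n}"] dest: dvd_imp_le)
  have "s \<in> kth_powers 1"
    by (simp add: kth_powers_def)
  then have "1 \<in> ?K"
    by simp
  then have "Max ?K \<in> ?K"
    using fin by (intro Max_in) auto
  then show "0 < m1 n s" "m1 n s dvd n"
    by (auto simp: m1_def)
  show "\<And>k. 0 < k \<Longrightarrow> k dvd n \<Longrightarrow> s \<in> kth_powers k \<Longrightarrow> k \<le> m1 n s"
    unfolding m1_def by (intro Max_ge fin) auto
qed

text \<open>Lets one set of facts about maximal exponents cover both numbers.\<close>

lemma m2_eq_m1: "m2 n s a = m1 (n div m1 n s) a"
  by (simp add: m1_def m2_def)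

text \<open>A k-th root of \<open>x\<close> would make \<open>a\<close> a power with exponent
  \<open>m1 n a * k\<close>, still a divisor of \<open>n\<close>, against maximality unless
  \<open>k = 1\<close>.\<close>

lemma m1_root_no_power:
  fixes a :: "'k::field"
  assumes "0 < n" "x ^ m1 n a = a" and k: "k dvd n div m1 n a" "x \<in> kth_powers k"
  shows "k = 1"
proof -
  define M where "M = m1 n a"
  note m1 = m1_props[OF \<open>0 < n\<close>, where s = a, folded M_def]
  obtain j where j: "n = M * j"
    using m1(2) by blast
  have "n div M = j"
    using j m1(1) by simp
  then have "k dvd j"
    using k(1) by (simp add: M_def)
  then have "0 < k" "M * k dvd n"
    using j \<open>0 < n\<close> by (auto intro: Nat.gr0I)
  obtain u where "x = u ^ k"
    using k(2) by (auto simp: kth_powers_def)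
  then have "a = u ^ (M * k)"
    using assms(2) by (simp add: M_def power_mult mult.commute)
  then have "a \<in> kth_powers (M * k)"
    unfolding kth_powers_def by blast
  then have "M * k \<le> M"
    using \<open>0 < k\<close> m1(1) \<open>M * k dvd n\<close> by (intro m1(3)) auto
  then show "k = 1"
    using \<open>0 < k\<close> m1(1) by simp
qed

subsection \<open>Quotient algebras\<close>

definition alg_hom :: "('k, 'r) module \<Rightarrow> ('k, 's) module \<Rightarrow> ('r \<Rightarrow> 's) set" where
  "alg_hom A B = {\<Psi> \<in> Ring.ring_hom A B. \<forall>c. \<forall>x\<in>carrier A. \<Psi> (c \<odot>\<^bsub>A\<^esub> x) = c \<odot>\<^bsub>B\<^esub> \<Psi> x}"

lemma alg_homI:
  assumes "\<And>x. x \<in> carrier A \<Longrightarrow> \<Psi> x \<in> carrier B"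
    and "\<And>x y. x \<in> carrier A \<Longrightarrow> y \<in> carrier A \<Longrightarrow> \<Psi> (x \<otimes>\<^bsub>A\<^esub> y) = \<Psi> x \<otimes>\<^bsub>B\<^esub> \<Psi> y"
    and "\<And>x y. x \<in> carrier A \<Longrightarrow> y \<in> carrier A \<Longrightarrow> \<Psi> (x \<oplus>\<^bsub>A\<^esub> y) = \<Psi> x \<oplus>\<^bsub>B\<^esub> \<Psi> y"
    and "\<Psi> \<one>\<^bsub>A\<^esub> = \<one>\<^bsub>B\<^esub>"
    and "\<And>c x. x \<in> carrier A \<Longrightarrow> \<Psi> (c \<odot>\<^bsub>A\<^esub> x) = c \<odot>\<^bsub>B\<^esub> \<Psi> x"
  shows "\<Psi> \<in> alg_hom A B"
  using assms by (auto simp: alg_hom_def intro!: ring_hom_memI)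

lemma alg_homD:
  assumes "\<Psi> \<in> alg_hom A B"
  shows "x \<in> carrier A \<Longrightarrow> \<Psi> x \<in> carrier B"
    and "x \<in> carrier A \<Longrightarrow> y \<in> carrier A \<Longrightarrow> \<Psi> (x \<otimes>\<^bsub>A\<^esub> y) = \<Psi> x \<otimes>\<^bsub>B\<^esub> \<Psi> y"
    and "x \<in> carrier A \<Longrightarrow> y \<in> carrier A \<Longrightarrow> \<Psi> (x \<oplus>\<^bsub>A\<^esub> y) = \<Psi> x \<oplus>\<^bsub>B\<^esub> \<Psi> y"
    and "\<Psi> \<one>\<^bsub>A\<^esub> = \<one>\<^bsub>B\<^esub>"
    and "x \<in> carrier A \<Longrightarrow> \<Psi> (c \<odot>\<^bsub>A\<^esub> x) = c \<odot>\<^bsub>B\<^esub> \<Psi> x"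
  using assms by (auto simp: alg_hom_def Ring.ring_hom_def Pi_def)

lemma quot_alg_simps [simp]:
  "carrier (quot_alg A I) = carrier (A Quot I)"
  "monoid.mult (quot_alg A I) = monoid.mult (A Quot I)"
  "one (quot_alg A I) = one (A Quot I)"
  "ring.zero (quot_alg A I) = ring.zero (A Quot I)"
  "add (quot_alg A I) = add (A Quot I)"
  by (simp_all add: quot_alg_def ring.defs module.defs)

text \<open>Scalars act as left multiplication by \<open>u \<odot> \<one>\<close>, so every ring
  ideal is a subspace and the ring quotient inherits the scalar action.\<close>

locale assoc_alg = ring A for A :: "('k::field, 'r) module" (structure) +
  assumes smult_closed: "x \<in> carrier A \<Longrightarrow> u \<odot> x \<in> carrier A"
    and smult_conv_mult: "x \<in> carrier A \<Longrightarrow> u \<odot> x = (u \<odot> \<one>) \<otimes> x"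
begin

lemma smult_add: "x \<in> carrier A \<Longrightarrow> y \<in> carrier A \<Longrightarrow> u \<odot> (x \<oplus> y) = u \<odot> x \<oplus> u \<odot> y"
  using smult_conv_mult[of x u] smult_conv_mult[of y u] smult_conv_mult[of "x \<oplus> y" u]
  by (simp add: r_distr smult_closed)

lemma smult_ideal: "ideal I A \<Longrightarrow> x \<in> I \<Longrightarrow> u \<odot> x \<in> I"
  using smult_conv_mult[of x u] ideal.I_l_closed[of I A x "u \<odot> \<one>"] ideal.Icarr[of I A x]
  by (simp add: smult_closed)

text \<open>Two representatives differ by an element of the ideal, also after scaling, so the union
  in \<open>quot_alg\<close> is a union of equal cosets.\<close>

lemma quot_alg_smult:
  assumes I: "ideal I A" and x: "x \<in> carrier A"
  shows "u \<odot>\<^bsub>quot_alg A I\<^esub> (I +> x) = I +> (u \<odot> x)"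
proof -
  interpret ideal I A by fact
  have "I +> (u \<odot> y) = I +> (u \<odot> x)" if y: "y \<in> I +> x" for y
  proof -
    obtain i where i: "i \<in> I" "y = i \<oplus> x"
      using y by (auto simp: a_r_coset_def')
    then have "u \<odot> y = u \<odot> i \<oplus> u \<odot> x"
      using x by (simp add: smult_add)
    then have "u \<odot> y \<in> I +> (u \<odot> x)"
      using smult_ideal[OF I i(1)] by (auto simp: a_r_coset_def')
    then show ?thesis
      using a_repr_independence'[of "u \<odot> y" "u \<odot> x"] x by (simp add: smult_closed)
  qed
  moreover have "x \<in> I +> x"
    using x by (rule a_rcos_self)
  ultimately have "(\<Union>y\<in>I +> x. I +> (u \<odot> y)) = I +> (u \<odot> x)"
    by blast
  then show ?thesis
    by (simp add: quot_alg_def ring.defs module.defs)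
qed

lemma quot_map_alg_hom: "ideal I A \<Longrightarrow> (\<lambda>x. I +> x) \<in> alg_hom A (quot_alg A I)"
  using ring_hom_memE[OF ideal.rcos_ring_hom[of I A]] quot_alg_smult[of I]
  by (intro alg_homI) auto

lemma quot_alg_carrier: "carrier (quot_alg A I) = (\<lambda>x. I +> x) ` carrier A"
  by (auto simp: FactRing_def A_RCOSETS_def')

text \<open>The homomorphism theorem in both directions. It trades maps on cosets for maps on
  representatives, where relations and kernels can be computed.\<close>

lemma quot_alg_isomorphic_iff:
  assumes I: "ideal I A" and "ring B"
  shows "quot_alg A I \<simeq>\<^sub>a\<^sub>l\<^sub>g B \<longleftrightarrow>
    (\<exists>\<Psi>\<in>alg_hom A B. \<Psi> ` carrier A = carrier B \<and> (\<forall>x\<in>carrier A. \<Psi> x = \<zero>\<^bsub>B\<^esub> \<longleftrightarrow> x \<in> I))"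
proof
  interpret ideal I A by fact
  interpret B: ring B by fact
  assume "quot_alg A I \<simeq>\<^sub>a\<^sub>l\<^sub>g B"
  then obtain \<phi> where \<phi>: "\<phi> \<in> ring_iso (quot_alg A I) B"
    and lin: "\<And>u Z. Z \<in> carrier (quot_alg A I) \<Longrightarrow> \<phi> (u \<odot>\<^bsub>quot_alg A I\<^esub> Z) = u \<odot>\<^bsub>B\<^esub> \<phi> Z"
    by (auto simp: alg_isomorphic_def alg_iso_def)
  note \<phi>' = ring_iso_memE[OF \<phi>]
  have \<phi>_hom: "\<phi> \<in> Ring.ring_hom (A Quot I) B"
    using \<phi>' by (intro ring_hom_memI) auto
  interpret h: ring_hom_ring "A Quot I" B \<phi>
    using \<phi>_hom quotient_is_ring \<open>ring B\<close> by (rule ring_hom_ringI2[rotated 2])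
  note quot = alg_homD[OF quot_map_alg_hom[OF I]]
  have "(\<lambda>x. \<phi> (I +> x)) \<in> alg_hom A B"
    using quot \<phi>' lin by (intro alg_homI) (simp_all flip: quot_alg_simps)
  moreover have "(\<lambda>x. \<phi> (I +> x)) ` carrier A = carrier B"
    using \<phi>'(5) by (auto simp: bij_betw_def quot_alg_carrier simp del: quot_alg_simps)
  moreover have "\<phi> (I +> x) = \<zero>\<^bsub>B\<^esub> \<longleftrightarrow> x \<in> I" if x: "x \<in> carrier A" for x
  proof -
    have "\<phi> I = \<zero>\<^bsub>B\<^esub>"
      using h.hom_zero by (simp add: FactRing_def)
    moreover have "I \<in> carrier (quot_alg A I)"
      using ring.ring_simprules(2)[OF quotient_is_ring] by (simp add: FactRing_def)
    moreover have "I +> x \<in> carrier (quot_alg A I)"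
      using quot(1) x by blast
    ultimately have "\<phi> (I +> x) = \<zero>\<^bsub>B\<^esub> \<longleftrightarrow> I +> x = I"
      using \<phi>'(5) by (metis bij_betw_def inj_onD)
    also have "\<dots> \<longleftrightarrow> x \<in> I"
      using x a_rcos_const rcos_const_imp_mem by (metis a_rcos_self)
    finally show ?thesis .
  qed
  ultimately show "\<exists>\<Psi>\<in>alg_hom A B. \<Psi> ` carrier A = carrier B \<and> (\<forall>x\<in>carrier A. \<Psi> x = \<zero>\<^bsub>B\<^esub> \<longleftrightarrow> x \<in> I)"
    by (intro bexI[of _ "\<lambda>x. \<phi> (I +> x)"]) auto
next
  interpret ideal I A by fact
  assume "\<exists>\<Psi>\<in>alg_hom A B. \<Psi> ` carrier A = carrier B \<and> (\<forall>x\<in>carrier A. \<Psi> x = \<zero>\<^bsub>B\<^esub> \<longleftrightarrow> x \<in> I)"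
  then obtain \<Psi> where \<Psi>: "\<Psi> \<in> alg_hom A B" "\<Psi> ` carrier A = carrier B"
    and ker: "\<And>x. x \<in> carrier A \<Longrightarrow> \<Psi> x = \<zero>\<^bsub>B\<^esub> \<longleftrightarrow> x \<in> I"
    by blast
  have "\<Psi> \<in> Ring.ring_hom A B"
    using \<Psi>(1) by (simp add: alg_hom_def)
  then interpret h: ring_hom_ring A B \<Psi>
    by (rule ring_hom_ringI2[OF ring_axioms \<open>ring B\<close>])
  have K: "a_kernel A B \<Psi> = I"
    using ker Icarr unfolding a_kernel_def' by blast
  let ?\<phi> = "\<lambda>Z. the_elem (\<Psi> ` Z)"
  have iso: "?\<phi> \<in> ring_iso (A Quot I) B"
    using h.FactRing_iso_set[OF \<Psi>(2)] by (simp add: K)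
  have val: "?\<phi> (I +> x) = \<Psi> x" if "x \<in> carrier A" for x
    using h.the_elem_simp[OF that] by (simp add: K)
  have "?\<phi> \<in> ring_iso (quot_alg A I) B"
    using ring_iso_memE[OF iso] by (intro ring_iso_memI) simp_all
  moreover have "?\<phi> (u \<odot>\<^bsub>quot_alg A I\<^esub> Z) = u \<odot>\<^bsub>B\<^esub> ?\<phi> Z" if "Z \<in> carrier (quot_alg A I)" for u Z
    using that alg_homD(5)[OF \<Psi>(1)]
    by (auto simp: quot_alg_carrier quot_alg_smult[OF I] val smult_closed simp del: quot_alg_simps)
  ultimately show "quot_alg A I \<simeq>\<^sub>a\<^sub>l\<^sub>g B"
    unfolding alg_isomorphic_def alg_iso_def by blast
qed

end

lemma ring_module_mat: "ring (module_mat TYPE('k::field) n n)"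
  using ring_mat[of n "()"]
  by (unfold_locales, insert add_inv_exists_mat)
    (auto simp: module_mat_def Units_def add_mult_distrib_mat mult_add_distrib_mat)

subsection \<open>The algebra on two generators\<close>

type_synonym 'k hx_alg = "hx fword \<Rightarrow>\<^sub>0 'k"

abbreviation const :: "'k::field \<Rightarrow> 'k hx_alg" where
  "const u \<equiv> Poly_Mapping.single 0 u"

lemma free_alg_simps [simp]:
  "carrier free_alg = UNIV"
  "monoid.mult free_alg = (*)"
  "one free_alg = 1"
  "ring.zero free_alg = 0"
  "add free_alg = (+)"
  "u \<odot>\<^bsub>free_alg\<^esub> f = Poly_Mapping.single 0 u * f"
  by (simp_all add: free_alg_def ring.defs module.defs ring_of_type_algebra_def)

lemma assoc_alg_free_alg: "assoc_alg (free_alg :: ('k::field, 'k hx_alg) module)"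
proof -
  have "\<exists>g. f + g = 0" for f :: "'k hx_alg"
    by (rule exI[of _ "- f"]) simp
  then show ?thesis
    by unfold_locales (auto simp: algebra_simps Units_def)
qed

lemma ring_free_alg: "ring (free_alg :: ('k::field, 'k hx_alg) module)"
  using assoc_alg_free_alg by (rule assoc_alg.axioms)

lemma const_mult: "const u * const v = const (u * v)"
  by (simp add: mult_single)

lemma const_add: "const u + const v = const (u + v)"
  by (simp add: single_add)

lemma update_conv_add:
  assumes "w \<notin> Poly_Mapping.keys f"
  shows "Poly_Mapping.update w u f = f + Poly_Mapping.single w u"
  using assms
  by (intro poly_mapping_eqI) (auto simp: lookup_update lookup_add lookup_single when_def in_keys_iff)

lemma free_alg_induct [case_names zero single add]:
  fixes f :: "'k::field hx_alg"
  assumes "R 0" and "\<And>w u. R (Poly_Mapping.single w u)"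
    and "\<And>f g. R f \<Longrightarrow> R g \<Longrightarrow> R (f + g)"
  shows "R f"
  by (induct f rule: update_induct) (use assms in \<open>auto simp: update_conv_add\<close>)

lemma const_commute: "f * const u = const u * f"
  by (induct f rule: free_alg_induct) (simp_all add: mult_single mult.commute distrib_left distrib_right)

lemma const_left_commute: "f * (const u * g) = const u * (f * g)"
  by (simp add: const_commute flip: mult.assoc)

lemma single_conv_const: "Poly_Mapping.single w u = const u * Poly_Mapping.single w 1"
  by (simp add: mult_single)

lemma single_word_Cons: "Poly_Mapping.single (FWord (v # l)) 1 = gen v * (Poly_Mapping.single (FWord l) 1 :: 'k::field hx_alg)"
  by (simp add: gen_def mult_single plus_fword_def)

definition normal_form :: "nat \<Rightarrow> (nat \<times> nat \<Rightarrow> 'k) \<Rightarrow> 'k::field hx_alg" where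
  "normal_form n c = (\<Sum>x\<in>{..<n} \<times> {..<n}. const (c x) * (gen Gen_h ^ fst x * gen Gen_x ^ snd x))"

text \<open>The elements congruent to a normal form include 1 and are stable under left
  multiplication by each generator, hence include every word. An exponent that reaches
  \<open>n\<close> is absorbed by the relation for \<open>h^n\<close> or \<open>x^n\<close>.\<close>

lemma normal_form_spans:
  fixes q s a :: "'k::field"
  assumes I: "ideal I (free_alg :: ('k, 'k hx_alg) module)" and n: "0 < n"
    and rel1: "gen Gen_x * gen Gen_h - const q * gen Gen_h * gen Gen_x \<in> I"
    and rel2: "gen Gen_h ^ n - const s \<in> I"
    and rel3: "gen Gen_x ^ n - const a \<in> I"
  shows "\<exists>c. f - normal_form n c \<in> I"
proof -
  interpret ideal I "free_alg :: ('k, 'k hx_alg) module"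
    by fact
  let ?h = "gen Gen_h :: 'k hx_alg" and ?x = "gen Gen_x :: 'k hx_alg"
  have I_add: "u + v \<in> I" if "u \<in> I" "v \<in> I" for u v
    using additive_subgroup.a_closed[OF additive_subgroup_axioms that] by simp
  have I_left: "u * v \<in> I" if "v \<in> I" for u v
    using I_l_closed[OF that, of u] by simp
  have I_right: "v * u \<in> I" if "v \<in> I" for u v
    using I_r_closed[OF that, of u] by simp
  have I_zero: "0 \<in> I"
    using additive_subgroup.zero_closed[OF additive_subgroup_axioms] by simp
  define S where "S = {f. \<exists>c. f - normal_form n c \<in> I}"
  have S_zero: "0 \<in> S"
  proof -
    have "0 - normal_form n (\<lambda>_. 0) \<in> I"
      using I_zero by (simp add: normal_form_def)
    then show ?thesis
      unfolding S_def by blast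
  qed
  have S_add: "u + v \<in> S" if uv: "u \<in> S" "v \<in> S" for u v
  proof -
    obtain c d where cd: "u - normal_form n c \<in> I" "v - normal_form n d \<in> I"
      using uv by (auto simp: S_def)
    have "normal_form n (\<lambda>x. c x + d x) = normal_form n c + normal_form n d"
      by (simp add: normal_form_def sum.distrib distrib_right flip: const_add)
    then have "u + v - normal_form n (\<lambda>x. c x + d x) \<in> I"
      using I_add[OF cd] by (simp add: algebra_simps)
    then show ?thesis
      by (auto simp: S_def)
  qed
  have S_cong: "u \<in> S" if uv: "u - v \<in> I" "v \<in> S" for u v
  proof -
    obtain c where "v - normal_form n c \<in> I"
      using uv by (auto simp: S_def)
    then have "u - normal_form n c \<in> I"
      using I_add[OF uv(1), of "v - normal_form n c"] by simp
    then show ?thesis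
      by (auto simp: S_def)
  qed
  have S_const: "const u * v \<in> S" if v: "v \<in> S" for u v
  proof -
    obtain c where c: "v - normal_form n c \<in> I"
      using v by (auto simp: S_def)
    have "normal_form n (\<lambda>x. u * c x) = const u * normal_form n c"
      by (simp add: normal_form_def sum_distrib_left mult.assoc flip: const_mult)
    then have "const u * v - normal_form n (\<lambda>x. u * c x) \<in> I"
      using I_left[OF c, of "const u"] by (simp add: right_diff_distrib)
    then show ?thesis
      by (auto simp: S_def)
  qed
  have S_sum: "sum F K \<in> S" if "\<And>x. x \<in> K \<Longrightarrow> F x \<in> S" for F and K :: "(nat \<times> nat) set"
    using that by (induct K rule: infinite_finite_induct) (auto intro: S_zero S_add)
  have S_basis: "?h ^ i * ?x ^ j \<in> S" if "i < n" "j < n" for i j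
  proof -
    have "normal_form n (\<lambda>x. if x = (i, j) then 1 else 0)
        = (\<Sum>x\<in>{..<n} \<times> {..<n}. if x = (i, j) then ?h ^ i * ?x ^ j else 0)"
      unfolding normal_form_def by (intro sum.cong) auto
    also have "\<dots> = ?h ^ i * ?x ^ j"
      using that by (subst sum.delta) simp_all
    finally have "?h ^ i * ?x ^ j - normal_form n (\<lambda>x. if x = (i, j) then 1 else 0) \<in> I"
      using I_zero by simp
    then show ?thesis
      unfolding S_def by blast
  qed
  have S_h: "?h * (?h ^ i * ?x ^ j) \<in> S" if "i < n" "j < n" for i j
  proof (cases "Suc i = n")
    case True
    have "?h * (?h ^ i * ?x ^ j) - const s * (?h ^ 0 * ?x ^ j) = (?h ^ n - const s) * ?x ^ j"
      by (simp add: left_diff_distrib mult.assoc flip: True)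
    then have "?h * (?h ^ i * ?x ^ j) - const s * (?h ^ 0 * ?x ^ j) \<in> I"
      using I_right[OF rel2] by simp
    then show ?thesis
      using S_const[OF S_basis[OF n \<open>j < n\<close>]] by (rule S_cong)
  next
    case False
    then show ?thesis
      using S_basis[of "Suc i" j] that by (simp add: mult.assoc)
  qed
  \<comment> \<open>Carrying \<open>x\<close> past \<open>h^i\<close> costs one factor
    \<open>q\<close> per letter.\<close>
  have x_h: "?x * ?h ^ i - const (q ^ i) * (?h ^ i * ?x) \<in> I" for i
  proof (induct i)
    case 0
    then show ?case
      using I_zero by simp
  next
    case (Suc i)
    have "?x * ?h ^ Suc i - const (q ^ Suc i) * (?h ^ Suc i * ?x)
        = (?x * ?h - const q * ?h * ?x) * ?h ^ i + const q * ?h * (?x * ?h ^ i - const (q ^ i) * (?h ^ i * ?x))"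
      by (simp add: left_diff_distrib right_diff_distrib mult.assoc const_left_commute[of ?h] flip: const_mult)
    then show ?case
      using I_add[OF I_right[OF rel1] I_left[OF Suc]] by simp
  qed
  have S_x: "?x * (?h ^ i * ?x ^ j) \<in> S" if "i < n" "j < n" for i j
  proof -
    have "?x * (?h ^ i * ?x ^ j) - const (q ^ i) * (?h ^ i * ?x ^ Suc j)
        = (?x * ?h ^ i - const (q ^ i) * (?h ^ i * ?x)) * ?x ^ j"
      by (simp add: left_diff_distrib mult.assoc)
    then have 1: "?x * (?h ^ i * ?x ^ j) - const (q ^ i) * (?h ^ i * ?x ^ Suc j) \<in> I"
      using I_right[OF x_h] by simp
    have "?h ^ i * ?x ^ Suc j \<in> S"
    proof (cases "Suc j = n")
      case True
      have "?h ^ i * ?x ^ Suc j - const a * (?h ^ i * ?x ^ 0) = ?h ^ i * (?x ^ n - const a)"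
        unfolding True by (simp add: right_diff_distrib const_commute)
      then have "?h ^ i * ?x ^ Suc j - const a * (?h ^ i * ?x ^ 0) \<in> I"
        using I_left[OF rel3] by simp
      then show ?thesis
        using S_const[OF S_basis[OF \<open>i < n\<close> n]] by (rule S_cong)
    next
      case False
      then show ?thesis
        using S_basis[of i "Suc j"] that by simp
    qed
    then show ?thesis
      using S_cong[OF 1] S_const by blast
  qed
  have S_gen: "gen v * f \<in> S" if f: "f \<in> S" for v f
  proof -
    obtain c where c: "f - normal_form n c \<in> I"
      using f by (auto simp: S_def)
    have "gen v * (const (c x) * (?h ^ fst x * ?x ^ snd x)) \<in> S" if "x \<in> {..<n} \<times> {..<n}" for x
      using S_h S_x S_const that by (cases v) (auto simp: const_left_commute[of "gen _"])
    then have "gen v * normal_form n c \<in> S"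
      by (auto simp: normal_form_def sum_distrib_left intro!: S_sum)
    moreover have "gen v * f - gen v * normal_form n c \<in> I"
      using I_left[OF c] by (simp add: right_diff_distrib)
    ultimately show ?thesis
      using S_cong by blast
  qed
  have S_word: "Poly_Mapping.single (FWord l) 1 \<in> S" for l
  proof (induct l)
    case Nil
    then show ?case
      using S_basis[OF n n] S_basis[of 0 0] n by (simp add: zero_fword_def[symmetric])
  next
    case (Cons v l)
    then show ?case
      by (simp only: single_word_Cons S_gen)
  qed
  have "f \<in> S"
  proof (induct f rule: free_alg_induct)
    case (single w u)
    then show ?case
      using S_word[of "letters w"] by (subst single_conv_const) (simp add: S_const)
  qed (auto intro: S_zero S_add)
  then show ?thesis
    by (simp add: S_def)
qed

section \<open>Action of the free algebra through a pair of operators\<close>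

primrec letter_op :: "('a \<Rightarrow> 'a) \<Rightarrow> ('a \<Rightarrow> 'a) \<Rightarrow> hx \<Rightarrow> 'a \<Rightarrow> 'a" where
  "letter_op P Q Gen_h = P"
| "letter_op P Q Gen_x = Q"

text \<open>With \<open>foldr\<close> the first letter acts last, so concatenation of words becomes
  composition of operators.\<close>

definition word_op :: "('a \<Rightarrow> 'a) \<Rightarrow> ('a \<Rightarrow> 'a) \<Rightarrow> hx fword \<Rightarrow> 'a \<Rightarrow> 'a" where
  "word_op P Q w v = foldr (letter_op P Q) (letters w) v"

definition free_op :: "('k poly \<Rightarrow> 'k poly) \<Rightarrow> ('k poly \<Rightarrow> 'k poly) \<Rightarrow> 'k::field hx_alg \<Rightarrow> 'k poly \<Rightarrow> 'k poly" where
  "free_op P Q f v = (\<Sum>w\<in>Poly_Mapping.keys f. Polynomial.smult (Poly_Mapping.lookup f w) (word_op P Q w v))"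

lemma word_op_add: "word_op P Q (u + w) v = word_op P Q u (word_op P Q w v)"
  by (simp add: word_op_def plus_fword_def)

context twisted_pair
begin

lemma lin_word_op: "lin_op (word_op P Q w)"
proof -
  have "lin_op (foldr (letter_op P Q) l)" for l
  proof (induct l)
    case (Cons v l)
    then show ?case
      using lin_P lin_Q by (cases v) (auto simp: lin_op_def)
  qed (simp add: lin_op_def)
  then show ?thesis
    by (simp add: word_op_def[abs_def])
qed

lemma low_word_op: "v \<in> low n \<Longrightarrow> word_op P Q w v \<in> low n"
proof -
  assume "v \<in> low n"
  then have "foldr (letter_op P Q) l v \<in> low n" for l
  proof (induct l)
    case (Cons y l)
    then show ?case
      by (cases y) (auto intro: low_P low_Q)
  qed simp
  then show ?thesis
    by (simp add: word_op_def)
qed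

lemma free_op_superset:
  "finite W \<Longrightarrow> Poly_Mapping.keys f \<subseteq> W \<Longrightarrow>
    free_op P Q f v = (\<Sum>w\<in>W. Polynomial.smult (Poly_Mapping.lookup f w) (word_op P Q w v))"
  unfolding free_op_def by (rule sum.mono_neutral_left) (auto simp: in_keys_iff)

lemma free_op_zero: "free_op P Q 0 v = 0"
  by (simp add: free_op_def)

lemma free_op_add: "free_op P Q (f + g) v = free_op P Q f v + free_op P Q g v"
  using Poly_Mapping.keys_add[of f g]
  by (simp add: free_op_superset[of "Poly_Mapping.keys f \<union> Poly_Mapping.keys g"] lookup_add smult_add_left sum.distrib)

lemma free_op_single: "free_op P Q (Poly_Mapping.single w u) v = Polynomial.smult u (word_op P Q w v)"
  by (simp add: free_op_superset[of "{w}"])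

lemma lin_free_op: "lin_op (free_op P Q f)"
  unfolding free_op_def[abs_def] by (intro lin_op_sum_fun lin_op_scale lin_word_op)

lemma low_free_op: "v \<in> low n \<Longrightarrow> free_op P Q f v \<in> low n"
  unfolding free_op_def by (intro low_sum low_smult low_word_op)

lemma free_op_mult: "free_op P Q (f * g) v = free_op P Q f (free_op P Q g v)"
proof (induct f rule: free_alg_induct)
  case (single w u)
  show ?case
    by (induct g rule: free_alg_induct)
      (simp_all add: mult_single free_op_single free_op_zero free_op_add word_op_add distrib_left
        lin_op_smult[OF lin_word_op] lin_op_zero[OF lin_word_op] lin_op_add[OF lin_word_op] smult_add_right)
qed (simp_all add: free_op_zero free_op_add distrib_right)

lemma free_op_const: "free_op P Q (const u) v = Polynomial.smult u v"
  by (simp add: free_op_single word_op_def zero_fword_def)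

lemma free_op_1: "free_op P Q 1 v = v"
  using free_op_const[of 1 v] by simp

lemma free_op_gen: "free_op P Q (gen y) v = letter_op P Q y v"
  by (simp add: gen_def free_op_single word_op_def)

lemma free_op_power: "free_op P Q (f ^ k) v = (free_op P Q f ^^ k) v"
  by (induct k arbitrary: v) (simp_all add: free_op_1 free_op_mult)

lemma free_op_gen_power: "free_op P Q (gen y ^ k) v = (letter_op P Q y ^^ k) v"
proof -
  have "free_op P Q (gen y) = letter_op P Q y"
    by (rule ext) (rule free_op_gen)
  then show ?thesis
    by (simp add: free_op_power)
qed

lemma free_op_diff: "free_op P Q (f - g) v = free_op P Q f v - free_op P Q g v"
  using free_op_add[of "f - g" g v] by simp

lemma free_op_sum: "free_op P Q (\<Sum>x\<in>K. F x) v = (\<Sum>x\<in>K. free_op P Q (F x) v)"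
  by (induct K rule: infinite_finite_induct) (simp_all add: free_op_zero free_op_add)

lemma free_op_normal_form:
  "free_op P Q (normal_form n c) v = (\<Sum>x\<in>{..<n} \<times> {..<n}. Polynomial.smult (c x) ((P ^^ fst x) ((Q ^^ snd x) v)))"
  by (simp add: normal_form_def free_op_sum free_op_mult free_op_const free_op_gen_power)

lemma opmat_free_op_hom: "(\<lambda>f. opmat n (free_op P Q f)) \<in> alg_hom free_alg (module_mat TYPE('k) n n)"
proof (rule alg_homI)
  fix f g
  show "opmat n (free_op P Q (f \<otimes>\<^bsub>free_alg\<^esub> g))
    = opmat n (free_op P Q f) \<otimes>\<^bsub>module_mat TYPE('k) n n\<^esub> opmat n (free_op P Q g)"
    using opmat_comp[OF lin_free_op low_free_op] by (simp add: free_op_mult[abs_def] module_mat_simps)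
qed (simp_all add: free_op_add[abs_def] opmat_add free_op_1[abs_def] opmat_id free_op_mult[abs_def]
    free_op_const opmat_smult module_mat_simps)

lemma opmat_free_op_zero_iff:
  "opmat n (free_op P Q f) = 0\<^sub>m n n \<longleftrightarrow> (\<forall>v\<in>low n. free_op P Q f v = 0)"
proof
  assume "opmat n (free_op P Q f) = 0\<^sub>m n n"
  then have *: "opmat n (free_op P Q f) = opmat n (\<lambda>v. 0)"
    by (simp add: opmat_zero)
  show "\<forall>v\<in>low n. free_op P Q f v = 0"
    using opmat_inject[OF * lin_free_op _ low_free_op] by (auto simp: lin_op_def)
next
  assume "\<forall>v\<in>low n. free_op P Q f v = 0"
  then have "opmat n (free_op P Q f) = opmat n (\<lambda>v. 0)"
    by (intro opmat_cong) auto
  then show "opmat n (free_op P Q f) = 0\<^sub>m n n"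
    by (simp add: opmat_zero)
qed

end

section \<open>Splitting of the algebra on two generators\<close>

definition cyc_relators :: "nat \<Rightarrow> 'k::field \<Rightarrow> 'k \<Rightarrow> 'k \<Rightarrow> 'k hx_alg set" where
  "cyc_relators n q s a =
     {gen Gen_x * gen Gen_h - const q * gen Gen_h * gen Gen_x,
      gen Gen_h ^ n - const s, gen Gen_x ^ n - const a}"

text \<open>An isomorphism yields the pair as the images of the generators. Conversely a pair makes
  the free algebra act on \<open>low n\<close>. Modulo the relations every element is a normal form,
  whose coefficients vanish if it acts as zero, so the kernel is exactly the ideal; surjectivity is
  \<open>op_span\<close>.\<close>

lemma cyc_alg_isomorphic_iff:
  fixes q s a :: "'k::field"
  assumes root: "prim_root n q" and "s \<noteq> 0" "a \<noteq> 0"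
  shows "cyc_alg n q s a \<simeq>\<^sub>a\<^sub>l\<^sub>g module_mat TYPE('k) n n \<longleftrightarrow> (\<exists>P Q. twisted_pair n q s a P Q)"
proof -
  let ?A = "free_alg :: ('k, 'k hx_alg) module" and ?M = "module_mat TYPE('k) n n"
  interpret A: assoc_alg ?A
    by (rule assoc_alg_free_alg)
  define I where "I = Idl\<^bsub>?A\<^esub> (cyc_relators n q s a)"
  have I: "ideal I ?A"
    unfolding I_def by (rule A.genideal_ideal) simp
  have rel: "cyc_relators n q s a \<subseteq> I"
    unfolding I_def by (rule A.genideal_self) simp
  then have rels: "gen Gen_x * gen Gen_h - const q * gen Gen_h * gen Gen_x \<in> I"
    "gen Gen_h ^ n - const s \<in> I" "gen Gen_x ^ n - const a \<in> I"
    by (simp_all add: cyc_relators_def)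
  have n: "0 < n"
    using root by (simp add: prim_root_def)
  have iff: "cyc_alg n q s a \<simeq>\<^sub>a\<^sub>l\<^sub>g ?M \<longleftrightarrow>
      (\<exists>\<Psi>\<in>alg_hom ?A ?M. \<Psi> ` UNIV = carrier_mat n n \<and> (\<forall>f. \<Psi> f = 0\<^sub>m n n \<longleftrightarrow> f \<in> I))"
    using A.quot_alg_isomorphic_iff[OF I ring_module_mat[of n]]
    by (simp add: cyc_alg_def I_def cyc_relators_def module_mat_simps)
  show ?thesis
  proof
    assume "cyc_alg n q s a \<simeq>\<^sub>a\<^sub>l\<^sub>g ?M"
    then obtain \<Psi> where \<Psi>: "\<Psi> \<in> alg_hom ?A ?M" and ker: "\<And>f. \<Psi> f = 0\<^sub>m n n \<longleftrightarrow> f \<in> I"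
      unfolding iff by blast
    have \<Psi>_carrier: "\<Psi> f \<in> carrier_mat n n" for f
      using alg_homD(1)[OF \<Psi>] by (simp add: module_mat_simps)
    have \<Psi>_mult: "\<Psi> (f * g) = \<Psi> f * \<Psi> g" for f g
      using alg_homD(2)[OF \<Psi>] by (simp add: module_mat_simps)
    have \<Psi>_add: "\<Psi> (f + g) = \<Psi> f + \<Psi> g" for f g
      using alg_homD(3)[OF \<Psi>] by (simp add: module_mat_simps)
    have \<Psi>_1: "\<Psi> 1 = 1\<^sub>m n"
      using alg_homD(4)[OF \<Psi>] by (simp add: module_mat_simps)
    have \<Psi>_smult: "\<Psi> (const u * f) = u \<cdot>\<^sub>m \<Psi> f" for u f
      using alg_homD(5)[OF \<Psi>] by (simp add: module_mat_simps)
    have \<Psi>_cong: "\<Psi> f = \<Psi> g" if "f - g \<in> I" for f g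
    proof -
      have "\<Psi> f = \<Psi> (f - g) + \<Psi> g"
        by (simp flip: \<Psi>_add)
      also have "\<Psi> (f - g) = 0\<^sub>m n n"
        using ker that by simp
      finally show ?thesis
        using \<Psi>_carrier[of g] by simp
    qed
    have \<Psi>_const: "\<Psi> (const u) = u \<cdot>\<^sub>m 1\<^sub>m n" for u
      using \<Psi>_smult[of u 1] \<Psi>_1 by simp
    have \<Psi>_power: "\<Psi> (f ^ k) = \<Psi> f ^\<^sub>m k" for f k
    proof (induct k)
      case (Suc k)
      then show ?case
        by (simp only: power_Suc2 \<Psi>_mult pow_mat.simps)
    qed (use \<Psi>_carrier[of f] \<Psi>_1 in simp)
    have "\<Psi> (gen Gen_x * gen Gen_h) = q \<cdot>\<^sub>m \<Psi> (gen Gen_h * gen Gen_x)"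
      using \<Psi>_cong[OF rels(1)] by (simp only: \<Psi>_smult mult.assoc)
    then have "\<Psi> (gen Gen_x) * \<Psi> (gen Gen_h) = q \<cdot>\<^sub>m (\<Psi> (gen Gen_h) * \<Psi> (gen Gen_x))"
      by (simp only: \<Psi>_mult)
    then have "twisted_pair n q s a (matop n (\<Psi> (gen Gen_h))) (matop n (\<Psi> (gen Gen_x)))"
      using assms \<Psi>_carrier \<Psi>_cong[OF rels(2)] \<Psi>_cong[OF rels(3)]
      by (intro twisted_pair_matop) (simp_all add: \<Psi>_power \<Psi>_const)
    then show "\<exists>P Q. twisted_pair n q s a P Q"
      by blast
  next
    assume "\<exists>P Q. twisted_pair n q s a P Q"
    then obtain P Q where "twisted_pair n q s a P Q"
      by blast
    then interpret twisted_pair n q s a P Q .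
    let ?\<Psi> = "\<lambda>f. opmat n (free_op P Q f)"
    let ?Z = "{f. \<forall>v\<in>low n. free_op P Q f v = 0}"
    \<comment> \<open>The annihilator of \<open>low n\<close> is a two-sided ideal because
      \<open>low n\<close> is invariant under the action.\<close>
    have "ideal ?Z ?A"
    proof (rule idealI)
      show "subgroup ?Z (add_monoid ?A)"
      proof (rule A.add.subgroupI)
        fix f assume f: "f \<in> ?Z"
        have "\<ominus>\<^bsub>?A\<^esub> f = - f"
          using A.add.inv_equality[of "- f" f] by (simp add: a_inv_def)
        then show "\<ominus>\<^bsub>?A\<^esub> f \<in> ?Z"
          using f free_op_diff[of 0 f] by (simp add: free_op_zero)
      qed (auto simp: free_op_add intro!: exI[of _ 0] free_op_zero)
    qed (auto simp: free_op_mult low_free_op lin_op_zero[OF lin_free_op] ring_free_alg)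
    moreover have "cyc_relators n q s a \<subseteq> ?Z"
      using P_power Q_power twist
      by (auto simp: cyc_relators_def free_op_diff free_op_mult free_op_const free_op_gen free_op_gen_power)
    ultimately have "I \<subseteq> ?Z"
      unfolding I_def by (rule A.genideal_minimal)
    have "f \<in> I" if f: "f \<in> ?Z" for f
    proof -
      obtain c where c: "f - normal_form n c \<in> I"
        using normal_form_spans[OF I n rels] by blast
      then have "free_op P Q (f - normal_form n c) v = 0" if "v \<in> low n" for v
        using \<open>I \<subseteq> ?Z\<close> that by blast
      then have "free_op P Q (normal_form n c) v = 0" if "v \<in> low n" for v
        using f that by (simp add: free_op_diff)
      then have "c x = 0" if "x \<in> {..<n} \<times> {..<n}" for x
        using op_independent[of c] that by (simp add: free_op_normal_form)
      then have "normal_form n c = 0"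
        unfolding normal_form_def by (intro sum.neutral) auto
      then show ?thesis
        using c by simp
    qed
    then have "?\<Psi> f = 0\<^sub>m n n \<longleftrightarrow> f \<in> I" for f
      using \<open>I \<subseteq> ?Z\<close> unfolding opmat_free_op_zero_iff by blast
    moreover have "?\<Psi> ` UNIV = carrier_mat n n"
    proof
      show "carrier_mat n n \<subseteq> ?\<Psi> ` UNIV"
      proof
        fix A :: "'k mat" assume "A \<in> carrier_mat n n"
        then obtain c where "A = opmat n (\<lambda>v. \<Sum>x\<in>{..<n} \<times> {..<n}. Polynomial.smult (c x) ((P ^^ fst x) ((Q ^^ snd x) v)))"
          using op_span by blast
        also have "\<dots> = ?\<Psi> (normal_form n c)"
          by (simp add: free_op_normal_form[abs_def])
        finally show "A \<in> ?\<Psi> ` UNIV"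
          by blast
      qed
    qed auto
    ultimately show "cyc_alg n q s a \<simeq>\<^sub>a\<^sub>l\<^sub>g ?M"
      unfolding iff using opmat_free_op_hom by blast
  qed
qed

subsection \<open>The radical extension and its Galois group\<close>

lemma poly_alg_simps [simp]:
  "carrier poly_alg = UNIV"
  "monoid.mult poly_alg = (*)"
  "one poly_alg = 1"
  "ring.zero poly_alg = 0"
  "add poly_alg = (+)"
  "module.smult poly_alg = Polynomial.smult"
  by (simp_all add: poly_alg_def ring.defs module.defs ring_of_type_algebra_def)

lemma cring_poly_alg: "cring (poly_alg :: ('k::field, 'k poly) module)"
proof -
  have "\<exists>g. f + g = 0" for f :: "'k poly"
    by (rule exI[of _ "- f"]) simp
  then show ?thesis
    by unfold_locales (auto simp: algebra_simps Units_def)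
qed

lemma assoc_alg_poly_alg: "assoc_alg (poly_alg :: ('k::field, 'k poly) module)"
proof -
  interpret cring "poly_alg :: ('k, 'k poly) module"
    by (rule cring_poly_alg)
  show ?thesis
    by unfold_locales simp_all
qed

text \<open>An explicit form of the coset of \<open>p\<close>: equations in the radical extension
  become divisibility statements in F[X].\<close>

definition cls :: "nat \<Rightarrow> 'k::field \<Rightarrow> 'k poly \<Rightarrow> 'k poly set" where
  "cls m c p = {p'. binom m c dvd p' - p}"

lemma cls_eq_iff: "cls m c p = cls m c p' \<longleftrightarrow> binom m c dvd p - p'"
proof
  assume eq: "cls m c p = cls m c p'"
  have "p \<in> cls m c p"
    by (simp add: cls_def)
  then have "p \<in> cls m c p'"
    by (simp only: eq)
  then show "binom m c dvd p - p'"
    by (simp add: cls_def)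
next
  assume *: "binom m c dvd p - p'"
  have "binom m c dvd u - p \<longleftrightarrow> binom m c dvd u - p'" for u
    using dvd_add_left_iff[OF *, of "u - p"] by simp
  then show "cls m c p = cls m c p'"
    by (simp add: cls_def)
qed

lemma radical_ideal:
  "Idl\<^bsub>poly_alg\<^esub> {Polynomial.monom 1 m - [:c:]} = {p. binom m c dvd p}"
proof -
  interpret cring "poly_alg :: ('k::field, 'k poly) module"
    by (rule cring_poly_alg)
  show ?thesis
    using cgenideal_eq_genideal[of "Polynomial.monom 1 m - [:c:]"]
    by (auto simp: cgenideal_def binom_def dvd_def mult.commute)
qed

lemma radical_coset: "Idl\<^bsub>poly_alg\<^esub> {Polynomial.monom 1 m - [:c:]} +>\<^bsub>poly_alg\<^esub> p = cls m c p"
proof -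
  have "u \<in> {p. binom m c dvd p} +>\<^bsub>poly_alg\<^esub> p \<longleftrightarrow> binom m c dvd u - p" for u
  proof
    assume "binom m c dvd u - p"
    then show "u \<in> {p. binom m c dvd p} +>\<^bsub>poly_alg\<^esub> p"
      by (auto simp: a_r_coset_def' intro!: exI[of _ "u - p"])
  qed (auto simp: a_r_coset_def')
  then show ?thesis
    by (auto simp: radical_ideal cls_def)
qed

lemma radical_ext_simps [simp]:
  "carrier (radical_ext m c) = range (cls m c)"
  "cls m c p \<otimes>\<^bsub>radical_ext m c\<^esub> cls m c p' = cls m c (p * p')"
  "\<one>\<^bsub>radical_ext m c\<^esub> = cls m c 1"
  "\<zero>\<^bsub>radical_ext m c\<^esub> = cls m c 0"
  "cls m c p \<oplus>\<^bsub>radical_ext m c\<^esub> cls m c p' = cls m c (p + p')"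
  "u \<odot>\<^bsub>radical_ext m c\<^esub> cls m c p = cls m c (Polynomial.smult u p)"
proof -
  interpret assoc_alg "poly_alg :: ('k::field, 'k poly) module"
    by (rule assoc_alg_poly_alg)
  let ?I = "Idl\<^bsub>poly_alg\<^esub> {Polynomial.monom 1 m - [:c:]}"
  have I: "ideal ?I poly_alg"
    by (rule genideal_ideal) simp
  note hom = alg_homD[OF quot_map_alg_hom[OF I], folded radical_ext_def, unfolded radical_coset]
  show "carrier (radical_ext m c) = range (cls m c)"
    using quot_alg_carrier[of ?I] by (simp add: radical_ext_def radical_coset)
  show "cls m c p \<otimes>\<^bsub>radical_ext m c\<^esub> cls m c p' = cls m c (p * p')"
    "\<one>\<^bsub>radical_ext m c\<^esub> = cls m c 1"
    "cls m c p \<oplus>\<^bsub>radical_ext m c\<^esub> cls m c p' = cls m c (p + p')"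
    "u \<odot>\<^bsub>radical_ext m c\<^esub> cls m c p = cls m c (Polynomial.smult u p)"
    using hom(2)[of p p'] hom(3)[of p p'] hom(4) hom(5)[of p u] by simp_all
  show "\<zero>\<^bsub>radical_ext m c\<^esub> = cls m c 0"
    by (simp add: radical_ext_def FactRing_def radical_ideal cls_def)
qed

lemma cring_radical_ext: "cring (radical_ext m c)"
proof -
  have "\<exists>p'. cls m c (p + p') = cls m c 0" for p
    by (rule exI[of _ "- p"]) simp
  then show ?thesis
    by unfold_locales (auto simp: algebra_simps Units_def)
qed

text \<open>Scaling by \<open>z\<close> and by \<open>inverse z\<close> both preserve the multiples
  of \<open>X^m - c\<close>; the second supplies the preimages that make this an equality of sets
  and not just an inclusion.\<close>

lemma radical_rot_cls:
  assumes "z ^ m = 1" "z \<noteq> 0"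
  shows "radical_rot z (cls m c p) = cls m c (scale z p)"
proof -
  have "u \<in> scale z ` cls m c p \<longleftrightarrow> u \<in> cls m c (scale z p)" for u
  proof
    assume "u \<in> scale z ` cls m c p"
    then obtain p' where "u = scale z p'" "binom m c dvd p' - p"
      by (auto simp: cls_def)
    then show "u \<in> cls m c (scale z p)"
      using dvd_pcompose[of "binom m c" "p' - p" "[:0, z:]"] assms
      by (simp add: cls_def scale_binom pcompose_diff)
  next
    assume "u \<in> cls m c (scale z p)"
    then have "binom m c dvd scale (inverse z) (u - scale z p)"
      using dvd_pcompose[of "binom m c" "u - scale z p" "[:0, inverse z:]"] assms
      by (simp add: cls_def scale_binom power_inverse)
    then have "scale (inverse z) u \<in> cls m c p"
      using assms by (simp add: cls_def pcompose_diff pcompose_scale_scale scale_one)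
    moreover have "u = scale z (scale (inverse z) u)"
      using assms by (simp add: pcompose_scale_scale scale_one)
    ultimately show "u \<in> scale z ` cls m c p"
      by blast
  qed
  then show ?thesis
    by (auto simp: radical_rot_def)
qed

lemma radical_rot_iso:
  assumes "z ^ m = 1" "z \<noteq> 0"
  shows "radical_rot z \<in> alg_iso (radical_ext m c) (radical_ext m c)"
proof -
  note [simp] = radical_rot_cls[OF assms]
  have inv: "radical_rot (inverse z) (cls m c p) = cls m c (scale (inverse z) p)" for p
    using assms by (intro radical_rot_cls) (simp_all add: power_inverse)
  have "bij_betw (radical_rot z) (range (cls m c)) (range (cls m c))"
    using assms
    by (intro bij_betw_byWitness[where f' = "radical_rot (inverse z)"])
      (auto simp: inv pcompose_scale_scale scale_one)
  then show ?thesis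
    by (auto simp: alg_iso_def pcompose_mult pcompose_add pcompose_smult pcompose_1 intro!: ring_iso_memI)
qed

lemma alg_hom_radical_ext_cls:
  assumes \<phi>: "\<phi> \<in> alg_hom (radical_ext m c) (radical_ext m c)" and y: "\<phi> (cls m c [:0, 1:]) = cls m c y"
  shows "\<phi> (cls m c p) = cls m c (pcompose p y)"
proof -
  note hom = alg_homD[OF \<phi>]
  have one: "\<phi> (cls m c 1) = cls m c 1"
    using hom(4) by simp
  have mult: "\<phi> (cls m c (p * p')) = \<phi> (cls m c p) \<otimes>\<^bsub>radical_ext m c\<^esub> \<phi> (cls m c p')" for p p'
    using hom(2)[of "cls m c p" "cls m c p'"] by simp
  have add: "\<phi> (cls m c (p + p')) = \<phi> (cls m c p) \<oplus>\<^bsub>radical_ext m c\<^esub> \<phi> (cls m c p')" for p p'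
    using hom(3)[of "cls m c p" "cls m c p'"] by simp
  have smult: "\<phi> (cls m c (Polynomial.smult u p)) = u \<odot>\<^bsub>radical_ext m c\<^esub> \<phi> (cls m c p)" for u p
    using hom(5)[of "cls m c p" u] by simp
  have const: "\<phi> (cls m c [:u:]) = cls m c [:u:]" for u
    using smult[of u 1] one by simp
  show ?thesis
  proof (induct p)
    case 0
    then show ?case
      using const[of 0] by simp
  next
    case (pCons u p)
    have "pCons u p = [:u:] + [:0, 1:] * p"
      by simp
    then have "\<phi> (cls m c (pCons u p)) = cls m c ([:u:] + y * pcompose p y)"
      using pCons by (simp only: add mult const y radical_ext_simps)
    then show ?case
      by (simp add: pcompose_pCons)
  qed
qed

text \<open>An automorphism is determined by the image \<open>y\<close> of X, a root of
  \<open>X^m - c\<close> in the quotient. As \<open>y^m - X^m\<close> splits into the factors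
  \<open>y - z^i X\<close>, irreducibility of \<open>X^m - c\<close> forces one of them to
  vanish.\<close>

lemma Gal_radical_ext:
  fixes c z :: "'k::field"
  assumes z: "prim_root m z"
    and irr: "\<And>f. f dvd binom m c \<Longrightarrow> degree f = 0 \<or> degree f = m"
  shows "Gal (radical_ext m c) = (\<lambda>i. restrict (radical_rot (z ^ i)) (range (cls m c))) ` {..<m}"
proof
  have m: "0 < m" and zi: "(z ^ i) ^ m = 1" "z ^ i \<noteq> 0" for i
    using z prim_root_nonzero[OF z] by (auto simp: prim_root_def simp flip: power_mult) (metis mult.commute power_mult power_one)
  show "(\<lambda>i. restrict (radical_rot (z ^ i)) (range (cls m c))) ` {..<m} \<subseteq> Gal (radical_ext m c)"
  proof (rule image_subsetI)
    fix i
    let ?R = "radical_ext m c"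
    have iso: "radical_rot (z ^ i) \<in> alg_iso ?R ?R"
      using zi by (rule radical_rot_iso)
    then have "radical_rot (z ^ i) \<in> ring_iso ?R ?R"
      by (simp add: alg_iso_def)
    then have "restrict (radical_rot (z ^ i)) (range (cls m c)) \<in> ring_iso ?R ?R"
      by (rule ring.ring_iso_restrict[OF cring.axioms(1)[OF cring_radical_ext]]) simp
    then show "restrict (radical_rot (z ^ i)) (range (cls m c)) \<in> Gal ?R"
      using iso by (auto simp: Gal_def alg_iso_def)
  qed
  show "Gal (radical_ext m c) \<subseteq> (\<lambda>i. restrict (radical_rot (z ^ i)) (range (cls m c))) ` {..<m}"
  proof
    fix \<phi> assume "\<phi> \<in> Gal (radical_ext m c)"
    then have hom: "\<phi> \<in> alg_hom (radical_ext m c) (radical_ext m c)" and ext: "\<phi> \<in> extensional (range (cls m c))"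
      by (auto simp: Gal_def alg_iso_def alg_hom_def ring_iso_def)
    have "\<phi> (cls m c [:0, 1:]) \<in> range (cls m c)"
      using alg_homD(1)[OF hom] by simp
    then obtain y where y: "\<phi> (cls m c [:0, 1:]) = cls m c y"
      by blast
    note val = alg_hom_radical_ext_cls[OF hom y]
    have "cls m c (binom m c) = cls m c 0"
      by (simp add: cls_eq_iff)
    then have "cls m c (pcompose (binom m c) y) = cls m c 0"
      using val[of "binom m c"] val[of 0] by simp
    then have "binom m c dvd y ^ m - [:c:]"
      by (simp add: cls_eq_iff) (simp add: binom_def pcompose_diff pcompose_monom)
    \<comment> \<open>In the quotient the constant \<open>c\<close> may be replaced by
      \<open>X^m\<close>, which produces a difference of m-th powers.\<close>
    then have "binom m c dvd (y ^ m - [:c:]) - binom m c"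
      by simp
    also have "(y ^ m - [:c:]) - binom m c = y ^ m - Polynomial.monom 1 1 ^ m"
      by (simp add: binom_def monom_power)
    also have "\<dots> = (\<Prod>i<m. y - Polynomial.smult (z ^ i) (Polynomial.monom 1 1))"
      using z by (intro power_diff_factorization) (auto simp: monom_eq_0_iff)
    finally have "\<exists>i\<in>{..<m}. binom m c dvd y - Polynomial.smult (z ^ i) (Polynomial.monom 1 1)"
      by (rule irreducible_dvd_prod[rotated 2]) (use irr m in \<open>auto simp: degree_binom[OF m]\<close>)
    then obtain i where i: "i < m" "binom m c dvd y - Polynomial.smult (z ^ i) (Polynomial.monom 1 1)"
      by auto
    have "Polynomial.smult (z ^ i) (Polynomial.monom 1 1) = [:0, z ^ i:]"
      by (simp add: monom_altdef)
    then have y_eq: "cls m c y = cls m c [:0, z ^ i:]"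
      using i by (simp add: cls_eq_iff)
    have "\<phi> (cls m c p) = radical_rot (z ^ i) (cls m c p)" for p
      using alg_hom_radical_ext_cls[OF hom, of "[:0, z ^ i:]" p] y y_eq radical_rot_cls[OF zi] by simp
    then have "\<phi> = restrict (radical_rot (z ^ i)) (range (cls m c))"
      using ext by (auto simp: fun_eq_iff extensional_def)
    then show "\<phi> \<in> (\<lambda>i. restrict (radical_rot (z ^ i)) (range (cls m c))) ` {..<m}"
      using i by blast
  qed
qed

lemma galois_norm_radical_ext:
  fixes c z :: "'k::field"
  assumes z: "prim_root m z"
    and irr: "\<And>f. f dvd binom m c \<Longrightarrow> degree f = 0 \<or> degree f = m"
  shows "galois_norm (radical_ext m c) (cls m c b) = cls m c (twisted_norm m z b)"
proof -
  interpret cring "radical_ext m c"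
    by (rule cring_radical_ext)
  have m: "0 < m" and zi: "(z ^ i) ^ m = 1" "z ^ i \<noteq> 0" for i
    using z prim_root_nonzero[OF z] by (auto simp: prim_root_def simp flip: power_mult) (metis mult.commute power_mult power_one)
  let ?h = "\<lambda>i. restrict (radical_rot (z ^ i)) (range (cls m c))"
  have h: "?h i (cls m c p) = cls m c (scale (z ^ i) p)" for i p
    using radical_rot_cls[OF zi] by simp
  have inj: "inj_on ?h {..<m}"
  proof (rule inj_onI)
    fix i j assume ij: "i \<in> {..<m}" "j \<in> {..<m}" "?h i = ?h j"
    show "i = j"
    \<comment> \<open>For \<open>m = 1\<close> the degree comparison below fails, but then 0 is the
      only index.\<close>
    proof (cases "m = 1")
      case False
      have "cls m c (scale (z ^ i) [:0, 1:]) = cls m c (scale (z ^ j) [:0, 1:])"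
        using ij(3) h by metis
      then have "binom m c dvd [:0, z ^ i - z ^ j:]"
        by (simp add: cls_eq_iff pcompose_pCons)
      moreover have "degree [:0, z ^ i - z ^ j:] < degree (binom m c)"
        using degree_binom[OF m, of c] m False by simp
      ultimately have "[:0, z ^ i - z ^ j:] = 0"
        using dvd_imp_degree_le[of "binom m c" "[:0, z ^ i - z ^ j:]"] by linarith
      then have "z ^ i = z ^ j"
        by simp
      then show ?thesis
        using prim_root_inj_on[OF z] ij by (auto dest: inj_onD)
    qed (use ij in auto)
  qed
  have "galois_norm (radical_ext m c) (cls m c b)
      = (\<Otimes>\<^bsub>radical_ext m c\<^esub>\<phi>\<in>?h ` {..<m}. \<phi> (cls m c b))"
    by (simp only: galois_norm_def Gal_radical_ext[OF z irr])
  also have "\<dots> = (\<Otimes>\<^bsub>radical_ext m c\<^esub>i\<in>{..<m}. ?h i (cls m c b))"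
    using h by (intro finprod_reindex inj) auto
  also have "\<dots> = cls m c (\<Prod>i\<in>{..<m}. scale (z ^ i) b)"
  proof -
    have "(\<Otimes>\<^bsub>radical_ext m c\<^esub>i\<in>K. ?h i (cls m c b)) = cls m c (\<Prod>i\<in>K. scale (z ^ i) b)" if "finite K" for K
      using that
    proof (induct K)
      case (insert i K)
      have "(\<Otimes>\<^bsub>radical_ext m c\<^esub>i\<in>insert i K. ?h i (cls m c b))
          = ?h i (cls m c b) \<otimes>\<^bsub>radical_ext m c\<^esub> (\<Otimes>\<^bsub>radical_ext m c\<^esub>i\<in>K. ?h i (cls m c b))"
        using insert by (intro finprod_insert) (auto simp: h simp del: restrict_apply)
      then show ?case
        using insert by (simp only: h radical_ext_simps prod.insert[OF insert(1,2)])
    qed simp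
    then show ?thesis
      by simp
  qed
  finally show ?thesis
    by (simp add: twisted_norm_def)
qed

lemma norm_condition_iff:
  fixes c z r :: "'k::field"
  assumes z: "prim_root m z" and "r \<noteq> 0"
    and irr: "\<And>f. f dvd binom m c \<Longrightarrow> degree f = 0 \<or> degree f = m"
  shows "(\<exists>b\<in>Units (radical_ext m c). r \<odot>\<^bsub>radical_ext m c\<^esub> \<one>\<^bsub>radical_ext m c\<^esub> = galois_norm (radical_ext m c) b)
    \<longleftrightarrow> (\<exists>b. binom m c dvd twisted_norm m z b - [:r:])"
proof -
  have norm: "r \<odot>\<^bsub>radical_ext m c\<^esub> \<one>\<^bsub>radical_ext m c\<^esub> = galois_norm (radical_ext m c) (cls m c b)
      \<longleftrightarrow> binom m c dvd twisted_norm m z b - [:r:]" for b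
    by (simp add: galois_norm_radical_ext[OF z irr] cls_eq_iff dvd_diff_commute)
  \<comment> \<open>\<open>b\<close> is a factor of its own norm, so the product of the other
    conjugates divided by \<open>r\<close> is an inverse.\<close>
  have unit: "cls m c b \<in> Units (radical_ext m c)" if b: "binom m c dvd twisted_norm m z b - [:r:]" for b
  proof -
    obtain k where k: "m = Suc k"
      using z by (cases m) (auto simp: prim_root_def)
    have "\<exists>p. twisted_norm m z b = p * b"
      unfolding k twisted_norm_Suc by blast
    then obtain p where p: "twisted_norm m z b = p * b"
      by blast
    define p' where "p' = Polynomial.smult (inverse r) p"
    have "p' * b - 1 = Polynomial.smult (inverse r) (twisted_norm m z b - [:r:])"
      using \<open>r \<noteq> 0\<close> by (simp add: p'_def p smult_diff_right one_pCons)
    then have "binom m c dvd p' * b - 1"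
      using b by (simp add: dvd_smult)
    then have "cls m c (p' * b) = cls m c 1"
      by (simp add: cls_eq_iff)
    then show ?thesis
      unfolding Units_def
      by (intro CollectI conjI bexI[of _ "cls m c p'"]) (simp_all add: mult.commute)
  qed
  show ?thesis
  proof
    assume "\<exists>b\<in>Units (radical_ext m c). r \<odot>\<^bsub>radical_ext m c\<^esub> \<one>\<^bsub>radical_ext m c\<^esub> = galois_norm (radical_ext m c) b"
    then obtain \<beta> where \<beta>: "\<beta> \<in> Units (radical_ext m c)"
      "r \<odot>\<^bsub>radical_ext m c\<^esub> \<one>\<^bsub>radical_ext m c\<^esub> = galois_norm (radical_ext m c) \<beta>"
      by blast
    then obtain b where "\<beta> = cls m c b"
      by (auto simp: Units_def)
    then show "\<exists>b. binom m c dvd twisted_norm m z b - [:r:]"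
      using \<beta> norm by blast
  next
    assume "\<exists>b. binom m c dvd twisted_norm m z b - [:r:]"
    then show "\<exists>b\<in>Units (radical_ext m c). r \<odot>\<^bsub>radical_ext m c\<^esub> \<one>\<^bsub>radical_ext m c\<^esub> = galois_norm (radical_ext m c) b"
      using norm unit by blast
  qed
qed

subsection \<open>The skew polynomial quotient\<close>

definition fin_supp :: "(nat \<Rightarrow> 'k::field poly) \<Rightarrow> bool" where
  "fin_supp F \<longleftrightarrow> (\<exists>N. \<forall>i>N. F i = 0)"

definition coeff_at :: "nat \<Rightarrow> 'k::field poly \<Rightarrow> nat \<Rightarrow> 'k poly" where
  "coeff_at k p = (\<lambda>i. if i = k then p else 0)"

text \<open>Multiplication in the skew polynomial ring over F[X] itself, before reduction modulo
  \<open>X^m - c\<close>. It lets products be computed on representatives of the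
  coefficients.\<close>

definition skew_conv :: "'k::field \<Rightarrow> (nat \<Rightarrow> 'k poly) \<Rightarrow> (nat \<Rightarrow> 'k poly) \<Rightarrow> nat \<Rightarrow> 'k poly" where
  "skew_conv z F G = (\<lambda>k. \<Sum>i\<le>k. F i * scale (z ^ i) (G (k - i)))"

lemma fin_supp_coeff_at: "fin_supp (coeff_at k p)"
  by (auto simp: fin_supp_def coeff_at_def)

lemma fin_supp_add:
  assumes "fin_supp F" "fin_supp G"
  shows "fin_supp (\<lambda>i. F i + G i)"
proof -
  obtain N K where "\<forall>i>N. F i = 0" "\<forall>i>K. G i = 0"
    using assms by (auto simp: fin_supp_def)
  then have "\<forall>i>max N K. F i + G i = 0"
    by simp
  then show ?thesis
    unfolding fin_supp_def by blast
qed

lemma skew_conv_bound: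
  assumes "\<forall>i>N. F i = 0" "\<forall>i>K. G i = 0" "N + K < k"
  shows "skew_conv z F G k = 0"
  unfolding skew_conv_def
proof (rule sum.neutral, rule ballI)
  fix i assume "i \<in> {..k}"
  show "F i * scale (z ^ i) (G (k - i)) = 0"
  proof (cases "N < i")
    case False
    then have "K < k - i"
      using assms(3) by linarith
    then show ?thesis
      using assms(2) by simp
  qed (use assms(1) in simp)
qed

lemma fin_supp_skew_conv:
  assumes "fin_supp F" "fin_supp G"
  shows "fin_supp (skew_conv z F G)"
  using assms skew_conv_bound unfolding fin_supp_def by metis

text \<open>Both sides collect the terms \<open>F_i \<sigma>^i(G_j) \<sigma>^(i+j)(K_l)\<close> over
  \<open>i + j + l = k\<close>, where \<sigma> is the scaling by \<open>z\<close>.\<close>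

lemma skew_conv_assoc:
  "skew_conv z (skew_conv z F G) K = skew_conv z F (skew_conv z G K)"
proof
  fix k
  define h where "h i j l = F i * scale (z ^ i) (G j) * scale (z ^ (i + j)) (K l)" for i j l
  have "skew_conv z (skew_conv z F G) K k = (\<Sum>j=0..k. \<Sum>i=0..j. h i (j - i) (k - j))"
    by (simp add: skew_conv_def h_def sum_distrib_right atLeast0AtMost)
  also have "\<dots> = (\<Sum>j=0..k. \<Sum>i=0..k - j. h j i (k - j - i))"
    by (rule fps_mult_assoc_lemma)
  also have "\<dots> = skew_conv z F (skew_conv z G K) k"
    by (simp add: skew_conv_def h_def sum_distrib_left pcompose_sum pcompose_mult pcompose_scale_scale
        power_add mult_ac atLeast0AtMost)
  finally show "skew_conv z (skew_conv z F G) K k = skew_conv z F (skew_conv z G K) k" .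
qed

lemma skew_conv_coeff_at:
  "skew_conv z (coeff_at j p) G = (\<lambda>k. if j \<le> k then p * scale (z ^ j) (G (k - j)) else 0)"
proof
  fix k
  have "skew_conv z (coeff_at j p) G k = (\<Sum>i\<le>k. if i = j then p * scale (z ^ j) (G (k - j)) else 0)"
    unfolding skew_conv_def coeff_at_def by (intro sum.cong) auto
  then show "skew_conv z (coeff_at j p) G k = (if j \<le> k then p * scale (z ^ j) (G (k - j)) else 0)"
    by simp
qed

lemma skew_conv_coeff_at_coeff_at:
  "skew_conv z (coeff_at j p) (coeff_at k p') = coeff_at (j + k) (p * scale (z ^ j) p')"
  unfolding skew_conv_coeff_at by (auto simp: coeff_at_def fun_eq_iff)

lemma skew_conv_one_right: "skew_conv z F (coeff_at 0 1) = F"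
proof
  fix k
  have "skew_conv z F (coeff_at 0 1) k = (\<Sum>i\<le>k. if i = k then F k else 0)"
    unfolding skew_conv_def coeff_at_def by (intro sum.cong) (auto simp: pcompose_1)
  then show "skew_conv z F (coeff_at 0 1) k = F k"
    by simp
qed

lemma skew_conv_one_left: "skew_conv z (coeff_at 0 1) F = F"
  by (simp add: skew_conv_coeff_at scale_one)

lemma skew_conv_add_left:
  "skew_conv z (\<lambda>i. F i + G i) K = (\<lambda>i. skew_conv z F K i + skew_conv z G K i)"
  by (simp add: skew_conv_def distrib_right sum.distrib)

lemma skew_conv_add_right:
  "skew_conv z K (\<lambda>i. F i + G i) = (\<lambda>i. skew_conv z K F i + skew_conv z K G i)"
  by (simp add: skew_conv_def pcompose_add distrib_left sum.distrib)

locale skew_radical =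
  fixes m :: nat and c z :: "'k::field"
  assumes m: "0 < m" and z: "z ^ m = 1"
begin

abbreviation R where "R \<equiv> radical_ext m c"
abbreviation S where "S \<equiv> skew_poly R (radical_rot z)"

definition lift :: "(nat \<Rightarrow> 'k poly) \<Rightarrow> nat \<Rightarrow> 'k poly set" where
  "lift F = (\<lambda>i. cls m c (F i))"

lemma z_nonzero: "z \<noteq> 0"
  using m z by (auto simp: power_0_left)

lemma rot_power: "(radical_rot z ^^ i) (cls m c p) = cls m c (scale (z ^ i) p)"
  by (induct i) (simp_all add: scale_one radical_rot_cls z z_nonzero pcompose_scale_scale mult.commute)

lemma finsum_cls: "finite K \<Longrightarrow> (\<Oplus>\<^bsub>R\<^esub>i\<in>K. cls m c (F i)) = cls m c (\<Sum>i\<in>K. F i)"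
proof (induct K rule: finite_induct)
  interpret cring R
    by (rule cring_radical_ext)
  case (insert i K)
  then show ?case
    by (subst finsum_insert) auto
next
  interpret cring R
    by (rule cring_radical_ext)
  case empty
  then show ?case
    by simp
qed

lemma lift_eqI: "(\<And>i. binom m c dvd F i - G i) \<Longrightarrow> lift F = lift G"
  by (simp add: lift_def cls_eq_iff fun_eq_iff)

text \<open>Coefficients beyond the bound are zero classes and receive the representative 0, so the
  chosen sequence is finitely supported.\<close>

lemma carrier_S: "carrier S = lift ` {F. fin_supp F}"
proof
  show "lift ` {F. fin_supp F} \<subseteq> carrier S"
  proof (rule image_subsetI)
    fix F :: "nat \<Rightarrow> 'k poly" assume "F \<in> {F. fin_supp F}"
    then obtain N where "\<forall>i>N. F i = 0"
      by (auto simp: fin_supp_def)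
    then have "bound \<zero>\<^bsub>R\<^esub> N (lift F)"
      by (auto simp: bound_def lift_def)
    then show "lift F \<in> carrier S"
      by (auto simp: skew_poly_def up_def lift_def)
  qed
  show "carrier S \<subseteq> lift ` {F. fin_supp F}"
  proof
    fix f assume "f \<in> carrier S"
    then obtain N where f: "\<And>i. f i \<in> range (cls m c)" and N: "bound \<zero>\<^bsub>R\<^esub> N f"
      by (auto simp: skew_poly_def up_def)
    have "\<forall>i. \<exists>p. f i = cls m c p \<and> (N < i \<longrightarrow> p = 0)"
    proof
      fix i
      show "\<exists>p. f i = cls m c p \<and> (N < i \<longrightarrow> p = 0)"
        using f[of i] N by (cases "N < i") (auto simp: bound_def)
    qed
    then obtain F where F: "\<And>i. f i = cls m c (F i)" "\<And>i. N < i \<Longrightarrow> F i = 0"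
      by metis
    then have "f = lift F" "fin_supp F"
      by (auto simp: lift_def fin_supp_def)
    then show "f \<in> lift ` {F. fin_supp F}"
      by blast
  qed
qed

lemma S_simps [simp]:
  "lift F \<otimes>\<^bsub>S\<^esub> lift G = lift (skew_conv z F G)"
  "\<one>\<^bsub>S\<^esub> = lift (coeff_at 0 1)"
  "\<zero>\<^bsub>S\<^esub> = lift (\<lambda>i. 0)"
  "lift F \<oplus>\<^bsub>S\<^esub> lift G = lift (\<lambda>i. F i + G i)"
  "u \<odot>\<^bsub>S\<^esub> lift F = lift (\<lambda>i. Polynomial.smult u (F i))"
  "skew_var R = lift (coeff_at 1 1)"
  by (auto simp: skew_poly_def lift_def coeff_at_def skew_var_def skew_conv_def fun_eq_iff
      rot_power finsum_cls)

lemma assoc_alg_S: "assoc_alg S"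
proof -
  have inv: "\<exists>G\<in>{F. fin_supp F}. lift (\<lambda>i. F i + G i) = lift (\<lambda>i. 0)" if "fin_supp F" for F
  proof
    show "(\<lambda>i. - F i) \<in> {F. fin_supp F}"
      using that by (auto simp: fin_supp_def)
  qed simp
  have smult: "fin_supp (\<lambda>i. Polynomial.smult u (F i))" if "fin_supp F" for u F
    using that by (auto simp: fin_supp_def)
  have "ring S"
  proof (rule ringI)
    show "abelian_group S"
    proof (rule abelian_groupI)
      show "\<exists>y\<in>carrier S. y \<oplus>\<^bsub>S\<^esub> x = \<zero>\<^bsub>S\<^esub>" if x: "x \<in> carrier S" for x
      proof -
        obtain F where F: "fin_supp F" "x = lift F"
          using x unfolding carrier_S by blast
        obtain G where "fin_supp G" "lift (\<lambda>i. F i + G i) = lift (\<lambda>i. 0)"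
          using inv[OF F(1)] by blast
        then show ?thesis
          using F by (intro bexI[of _ "lift G"]) (auto simp: carrier_S add.commute)
      qed
    qed (auto simp: carrier_S fin_supp_add add_ac intro!: imageI exI[of _ 0] simp: fin_supp_def[of "\<lambda>i. 0"])
    show "Group.monoid S"
      by (rule monoidI) (auto simp: carrier_S fin_supp_skew_conv fin_supp_coeff_at skew_conv_assoc
          skew_conv_one_left skew_conv_one_right)
  qed (auto simp: carrier_S skew_conv_add_left skew_conv_add_right)
  have unit: "u \<odot>\<^bsub>S\<^esub> lift F = (u \<odot>\<^bsub>S\<^esub> \<one>\<^bsub>S\<^esub>) \<otimes>\<^bsub>S\<^esub> lift F" for u F
  proof -
    have "(\<lambda>i. Polynomial.smult u (coeff_at 0 1 i)) = coeff_at 0 [:u:]"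
      by (auto simp: coeff_at_def fun_eq_iff)
    then show ?thesis
      by (simp add: skew_conv_coeff_at scale_one)
  qed
  show ?thesis
  proof (intro assoc_alg.intro assoc_alg_axioms.intro)
    fix x u assume "x \<in> carrier S"
    then obtain F where F: "fin_supp F" "x = lift F"
      unfolding carrier_S by blast
    show "u \<odot>\<^bsub>S\<^esub> x \<in> carrier S"
      using smult[OF F(1), of u] by (auto simp: carrier_S F(2))
    show "u \<odot>\<^bsub>S\<^esub> x = (u \<odot>\<^bsub>S\<^esub> \<one>\<^bsub>S\<^esub>) \<otimes>\<^bsub>S\<^esub> x"
      unfolding F(2) by (rule unit)
  qed (rule \<open>ring S\<close>)
qed

lemma var_power: "skew_var R [^]\<^bsub>S\<^esub> k = lift (coeff_at k 1)"
proof (induct k)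
  case (Suc k)
  then show ?case
    by (simp add: nat_pow_def skew_conv_coeff_at_coeff_at pcompose_1)
qed (simp add: nat_pow_def)

definition relator :: "'k \<Rightarrow> nat \<Rightarrow> 'k poly" where
  "relator r = (\<lambda>i. coeff_at m 1 i + coeff_at 0 [:- r:] i)"

lemma fin_supp_relator: "fin_supp (relator r)"
  unfolding relator_def by (intro fin_supp_add fin_supp_coeff_at)

lemma relator_eq:
  "skew_var R [^]\<^bsub>S\<^esub> m \<ominus>\<^bsub>S\<^esub> (r \<odot>\<^bsub>S\<^esub> \<one>\<^bsub>S\<^esub>) = lift (relator r)"
proof -
  interpret assoc_alg S
    by (rule assoc_alg_S)
  have const: "(\<lambda>i. Polynomial.smult r (coeff_at 0 1 i)) = coeff_at 0 [:r:]"
    by (auto simp: coeff_at_def fun_eq_iff)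
  have mem: "lift (coeff_at k p) \<in> carrier S" for k p
    by (simp add: carrier_S fin_supp_coeff_at)
  have "lift (coeff_at 0 [:- r:]) \<oplus>\<^bsub>S\<^esub> lift (coeff_at 0 [:r:]) = \<zero>\<^bsub>S\<^esub>"
    by (simp add: coeff_at_def if_distrib[of "\<lambda>x. x + _"] cong: if_cong)
  then have "\<ominus>\<^bsub>S\<^esub> lift (coeff_at 0 [:r:]) = lift (coeff_at 0 [:- r:])"
    using mem by (intro minus_equality)
  then show ?thesis
    unfolding a_minus_def var_power by (simp add: const relator_def)
qed

text \<open>Division by \<open>H^m - r\<close>, which is monic in H: a leading term
  \<open>F_N H^N\<close> is cancelled by the left multiple \<open>F_N H^(N-m) (H^m - r)\<close>, an
  element of the ideal.\<close>

lemma reduce: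
  assumes I: "ideal I S" and rel: "lift (relator r) \<in> I" and "\<forall>i>N. F i = 0"
  shows "\<exists>k\<in>I. \<exists>G. (\<forall>i\<ge>m. G i = 0) \<and> lift F = k \<oplus>\<^bsub>S\<^esub> lift G"
  using assms(3)
proof (induct N arbitrary: F rule: less_induct)
  case (less N)
  interpret ideal I S
    by fact
  show ?case
  proof (cases "N < m")
    case True
    then have "\<forall>i\<ge>m. F i = 0"
      using less(2) by simp
    moreover have "\<zero>\<^bsub>S\<^esub> \<in> I"
      by (rule additive_subgroup.zero_closed[OF additive_subgroup_axioms])
    moreover have "lift F = \<zero>\<^bsub>S\<^esub> \<oplus>\<^bsub>S\<^esub> lift F"
      by simp
    ultimately show ?thesis
      by blast
  next
    case False
    define A where "A = skew_conv z (coeff_at (N - m) (F N)) (relator r)"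
    have "lift (coeff_at (N - m) (F N)) \<in> carrier S"
      by (simp add: carrier_S fin_supp_coeff_at)
    then have "lift A \<in> I"
      using I_l_closed[OF rel, of "lift (coeff_at (N - m) (F N))"] by (simp add: A_def)
    have A: "A = (\<lambda>i. coeff_at N (F N) i + coeff_at (N - m) (Polynomial.smult (- r) (F N)) i)"
      unfolding A_def relator_def skew_conv_add_right skew_conv_coeff_at_coeff_at
      using False by (simp add: pcompose_1 mult.commute)
    define F1 where "F1 = (\<lambda>i. F i - A i)"
    have "\<forall>i>N - 1. F1 i = 0"
      using less(2) m False by (auto simp: F1_def A coeff_at_def)
    moreover have "N - 1 < N"
      using False m by simp
    ultimately obtain k G where k: "k \<in> I" "\<forall>i\<ge>m. G i = 0" "lift F1 = k \<oplus>\<^bsub>S\<^esub> lift G"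
      using less(1) by blast
    have "fin_supp G"
      unfolding fin_supp_def using k(2) by (meson less_imp_le)
    have "lift F = lift A \<oplus>\<^bsub>S\<^esub> lift F1"
      by (simp add: F1_def)
    also have "\<dots> = (lift A \<oplus>\<^bsub>S\<^esub> k) \<oplus>\<^bsub>S\<^esub> lift G"
      unfolding k(3) using Icarr[OF k(1)] Icarr[OF \<open>lift A \<in> I\<close>] \<open>fin_supp G\<close>
      by (subst a_assoc) (auto simp: carrier_S)
    finally have "lift F = (lift A \<oplus>\<^bsub>S\<^esub> k) \<oplus>\<^bsub>S\<^esub> lift G" .
    moreover have "lift A \<oplus>\<^bsub>S\<^esub> k \<in> I"
      using additive_subgroup.a_closed[OF additive_subgroup_axioms \<open>lift A \<in> I\<close> k(1)] .
    ultimately show ?thesis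
      using k(2) by blast
  qed
qed

end

text \<open>A skew polynomial acts with \<open>P\<close> for H and \<open>Q\<close> for X. A
  sequence of infinite support would give the sum 0 by convention, whence the assumptions
  \<open>fin_supp\<close> in the algebraic rules.\<close>

definition skew_op :: "('k poly \<Rightarrow> 'k poly) \<Rightarrow> ('k poly \<Rightarrow> 'k poly) \<Rightarrow> (nat \<Rightarrow> 'k::field poly) \<Rightarrow> 'k poly \<Rightarrow> 'k poly" where
  "skew_op P Q F v = (\<Sum>i | F i \<noteq> 0. evop (F i) Q ((P ^^ i) v))"

lemma skew_op_bound:
  assumes "\<forall>i>N. F i = 0"
  shows "skew_op P Q F v = (\<Sum>i\<le>N. evop (F i) Q ((P ^^ i) v))"
  unfolding skew_op_def
  by (rule sum.mono_neutral_left) (use assms in \<open>auto simp: not_less[symmetric]\<close>)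

text \<open>\<open>Q P = \<omega> P Q\<close> says that \<open>P\<close> moves past \<open>Q\<close>
  at the cost of \<open>inverse \<omega>\<close>, which is the rule \<open>H e = \<tau>(e) H\<close>
  when \<tau> scales X by \<open>inverse \<omega>\<close>.\<close>

locale skew_pair = twisted_pair m \<omega> r c P Q
  for m and \<omega> r c :: "'k::field" and P Q
begin

lemma skew_radical: "skew_radical m (inverse \<omega>)"
  using root by (auto simp: skew_radical_def prim_root_def power_inverse)

sublocale skew_radical m c "inverse \<omega>"
  by (rule skew_radical)

lemma P_evop:
  assumes "v \<in> low m"
  shows "(P ^^ i) (evop f Q v) = evop (scale (inverse \<omega> ^ i) f) Q ((P ^^ i) v)"
proof -
  have "(P ^^ i) ((Q ^^ j) v) = Polynomial.smult ((inverse \<omega> ^ i) ^ j) ((Q ^^ j) ((P ^^ i) v))" for j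
    using twist_power[OF assms, of j i] prim_root_nonzero[OF root]
    by (simp add: power_inverse flip: power_mult)
  then show ?thesis
    using z_nonzero
    by (simp add: evop_def lin_op_sum[OF lin_P_pow] lin_op_smult[OF lin_P_pow] coeff_pcompose_scale
        degree_pcompose mult.commute)
qed

lemma lin_skew_op: "lin_op (skew_op P Q F)"
  unfolding skew_op_def[abs_def]
  by (intro lin_op_sum_fun lin_op_comp[OF lin_op_evop[OF lin_Q] lin_P_pow])

lemma low_skew_op: "v \<in> low m \<Longrightarrow> skew_op P Q F v \<in> low m"
  unfolding skew_op_def by (intro low_sum evop_low low_P_pow low_Q)

lemma skew_op_add:
  assumes "fin_supp F" "fin_supp G"
  shows "skew_op P Q (\<lambda>i. F i + G i) v = skew_op P Q F v + skew_op P Q G v"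
proof -
  obtain N K where "\<forall>i>N. F i = 0" "\<forall>i>K. G i = 0"
    using assms by (auto simp: fin_supp_def)
  then have "\<forall>i>max N K. F i = 0" "\<forall>i>max N K. G i = 0" "\<forall>i>max N K. F i + G i = 0"
    by auto
  then show ?thesis
    by (simp only: skew_op_bound evop_add sum.distrib)
qed

lemma skew_op_smult: "skew_op P Q (\<lambda>i. Polynomial.smult u (F i)) v = Polynomial.smult u (skew_op P Q F v)"
  if fin: "fin_supp F"
proof -
  obtain N where "\<forall>i>N. F i = 0"
    using fin by (auto simp: fin_supp_def)
  moreover from this have "\<forall>i>N. Polynomial.smult u (F i) = 0"
    by simp
  ultimately show ?thesis
    by (simp only: skew_op_bound evop_smult smult_sum_right)
qed

lemma skew_op_coeff_at: "skew_op P Q (coeff_at k p) v = evop p Q ((P ^^ k) v)"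
proof -
  have "\<forall>i>k. coeff_at k p i = 0"
    by (simp add: coeff_at_def)
  then have "skew_op P Q (coeff_at k p) v = (\<Sum>i\<le>k. evop (coeff_at k p i) Q ((P ^^ i) v))"
    by (rule skew_op_bound)
  also have "\<dots> = (\<Sum>i\<le>k. if i = k then evop p Q ((P ^^ k) v) else 0)"
    by (intro sum.cong) (auto simp: coeff_at_def)
  finally show ?thesis
    by simp
qed

lemma skew_op_conv:
  assumes "fin_supp F" "fin_supp G" "v \<in> low m"
  shows "skew_op P Q (skew_conv (inverse \<omega>) F G) v = skew_op P Q F (skew_op P Q G v)"
proof -
  obtain N K where N: "\<forall>i>N. F i = 0" and K: "\<forall>i>K. G i = 0"
    using assms by (auto simp: fin_supp_def)
  define h where "h i j = evop (F i) Q (evop (scale (inverse \<omega> ^ i) (G j)) Q ((P ^^ (i + j)) v))" for i j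
  have h0: "h i j = 0" if "N < i \<or> K < j" for i j
    using that N K by (auto simp: h_def lin_op_zero[OF lin_op_evop[OF lin_Q]])
  have h_nonzero: "i \<le> N \<and> j \<le> K" if "h i j \<noteq> 0" for i j
    using h0[of i j] that by (meson not_le)
  have conv: "\<forall>k>N + K. skew_conv (inverse \<omega>) F G k = 0"
    using skew_conv_bound[OF N K] by blast
  have evop_sum: "evop (\<Sum>i\<in>A. f i) Q w = (\<Sum>i\<in>A. evop (f i) Q w)" for f w and A :: "nat set"
    by (induct A rule: infinite_finite_induct) (simp_all add: evop_add)
  have "skew_op P Q (skew_conv (inverse \<omega>) F G) v = (\<Sum>k\<le>N + K. \<Sum>i\<le>k. h i (k - i))"
    unfolding skew_op_bound[OF conv]
    by (intro sum.cong) (simp_all add: skew_conv_def h_def evop_sum evop_mult[OF lin_Q])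
  also have "\<dots> = (\<Sum>(i, j)\<in>{(i, j). i + j \<le> N + K}. h i j)"
    by (rule sum.triangle_reindex_eq[symmetric])
  \<comment> \<open>The sum runs over a triangle, whereas its nonzero terms lie in a rectangle
    inside it.\<close>
  also have "\<dots> = (\<Sum>(i, j)\<in>{..N} \<times> {..K}. h i j)"
  proof (rule sum.mono_neutral_right)
    show "finite {(i, j). i + j \<le> N + K}"
      by (rule finite_subset[of _ "{..N + K} \<times> {..N + K}"]) auto
  qed (auto dest: h_nonzero)
  also have "\<dots> = (\<Sum>i\<le>N. \<Sum>j\<le>K. h i j)"
    by (simp add: sum.cartesian_product)
  also have "\<dots> = (\<Sum>i\<le>N. evop (F i) Q ((P ^^ i) (\<Sum>j\<le>K. evop (G j) Q ((P ^^ j) v))))"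
    using assms(3)
    by (simp add: h_def P_evop low_P_pow funpow_add lin_op_sum[OF lin_P_pow]
        lin_op_sum[OF lin_op_evop[OF lin_Q]])
  also have "\<dots> = skew_op P Q F (skew_op P Q G v)"
    by (simp only: skew_op_bound[OF N] skew_op_bound[OF K])
  finally show ?thesis .
qed

lemma evop_cong:
  assumes "binom m c dvd f - g" "v \<in> low m"
  shows "evop f Q v = evop g Q v"
proof -
  obtain u where "f - g = u * binom m c"
    using assms(1) by (metis dvdE mult.commute)
  then have "evop (f - g) Q v = 0"
    using Q_power[OF assms(2)]
    by (simp add: evop_mult[OF lin_Q] evop_binom lin_op_zero[OF lin_op_evop[OF lin_Q]])
  then show ?thesis
    by (simp add: evop_diff)
qed

text \<open>Reduction modulo \<open>X^m - c\<close> makes the arbitrary choice canonical; in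
  particular a zero class is represented by 0, so finite support survives.\<close>

definition rep :: "(nat \<Rightarrow> 'k poly set) \<Rightarrow> nat \<Rightarrow> 'k poly" where
  "rep f = (\<lambda>i. (SOME p. f i = cls m c p) mod binom m c)"

lemma rep_lift: "rep (lift F) = (\<lambda>i. F i mod binom m c)"
proof
  fix i
  have "cls m c (F i) = cls m c (SOME p. cls m c (F i) = cls m c p)"
    by (rule someI) (rule refl)
  then have "binom m c dvd (SOME p. cls m c (F i) = cls m c p) - F i"
    by (simp only: cls_eq_iff[symmetric])
  then show "rep (lift F) i = F i mod binom m c"
    unfolding rep_def lift_def by (rule poly_mod_eqI)
qed

lemma skew_op_mod:
  assumes "fin_supp F" "v \<in> low m"
  shows "skew_op P Q (\<lambda>i. F i mod binom m c) v = skew_op P Q F v"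
proof -
  obtain N where N: "\<forall>i>N. F i = 0"
    using assms by (auto simp: fin_supp_def)
  then have N': "\<forall>i>N. F i mod binom m c = 0"
    by simp
  have "evop (F i mod binom m c) Q w = evop (F i) Q w" if "w \<in> low m" for i w
    using that by (intro evop_cong) (simp_all add: dvd_diff_commute[of _ "F i mod _"] minus_mod_eq_mult_div)
  then show ?thesis
    using assms(2) by (simp only: skew_op_bound[OF N] skew_op_bound[OF N'] low_P_pow)
qed

definition skew_hom :: "(nat \<Rightarrow> 'k poly set) \<Rightarrow> 'k mat" where
  "skew_hom f = opmat m (skew_op P Q (rep f))"

lemma skew_hom_lift: "fin_supp F \<Longrightarrow> skew_hom (lift F) = opmat m (skew_op P Q F)"
  unfolding skew_hom_def rep_lift by (intro opmat_cong) (simp add: skew_op_mod)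

lemma skew_hom_alg_hom: "skew_hom \<in> alg_hom S (module_mat TYPE('k) m m)"
proof (rule alg_homI)
  fix x y assume "x \<in> carrier S" "y \<in> carrier S"
  then obtain F G where F: "fin_supp F" "x = lift F" and G: "fin_supp G" "y = lift G"
    unfolding carrier_S by blast
  have "opmat m (skew_op P Q (skew_conv (inverse \<omega>) F G)) = opmat m (\<lambda>v. skew_op P Q F (skew_op P Q G v))"
    by (intro opmat_cong skew_op_conv F G)
  also have "\<dots> = opmat m (skew_op P Q F) * opmat m (skew_op P Q G)"
    by (intro opmat_comp lin_skew_op low_skew_op)
  finally show "skew_hom (x \<otimes>\<^bsub>S\<^esub> y) = skew_hom x \<otimes>\<^bsub>module_mat TYPE('k) m m\<^esub> skew_hom y"
    by (simp add: F G skew_hom_lift fin_supp_skew_conv module_mat_simps)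
  have "opmat m (skew_op P Q (\<lambda>i. F i + G i)) = opmat m (\<lambda>v. skew_op P Q F v + skew_op P Q G v)"
    by (intro opmat_cong skew_op_add F G)
  then show "skew_hom (x \<oplus>\<^bsub>S\<^esub> y) = skew_hom x \<oplus>\<^bsub>module_mat TYPE('k) m m\<^esub> skew_hom y"
    by (simp add: F G skew_hom_lift fin_supp_add module_mat_simps opmat_add)
next
  have "opmat m (skew_op P Q (coeff_at 0 1)) = opmat m (\<lambda>v. v)"
    by (intro opmat_cong) (simp add: skew_op_coeff_at)
  then show "skew_hom \<one>\<^bsub>S\<^esub> = \<one>\<^bsub>module_mat TYPE('k) m m\<^esub>"
    by (simp add: skew_hom_lift fin_supp_coeff_at module_mat_simps opmat_id)
next
  fix x u assume "x \<in> carrier S"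
  then obtain F where F: "fin_supp F" "x = lift F"
    unfolding carrier_S by blast
  then have "fin_supp (\<lambda>i. Polynomial.smult u (F i))"
    by (auto simp: fin_supp_def)
  moreover have "opmat m (skew_op P Q (\<lambda>i. Polynomial.smult u (F i))) = opmat m (\<lambda>v. Polynomial.smult u (skew_op P Q F v))"
    by (intro opmat_cong skew_op_smult F)
  ultimately show "skew_hom (u \<odot>\<^bsub>S\<^esub> x) = u \<odot>\<^bsub>module_mat TYPE('k) m m\<^esub> skew_hom x"
    by (simp add: F skew_hom_lift module_mat_simps opmat_smult)
qed (simp add: skew_hom_def module_mat_simps)

lemma skew_hom_zero_iff:
  assumes "fin_supp F"
  shows "skew_hom (lift F) = 0\<^sub>m m m \<longleftrightarrow> (\<forall>v\<in>low m. skew_op P Q F v = 0)"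
proof
  assume "skew_hom (lift F) = 0\<^sub>m m m"
  then have *: "opmat m (skew_op P Q F) = opmat m (\<lambda>v. 0)"
    by (simp add: skew_hom_lift[OF assms] opmat_zero)
  show "\<forall>v\<in>low m. skew_op P Q F v = 0"
    using opmat_inject[OF * lin_skew_op _ low_skew_op] by (auto simp: lin_op_def)
next
  assume "\<forall>v\<in>low m. skew_op P Q F v = 0"
  then have "opmat m (skew_op P Q F) = opmat m (\<lambda>v. 0)"
    by (intro opmat_cong) auto
  then show "skew_hom (lift F) = 0\<^sub>m m m"
    by (simp add: skew_hom_lift[OF assms] opmat_zero)
qed

text \<open>Coefficients stand to the left of H, so a monomial acts as \<open>Q^j P^i\<close>;
  reordering it to \<open>P^i Q^j\<close> produces \<open>\<omega>^(ij)\<close>.\<close>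

lemma skew_op_reduced:
  assumes "\<forall>i\<ge>m. F i = 0" "\<And>i. F i \<in> low m" and v: "v \<in> low m"
  shows "skew_op P Q F v
    = (\<Sum>x\<in>{..<m} \<times> {..<m}. Polynomial.smult (coeff (F (fst x)) (snd x) * \<omega> ^ (fst x * snd x)) ((P ^^ fst x) ((Q ^^ snd x) v)))"
proof -
  have "skew_op P Q F v = (\<Sum>i<m. evop (F i) Q ((P ^^ i) v))"
    using assms(1) unfolding skew_op_def by (intro sum.mono_neutral_left) (auto simp: not_le[symmetric])
  also have "\<dots> = (\<Sum>i<m. \<Sum>j<m. Polynomial.smult (coeff (F i) j * \<omega> ^ (i * j)) ((P ^^ i) ((Q ^^ j) v)))"
  proof (rule sum.cong[OF refl])
    fix i
    have "degree (F i) \<le> m - 1"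
      using assms(2)[of i] n_pos by (simp add: low_iff_degree)
    then have "evop (F i) Q ((P ^^ i) v) = (\<Sum>j\<le>m - 1. Polynomial.smult (coeff (F i) j) ((Q ^^ j) ((P ^^ i) v)))"
      by (rule evop_bound)
    also have "{..m - 1} = {..<m}"
      using n_pos by auto
    finally show "evop (F i) Q ((P ^^ i) v) = (\<Sum>j<m. Polynomial.smult (coeff (F i) j * \<omega> ^ (i * j)) ((P ^^ i) ((Q ^^ j) v)))"
      using v by (simp add: twist_power)
  qed
  finally show ?thesis
    by (simp add: sum.cartesian_product case_prod_unfold)
qed

lemma skew_hom_surj: "skew_hom ` carrier S = carrier_mat m m"
proof
  show "carrier_mat m m \<subseteq> skew_hom ` carrier S"
  proof
    fix A :: "'k mat" assume "A \<in> carrier_mat m m"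
    then obtain C where C: "A = opmat m (\<lambda>v. \<Sum>x\<in>{..<m} \<times> {..<m}. Polynomial.smult (C x) ((P ^^ fst x) ((Q ^^ snd x) v)))"
      using op_span by blast
    \<comment> \<open>The division compensates for the factor that arises when
      \<open>Q^j P^i\<close> is reordered.\<close>
    define F where "F i = (if i < m then \<Sum>j<m. Polynomial.monom (C (i, j) / \<omega> ^ (i * j)) j else 0)" for i
    have coeff_F: "coeff (F i) j = C (i, j) / \<omega> ^ (i * j)" if "i < m" "j < m" for i j
      using that by (simp add: F_def coeff_sum)
    have F: "\<forall>i\<ge>m. F i = 0" "\<And>i. F i \<in> low m"
      by (auto simp: F_def intro!: low_sum)
    then have fin: "fin_supp F"
      unfolding fin_supp_def by (meson less_imp_le)
    have "opmat m (skew_op P Q F) = A"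
      unfolding C
    proof (rule opmat_cong)
      fix v :: "'k poly" assume v: "v \<in> low m"
      show "skew_op P Q F v = (\<Sum>x\<in>{..<m} \<times> {..<m}. Polynomial.smult (C x) ((P ^^ fst x) ((Q ^^ snd x) v)))"
        unfolding skew_op_reduced[OF F v]
        using prim_root_nonzero[OF root] by (intro sum.cong) (auto simp: coeff_F)
    qed
    then have "A = skew_hom (lift F)"
      by (simp add: skew_hom_lift[OF fin])
    then show "A \<in> skew_hom ` carrier S"
      using fin by (auto simp: carrier_S)
  qed
qed (auto simp: skew_hom_def)

text \<open>Modulo the ideal an element has degree below \<open>m\<close> in H, and its coefficients
  can be reduced modulo \<open>X^m - c\<close>. It then acts as a combination of independent
  monomials, so acting as zero forces all coefficients to vanish.\<close>

lemma skew_hom_kernel: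
  assumes I: "ideal I S" and rel: "lift (relator r) \<in> I" and I_zero: "\<And>x. x \<in> I \<Longrightarrow> skew_hom x = 0\<^sub>m m m"
    and x: "x \<in> carrier S" "skew_hom x = 0\<^sub>m m m"
  shows "x \<in> I"
proof -
  interpret ideal I S
    by fact
  note hom = alg_homD[OF skew_hom_alg_hom]
  obtain F where F: "fin_supp F" "x = lift F"
    using x unfolding carrier_S by blast
  then obtain N where "\<forall>i>N. F i = 0"
    by (auto simp: fin_supp_def)
  then obtain k G where k: "k \<in> I" and G: "\<forall>i\<ge>m. G i = 0" and x_eq: "x = k \<oplus>\<^bsub>S\<^esub> lift G"
    using reduce[OF I rel] F by blast
  have fin: "fin_supp G"
    unfolding fin_supp_def using G by (meson less_imp_le)
  then have mem: "lift G \<in> carrier S"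
    by (simp add: carrier_S)
  have "skew_hom (lift G) = 0\<^sub>m m m"
    using hom(3)[OF Icarr[OF k] mem] hom(1)[OF mem] x(2) I_zero[OF k] by (simp add: x_eq module_mat_simps)
  then have zero: "skew_op P Q G v = 0" if "v \<in> low m" for v
    using skew_hom_zero_iff[OF fin] that by blast
  define K where "K = (\<lambda>i. G i mod binom m c)"
  have K: "\<forall>i\<ge>m. K i = 0" "\<And>i. K i \<in> low m"
    using G n_pos by (simp_all add: K_def mod_binom_low)
  have "poly.coeff (K (fst y)) (snd y) * \<omega> ^ (fst y * snd y) = 0" if y: "y \<in> {..<m} \<times> {..<m}" for y
  proof (rule op_independent[OF _ y])
    fix v :: "'k poly" assume v: "v \<in> low m"
    show "(\<Sum>x\<in>{..<m} \<times> {..<m}. Polynomial.smult (poly.coeff (K (fst x)) (snd x) * \<omega> ^ (fst x * snd x)) ((P ^^ fst x) ((Q ^^ snd x) v))) = 0"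
      using zero[OF v] skew_op_mod[OF fin v] skew_op_reduced[OF K v] by (simp add: K_def)
  qed
  then have coeff_K: "poly.coeff (K i) j = 0" if "i < m" "j < m" for i j
    using that prim_root_nonzero[OF root] by force
  have "K i = 0" for i
  proof (cases "i < m")
    case True
    show ?thesis
    proof (rule poly_eqI)
      fix j
      show "poly.coeff (K i) j = poly.coeff 0 j"
        using coeff_K[OF True, of j] K(2)[of i] by (cases "j < m") (auto simp: low_def)
    qed
  qed (use K in simp)
  then have G_zero: "lift G = \<zero>\<^bsub>S\<^esub>"
    unfolding S_simps by (intro lift_eqI) (simp add: K_def mod_eq_0_iff_dvd)
  show ?thesis
    unfolding x_eq G_zero r_zero[OF Icarr[OF k]] by (rule k)
qed

end

text \<open>The counterpart for H and X in place of h and x: the relations are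
  \<open>XH = \<omega> HX\<close>, \<open>H^m = r\<close> and \<open>X^m = c\<close>, the last being
  built into the coefficient ring.\<close>

lemma skew_cyc_alg_isomorphic_iff:
  fixes \<omega> r c :: "'k::field"
  assumes root: "prim_root m \<omega>" and "r \<noteq> 0" "c \<noteq> 0"
  shows "skew_cyc_alg (radical_ext m c) (radical_rot (inverse \<omega>)) m r \<simeq>\<^sub>a\<^sub>l\<^sub>g module_mat TYPE('k) m m
    \<longleftrightarrow> (\<exists>P Q. twisted_pair m \<omega> r c P Q)"
proof -
  let ?M = "module_mat TYPE('k) m m"
  interpret skew_radical m c "inverse \<omega>"
    using root by (auto simp: skew_radical_def prim_root_def power_inverse)
  interpret A: assoc_alg S
    by (rule assoc_alg_S)
  define I where "I = Idl\<^bsub>S\<^esub> {lift (relator r)}"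
  have mem: "lift F \<in> carrier S" if "fin_supp F" for F
    using that by (simp add: carrier_S)
  have I: "ideal I S"
    unfolding I_def by (rule A.genideal_ideal) (simp add: mem fin_supp_relator)
  have rel: "lift (relator r) \<in> I"
    unfolding I_def by (rule A.genideal_self') (simp add: mem fin_supp_relator)
  have iff: "skew_cyc_alg R (radical_rot (inverse \<omega>)) m r \<simeq>\<^sub>a\<^sub>l\<^sub>g ?M \<longleftrightarrow>
      (\<exists>\<Psi>\<in>alg_hom S ?M. \<Psi> ` carrier S = carrier_mat m m \<and> (\<forall>x\<in>carrier S. \<Psi> x = 0\<^sub>m m m \<longleftrightarrow> x \<in> I))"
    using A.quot_alg_isomorphic_iff[OF I ring_module_mat[of m]]
    by (simp only: skew_cyc_alg_def Let_def relator_eq I_def module_mat_simps)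
  show ?thesis
  proof
    assume "skew_cyc_alg R (radical_rot (inverse \<omega>)) m r \<simeq>\<^sub>a\<^sub>l\<^sub>g ?M"
    then obtain \<Psi> where \<Psi>: "\<Psi> \<in> alg_hom S ?M" and ker: "\<And>x. x \<in> carrier S \<Longrightarrow> \<Psi> x = 0\<^sub>m m m \<longleftrightarrow> x \<in> I"
      unfolding iff by blast
    note hom = alg_homD[OF \<Psi>, unfolded module_mat_simps]
    let ?e = "\<lambda>k p. \<Psi> (lift (coeff_at k p))"
    have at_mem: "lift (coeff_at k p) \<in> carrier S" for k p
      by (simp add: mem fin_supp_coeff_at)
    have car: "?e k p \<in> carrier_mat m m" for k p
      using hom(1)[OF at_mem] .
    have mult: "?e j p * ?e k p' = ?e (j + k) (p * scale (inverse \<omega> ^ j) p')" for j k p p'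
      using hom(2)[OF at_mem at_mem] by (simp add: skew_conv_coeff_at_coeff_at)
    have one: "?e 0 1 = 1\<^sub>m m"
      using hom(4) by simp
    have smult: "?e k (Polynomial.smult u p) = u \<cdot>\<^sub>m ?e k p" for k u p
    proof -
      have "(\<lambda>i. Polynomial.smult u (coeff_at k p i)) = coeff_at k (Polynomial.smult u p)"
        by (auto simp: coeff_at_def fun_eq_iff)
      then show ?thesis
        using hom(5)[OF at_mem, of u k p] by simp
    qed
    have const: "?e 0 [:u:] = u \<cdot>\<^sub>m 1\<^sub>m m" for u
      using smult[of 0 u 1] one by simp
    define A where "A = ?e 1 1"
    define B where "B = ?e 0 [:0, 1:]"
    have A_power: "A ^\<^sub>m k = ?e k 1" for k
    proof (induct k)
      case (Suc k)
      then show ?case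
        using mult[of k 1 1 1] by (simp add: A_def pcompose_1)
    qed (use one in \<open>simp add: A_def carrier_matD[OF car]\<close>)
    have B_power: "B ^\<^sub>m k = ?e 0 (Polynomial.monom 1 k)" for k
    proof (induct k)
      case (Suc k)
      then show ?case
        using mult[of 0 "Polynomial.monom 1 k" 0 "[:0, 1:]"]
        by (simp add: B_def scale_one monom_Suc mult.commute)
    qed (use one in \<open>simp add: B_def monom_eq_1 carrier_matD[OF car]\<close>)
    have "B * A = ?e 1 [:0, 1:]"
      using mult[of 0 "[:0, 1:]" 1 1] by (simp add: A_def B_def pcompose_1)
    \<comment> \<open>This is \<open>H X = \<tau>(X) H\<close>, with the coefficient moved to the
      left.\<close>
    moreover have "A * B = inverse \<omega> \<cdot>\<^sub>m ?e 1 [:0, 1:]"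
      using mult[of 1 1 0 "[:0, 1:]"] smult[of 1 "inverse \<omega>" "[:0, 1:]"]
      by (simp add: A_def B_def pcompose_pCons)
    moreover have "\<omega> \<cdot>\<^sub>m (inverse \<omega> \<cdot>\<^sub>m Z) = Z" for Z
      using prim_root_nonzero[OF root] by (intro eq_matI) simp_all
    ultimately have BA: "B * A = \<omega> \<cdot>\<^sub>m (A * B)"
      by simp
    have "lift (coeff_at m 1) = lift (relator r) \<oplus>\<^bsub>S\<^esub> lift (coeff_at 0 [:r:])"
      by (simp add: relator_def add.assoc) (simp add: coeff_at_def if_distrib[of "\<lambda>x. x + _"] cong: if_cong)
    then have "?e m 1 = \<Psi> (lift (relator r)) + ?e 0 [:r:]"
      using hom(3)[OF mem[OF fin_supp_relator] at_mem] by simp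
    also have "\<Psi> (lift (relator r)) = 0\<^sub>m m m"
      using ker[OF mem[OF fin_supp_relator]] rel by simp
    finally have "A ^\<^sub>m m = r \<cdot>\<^sub>m 1\<^sub>m m"
      using car[of 0 "[:r:]"] by (simp add: A_power const)
    moreover have "B ^\<^sub>m m = c \<cdot>\<^sub>m 1\<^sub>m m"
    proof -
      have "lift (coeff_at 0 (Polynomial.monom 1 m)) = lift (coeff_at 0 [:c:])"
        by (rule lift_eqI) (simp add: coeff_at_def binom_def)
      then show ?thesis
        by (simp add: B_power const)
    qed
    ultimately have "twisted_pair m \<omega> r c (matop m A) (matop m B)"
      using assms BA car by (intro twisted_pair_matop) (simp_all add: A_def B_def)
    then show "\<exists>P Q. twisted_pair m \<omega> r c P Q"
      by blast
  next
    assume "\<exists>P Q. twisted_pair m \<omega> r c P Q"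
    then obtain P Q where "twisted_pair m \<omega> r c P Q"
      by blast
    then interpret skew_pair m \<omega> r c P Q
      by (rule skew_pair.intro)
    note hom = alg_homD[OF skew_hom_alg_hom, unfolded module_mat_simps]
    interpret h: ring_hom_ring S ?M skew_hom
      using skew_hom_alg_hom by (intro ring_hom_ringI2 A.ring_axioms ring_module_mat) (simp add: alg_hom_def)
    have rel_zero: "skew_hom (lift (relator r)) = 0\<^sub>m m m"
      unfolding skew_hom_zero_iff[OF fin_supp_relator]
    proof
      fix v :: "'k poly" assume v: "v \<in> low m"
      have "skew_op P Q (relator r) v = (P ^^ m) v + evop [:- r:] Q v"
        unfolding relator_def skew_op_add[OF fin_supp_coeff_at fin_supp_coeff_at] skew_op_coeff_at by simp
      then show "skew_op P Q (relator r) v = 0"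
        using P_power[OF v] by simp
    qed
    have "lift (relator r) \<in> a_kernel S ?M skew_hom"
      unfolding a_kernel_def' by (intro CollectI conjI mem fin_supp_relator) (simp only: rel_zero module_mat_simps)
    then have "{lift (relator r)} \<subseteq> a_kernel S ?M skew_hom"
      by blast
    then have "I \<subseteq> a_kernel S ?M skew_hom"
      unfolding I_def by (rule A.genideal_minimal[OF h.kernel_is_ideal])
    then have I_zero: "skew_hom x = 0\<^sub>m m m" if "x \<in> I" for x
      using subsetD[OF _ that] unfolding a_kernel_def' module_mat_simps by blast
    show "skew_cyc_alg R (radical_rot (inverse \<omega>)) m r \<simeq>\<^sub>a\<^sub>l\<^sub>g ?M"
      unfolding iff using skew_hom_alg_hom skew_hom_surj skew_hom_kernel[OF I rel I_zero] I_zero by blast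
  qed
qed

subsection \<open>The equivalences\<close>

theorem proposition2p23:
  fixes n :: nat and q s a s_root a_root :: "'k::field"
  assumes "n \<ge> 2"
    and "q ^ n = 1" and "\<forall>k. 0 < k \<and> k < n \<longrightarrow> q ^ k \<noteq> 1"
    and "s \<noteq> 0" and "a \<noteq> 0"
    and "s_root ^ m1 n s = s"
    and "a_root ^ m2 n s a = a"
  shows
    "let M = m1 n s * m2 n s a;
         m = n div M;
         E' = radical_ext m a_root;
         \<tau>' = radical_rot (inverse (q ^ M));
         E'' = skew_cyc_alg E' \<tau>' m s_root
     in (cyc_alg n q s a \<simeq>\<^sub>a\<^sub>l\<^sub>g module_mat TYPE('k) n n
           \<longleftrightarrow> E'' \<simeq>\<^sub>a\<^sub>l\<^sub>g module_mat TYPE('k) m m) \<and>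
        (E'' \<simeq>\<^sub>a\<^sub>l\<^sub>g module_mat TYPE('k) m m
           \<longleftrightarrow> (\<exists>b\<in>Units E'. s_root \<odot>\<^bsub>E'\<^esub> \<one>\<^bsub>E'\<^esub> = galois_norm E' b))"
proof -
  define d where "d = m1 n s"
  define e where "e = m2 n s a"
  define m where "m = n div (d * e)"
  define \<omega> where "\<omega> = q ^ (d * e)"
  have root: "prim_root n q" and n: "0 < n"
    using assms(1-3) by (auto simp: prim_root_def)
  have d: "0 < d" "d dvd n"
    using m1_props[OF n, where s = s] by (auto simp: d_def)
  then have nd: "0 < n div d"
    using n by (auto elim!: dvdE)
  have e_eq: "e = m1 (n div d) a"
    by (simp add: e_def d_def m2_eq_m1)
  then have e: "0 < e" "e dvd n div d"
    using m1_props[OF nd, where s = a] by auto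
  have m_eq: "m = n div d div e"
    by (simp add: m_def div_mult2_eq)
  have n_eq: "n = d * e * m"
    using d e by (simp add: m_eq mult.assoc)
  have roots: "s_root ^ d = s" "a_root ^ e = a"
    using assms by (simp_all add: d_def e_def)
  have nonzero: "s_root \<noteq> 0" "a_root \<noteq> 0"
    using roots assms d e by (auto simp: power_0_left)
  have \<omega>: "prim_root m \<omega>"
    unfolding \<omega>_def using root by (intro prim_root_power) (simp add: n_eq)
  have irr: "degree f = 0 \<or> degree f = m" if "f dvd binom m a_root" for f
  proof (rule binom_factor_degree[OF \<omega> nonzero(2) _ that])
    show "k = 1" if "k dvd m" "a_root \<in> kth_powers k" for k
      by (rule m1_root_no_power[OF nd, of a_root a]) (use that roots in \<open>simp_all add: e_eq m_eq\<close>)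
  qed
  \<comment> \<open>The congruence to which each of the three statements is reduced.\<close>
  define N where "N \<longleftrightarrow> (\<exists>b. binom m a_root dvd twisted_norm m (inverse \<omega>) b - [:s_root:])"
  have full: "cyc_alg n q s a \<simeq>\<^sub>a\<^sub>l\<^sub>g module_mat TYPE('k) n n \<longleftrightarrow> N"
    unfolding cyc_alg_isomorphic_iff[OF root assms(4,5)]
  proof
    assume "\<exists>P Q. twisted_pair n q s a P Q"
    then obtain P Q where pair: "twisted_pair n q s a P Q"
      by blast
    interpret twisted_pair_roots n q s a P Q d e m s_root a_root
      by (intro twisted_pair_roots.intro pair twisted_pair_roots_axioms.intro n_eq roots)
    show N
      unfolding N_def \<omega>_def using norm_exists irr by blast
  next
    assume N
    then obtain b where "binom m a_root dvd twisted_norm m (inverse (q ^ (d * e))) b - [:s_root:]"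
      by (auto simp: N_def \<omega>_def)
    then obtain B where "binom n a dvd twisted_norm n (inverse q) B - [:s:]"
      using twisted_norm_lift[OF root n_eq nonzero(2) roots] by blast
    then show "\<exists>P Q. twisted_pair n q s a P Q"
      using twisted_pair_of_norm root assms(4,5) by blast
  qed
  have skew: "skew_cyc_alg (radical_ext m a_root) (radical_rot (inverse \<omega>)) m s_root \<simeq>\<^sub>a\<^sub>l\<^sub>g module_mat TYPE('k) m m \<longleftrightarrow> N"
    unfolding skew_cyc_alg_isomorphic_iff[OF \<omega> nonzero]
  proof
    assume "\<exists>P Q. twisted_pair m \<omega> s_root a_root P Q"
    then obtain P Q where pair: "twisted_pair m \<omega> s_root a_root P Q"
      by blast
    \<comment> \<open>The pair already has size \<open>m\<close> and its parameters are the
      extracted roots, so \<open>d = e = 1\<close>.\<close>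
    interpret twisted_pair_roots m \<omega> s_root a_root P Q 1 1 m s_root a_root
      by (intro twisted_pair_roots.intro pair twisted_pair_roots_axioms.intro) simp_all
    show N
      unfolding N_def using norm_exists irr by simp
  next
    assume N
    then show "\<exists>P Q. twisted_pair m \<omega> s_root a_root P Q"
      unfolding N_def using twisted_pair_of_norm \<omega> nonzero by blast
  qed
  have norm: "(\<exists>b\<in>Units (radical_ext m a_root). s_root \<odot>\<^bsub>radical_ext m a_root\<^esub> \<one>\<^bsub>radical_ext m a_root\<^esub>
      = galois_norm (radical_ext m a_root) b) \<longleftrightarrow> N"
    unfolding N_def by (rule norm_condition_iff[OF prim_root_inverse[OF \<omega>] nonzero(1) irr])
  show ?thesis
    unfolding Let_def d_def[symmetric] e_def[symmetric] m_def[symmetric] \<omega>_def[symmetric]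
    using full skew norm by blast
qed

end
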